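(* Let $W$ be a positive random variable with $\mathbf{E}[W^4]<\infty$, and let $\mathcal{C}_n$ be the cycle-counting point process of the generalised random graph on $n$ vertices with weight distribution that of $W$. Let $\eta$ be a Poisson point process on $\mathbb{N}_{\geq 3}$ with intensity measure given by $\lambda(\{k\})=\lambda_k$, $k\in\mathbb{N}_{\ge 3}$. Then for all $N\in\mathbb{N}$ there exists a constant $C>0$ such that for all $A\subseteq\{3,4,\dots,N\}$ and all $n\geq 3$, $$d_{TV}(\mathcal{C}_n(A),\eta(A))\leq\frac{C}{n}.$$
   Context: Generalised random graph: for $n\in\mathbb{N}$ the vertex set is $[n]=\{1,\dots,n\}$, the vertices carry i.i.d. weights $W_1,\dots,W_n$ distributed as the positive random variable $W$, and $L_n=\sum_{i=1}^n W_i$. Conditionally on the weights, any two distinct vertices $i,j\in[n]$ are joined by an edge independently with probability $\frac{W_iW_j}{W_iW_j+L_n}$. $\mathbb{N}_{\geq 3}=\{3,4,\dots\}$. For $A\subseteq\mathbb{N}_{\ge 3}$, $\mathcal{C}_n(A)$ is the number of cycles (as subgraphs, each counted once irrespective of starting vertex and orientation) in the graph whose length lies in $A$. For $k\in\mathbb{N}$, $\lambda_k=\frac{1}{2k}\left(\frac{\mathbf{E}[W^2]}{\mathbf{E}[W]}\right)^k$. Thus $\eta(A)$ is Poisson distributed with parameter $\sum_{k\in A}\lambda_k$. For $\mathbb{N}_0$-valued random variables $X,Y$, $d_{TV}(X,Y)=\sup_{B\subseteq\mathbb{N}_0}|\mathbf{P}(X\in B)-\mathbf{P}(Y\in B)|$.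 *)

theory Defs
  imports "HOL-Probability.Probability"
begin

section \<open>Cycles in simple graphs\<close>

text \<open>
  A simple graph on a known vertex set is given by its edge set, an edge being a two-element
  set of vertices. A cycle has no isolated vertices, so as a subgraph it is determined by
  its edge set; counting edge sets therefore counts every cycle once, irrespective of starting
  vertex and orientation.
\<close>

definition cycle_edges :: "'v list \<Rightarrow> 'v set set" where
  "cycle_edges vs = {{vs ! i, vs ! (Suc i mod length vs)} | i. i < length vs}"

definition is_cycle :: "nat \<Rightarrow> 'v set set \<Rightarrow> bool" where
  "is_cycle k F \<longleftrightarrow> k \<ge> 3 \<and> (\<exists>vs. distinct vs \<and> length vs = k \<and> F = cycle_edges vs)"

definition cycle_count :: "nat set \<Rightarrow> 'v set set \<Rightarrow> nat" where
  "cycle_count A G = card {F. F \<subseteq> G \<and> (\<exists>k\<in>A. is_cycle k F)}"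


section \<open>The generalised random graph\<close>

definition all_edges :: "nat \<Rightarrow> nat set set" where
  "all_edges n = {{i, j} | i j. i \<in> {1..n} \<and> j \<in> {1..n} \<and> i \<noteq> j}"

text \<open>For an edge \<open>e = {i, j}\<close> the product over \<open>e\<close> is \<open>w i * w j\<close>.\<close>

definition edge_prob :: "nat \<Rightarrow> (nat \<Rightarrow> real) \<Rightarrow> nat set \<Rightarrow> real" where
  "edge_prob n w e = (\<Prod>i\<in>e. w i) / ((\<Prod>i\<in>e. w i) + (\<Sum>i=1..n. w i))"

definition grg_given_weights :: "nat \<Rightarrow> (nat \<Rightarrow> real) \<Rightarrow> nat set set pmf" where
  "grg_given_weights n w =
     map_pmf (\<lambda>present. {e \<in> all_edges n. present e})
       (Pi_pmf (all_edges n) False (\<lambda>e. bernoulli_pmf (edge_prob n w e)))"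

text \<open>
  The law of the generalised random graph: the weights have the \<open>n\<close>-fold product of the law
  of \<open>W\<close> as their joint law, and \<^const>\<open>grg_given_weights\<close> is the conditional law of
  the edge set given the weights.
\<close>

definition grg :: "'a measure \<Rightarrow> ('a \<Rightarrow> real) \<Rightarrow> nat \<Rightarrow> nat set set measure" where
  "grg M W n =
     (\<Pi>\<^sub>M i\<in>{1..n}. distr M borel W) \<bind> (\<lambda>w. measure_pmf (grg_given_weights n w))"

text \<open>The kernel is measurable, so that the monadic bind above is the genuine mixture of laws.\<close>

lemma finite_all_edges: "finite (all_edges n)"
proof -
  have "all_edges n \<subseteq> Pow {1..n}" by (auto simp: all_edges_def)
  then show ?thesis by (rule finite_subset) simp
qed

lemma pmf_bernoulli_edge_prob_measurable:
  assumes "e \<in> all_edges n"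
  shows "(\<lambda>w. pmf (bernoulli_pmf (edge_prob n w e)) b)
           \<in> borel_measurable (\<Pi>\<^sub>M i\<in>{1..n}. distr M borel W)"
proof -
  have p: "(\<lambda>w. edge_prob n w e) \<in> borel_measurable (\<Pi>\<^sub>M i\<in>{1..n}. distr M borel W)"
  proof -
    have "e \<subseteq> {1..n}" using assms by (auto simp: all_edges_def)
    moreover have "(\<lambda>w. w i) \<in> borel_measurable (\<Pi>\<^sub>M i\<in>{1..n}. distr M borel W)"
      if "i \<in> {1..n}" for i
      using measurable_component_singleton[OF that, of "\<lambda>_. distr M borel W"] by simp
    ultimately show ?thesis
      unfolding edge_prob_def
      by (intro borel_measurable_divide borel_measurable_add borel_measurable_prod
          borel_measurable_sum) auto
  qed
  have "pmf (bernoulli_pmf x) b = (if b then min 1 (max 0 x) else 1 - min 1 (max 0 x))" for x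
    by (cases b) (simp_all add: bernoulli_pmf.rep_eq)
  then show ?thesis using p by simp
qed

lemma grg_given_weights_measurable:
  "(\<lambda>w. measure_pmf (grg_given_weights n w))
     \<in> (\<Pi>\<^sub>M i\<in>{1..n}. distr M borel W) \<rightarrow>\<^sub>M subprob_algebra (count_space UNIV)"
proof (rule measurable_subprob_algebra)
  let ?D = "\<Pi>\<^sub>M i\<in>{1..n}. distr M borel W"
  fix A :: "nat set set set"
  have "(\<lambda>w. emeasure (measure_pmf (grg_given_weights n w)) A) =
      (\<lambda>w. \<Sum>f\<in>(\<lambda>S e. e \<in> S) ` Pow (all_edges n).
        ennreal (\<Prod>e\<in>all_edges n. pmf (bernoulli_pmf (edge_prob n w e)) (f e))
        * indicator A {e \<in> all_edges n. f e})" (is "?l = ?r")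
  proof
    fix w
    let ?P = "Pi_pmf (all_edges n) False (\<lambda>e. bernoulli_pmf (edge_prob n w e))"
    let ?F = "(\<lambda>S e. e \<in> S) ` Pow (all_edges n)"
    have supp: "set_pmf ?P \<subseteq> ?F"
    proof
      fix f assume "f \<in> set_pmf ?P"
      then have "\<forall>x. x \<notin> all_edges n \<longrightarrow> f x = False"
        using set_Pi_pmf_subset[OF finite_all_edges] by fastforce
      then have "f = (\<lambda>e. e \<in> {e. f e})" "{e. f e} \<subseteq> all_edges n" by auto
      then show "f \<in> ?F" by (metis PowI image_eqI)
    qed
    have "?l w = (\<integral>\<^sup>+ f. indicator A {e \<in> all_edges n. f e} \<partial>measure_pmf ?P)"
      unfolding grg_given_weights_def
      by (simp add: nn_integral_indicator[symmetric] indicator_def vimage_def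
          del: nn_integral_indicator)
    also have "\<dots> = (\<Sum>f\<in>?F. indicator A {e \<in> all_edges n. f e} * ennreal (pmf ?P f))"
      by (rule nn_integral_measure_pmf_support)
        (use supp in \<open>auto simp: finite_all_edges\<close>)
    also have "\<dots> = ?r w"
      by (intro sum.cong refl) (auto simp: pmf_Pi finite_all_edges mult.commute)
    finally show "?l w = ?r w" .
  qed
  moreover have "?r \<in> borel_measurable ?D"
    by (intro borel_measurable_sum borel_measurable_times_ennreal borel_measurable_const
        measurable_compose[OF _ measurable_ennreal] borel_measurable_prod
        pmf_bernoulli_edge_prob_measurable)
  ultimately show "(\<lambda>w. emeasure (measure_pmf (grg_given_weights n w)) A) \<in> borel_measurable ?D"
    by simp
qed (auto intro: prob_space_imp_subprob_space measure_pmf.prob_space_axioms)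

lemma prob_space_grg:
  assumes "prob_space M" "W \<in> borel_measurable M"
  shows "prob_space (grg M W n)"
proof -
  interpret D: prob_space "distr M borel W"
    using assms by (rule prob_space.prob_space_distr)
  interpret product_prob_space "\<lambda>_. distr M borel W" "{1..n}" ..
  show ?thesis
    unfolding grg_def
    by (rule prob_space_bind[OF _ grg_given_weights_measurable])
      (auto intro: measure_pmf.prob_space_axioms)
qed


section \<open>Poisson point processes on a discrete space\<close>

text \<open>
  A locally finite point process on a discrete space is encoded by its random multiplicities:
  \<open>\<xi> k\<close> is the number of points at \<open>k\<close>, and a finite set \<open>A\<close> receives \<open>count_in \<xi> A\<close> points.
\<close>

definition count_in :: "('c \<Rightarrow> nat) \<Rightarrow> 'c set \<Rightarrow> nat" where
  "count_in \<xi> A = (\<Sum>k\<in>A. \<xi> k)"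

text \<open>
  \<open>\<Lambda>\<close> is meant to be a measure on all subsets of its space that is finite on finite sets.
  The Poisson weights are spelled out because \<^const>\<open>poisson_pmf\<close> is only specified for
  positive parameters, whereas parameter 0 (the point mass at 0) is needed here, e.g. for
  the empty set.
\<close>

definition poisson_point_process :: "'p measure \<Rightarrow> 'c measure \<Rightarrow> ('p \<Rightarrow> 'c \<Rightarrow> nat) \<Rightarrow> bool" where
  "poisson_point_process P \<Lambda> \<eta> \<longleftrightarrow>
     prob_space P \<and>
     (\<forall>k\<in>space \<Lambda>. (\<lambda>\<omega>. \<eta> \<omega> k) \<in> P \<rightarrow>\<^sub>M count_space UNIV) \<and>
     (\<forall>A j. finite A \<and> A \<subseteq> space \<Lambda> \<longrightarrow>
        measure P {\<omega> \<in> space P. count_in (\<eta> \<omega>) A = j} =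
          measure \<Lambda> A ^ j / fact j * exp (- measure \<Lambda> A)) \<and>
     (\<forall>m As. (\<forall>i<m. finite (As i) \<and> As i \<subseteq> space \<Lambda>) \<and> disjoint_family_on As {..<m} \<longrightarrow>
        prob_space.indep_vars P (\<lambda>_. count_space UNIV) (\<lambda>i \<omega>. count_in (\<eta> \<omega>) (As i)) {..<(m::nat)})"

definition cycle_rate :: "'a measure \<Rightarrow> ('a \<Rightarrow> real) \<Rightarrow> nat \<Rightarrow> real" where
  "cycle_rate M W k =
     1 / (2 * real k) * ((\<integral>x. W x ^ 2 \<partial>M) / (\<integral>x. W x \<partial>M)) ^ k"

definition cycle_intensity :: "'a measure \<Rightarrow> ('a \<Rightarrow> real) \<Rightarrow> nat measure" where
  "cycle_intensity M W = point_measure {3..} (\<lambda>k. ennreal (cycle_rate M W k))"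


section \<open>Total variation distance\<close>

definition d_TV :: "'p measure \<Rightarrow> ('p \<Rightarrow> nat) \<Rightarrow> 'q measure \<Rightarrow> ('q \<Rightarrow> nat) \<Rightarrow> real" where
  "d_TV P X Q Y =
     (SUP B. \<bar>measure P {\<omega> \<in> space P. X \<omega> \<in> B} - measure Q {\<omega> \<in> space Q. Y \<omega> \<in> B}\<bar>)"

end

theory Submission
  imports Defs
begin

text \<open>
  Why the theorem holds. Let \<open>L\<close>, \<open>S2\<close> and \<open>S4\<close> be the sums of the weights, of their squares and of
  their fourth powers. Given the weights, edges are independent, and with \<open>x i = w i / sqrt L\<close> the
  edge \<open>{i, j}\<close> has probability \<open>x i * x j / (1 + x i * x j)\<close>. The argument separates the randomness
  of the edges from that of the weights.

  Fixed weights (\<open>poisson_approximation_cycle_count\<close>). The cycle count is a sum of indicators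
  of the events that all edges of a given cycle \<open>\<alpha>\<close> are present. Conditioning on such an event means
  adding \<open>\<alpha>\<close> to the random edge set, which creates \<open>\<alpha>\<close> and otherwise only cycles having an edge in
  common with \<open>\<alpha>\<close>. The Stein equation converts this coupling into a bound on the distance to a Poisson
  law (\<open>chen_stein_random_subset\<close>). The expected number of \<open>k\<close>-cycles is \<open>(S2 / L) ^ k / (2 * k)\<close> up to
  an error of order \<open>S4 / L\<^sup>2\<close>: a cycle of length \<open>k\<close> has \<open>2 * k\<close> traversals, and the sum of
  the products of the \<open>x\<close>-weights along all vertex sequences of length \<open>k\<close> factorises
  (\<open>expected_cycles\<close>). The expected number of further cycles through an edge of \<open>\<alpha>\<close> is at most a
  multiple of the sum of \<open>(x v)\<^sup>2\<close> over the vertices of \<open>\<alpha>\<close> (\<open>sum_neighbours_le\<close>); summed over \<open>\<alpha>\<close> this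
  again gives the order \<open>S4 / L\<^sup>2\<close>. As long as \<open>S2 / L\<close> is bounded, the conditional law
  of the cycle count is therefore within order \<open>S4 / L\<^sup>2\<close> of a Poisson law whose parameter is
  a polynomial in \<open>S2 / L\<close>.

  Random weights (\<open>expansion_given_weights\<close>). It remains to replace \<open>S2 / L\<close> by \<open>m2 / m1\<close>,
  where \<open>m1\<close> and \<open>m2\<close> are the first two moments of \<open>W\<close>. The difference is of order
  \<open>n powr (- 1 / 2)\<close>, too large to be estimated in absolute value. However, Poisson probabilities
  depend smoothly on the parameter (\<open>poisson_mean_second_order\<close>), and the leading part of the difference
  is a constant multiple of \<open>D / n\<close> with \<open>D = m1 * S2 - m2 * L\<close>, a sum of independent centred
  variables, whose expectation vanishes. What is left is bounded by a multiple of
  \<open>(S4 + D\<^sup>2 + (L - n * m1)\<^sup>2 + (S2 - n * m2)\<^sup>2) / n\<^sup>2\<close>. This bound is also valid for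
  weights with atypical \<open>L\<close> or \<open>S2\<close>, where it exceeds a positive constant. Each of the four terms in the
  numerator has expectation of order \<open>n\<close> as soon as \<open>W\<close> has a fourth moment, which yields the rate
  \<open>1 / n\<close>.
\<close>


section \<open>Poisson expectations and the Stein equation\<close>

text \<open>By the convention \<open>0 ^ 0 = 1\<close> the parameter \<open>t = 0\<close> gives the value of \<open>h\<close> at 0, the expectation under
  the degenerate Poisson law.\<close>

definition poisson_mean :: "real \<Rightarrow> (nat \<Rightarrow> real) \<Rightarrow> real" where
  "poisson_mean t h = (\<Sum>j. t ^ j / fact j * exp (- t) * h j)"

lemma sums_poisson_weights: "(\<lambda>j. t ^ j / fact j * exp (- t)) sums (1 :: real)"
proof -
  have "(\<lambda>j. t ^ j /\<^sub>R fact j) sums exp t" by (rule exp_converges)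
  then have "(\<lambda>j. t ^ j / fact j) sums exp t" by (simp add: field_simps scaleR_conv_of_real)
  then have "(\<lambda>j. t ^ j / fact j * exp (- t)) sums (exp t * exp (- t))" by (rule sums_mult2)
  then show ?thesis by (simp add: exp_minus)
qed

lemma summable_poisson:
  fixes t B :: real
  assumes "0 \<le> t" "\<And>j. \<bar>h j\<bar> \<le> B"
  shows "summable (\<lambda>j. t ^ j / fact j * exp (- t) * h j)"
proof (rule summable_comparison_test')
  show "summable (\<lambda>j. t ^ j / fact j * exp (- t) * B)"
    using sums_mult2[OF sums_poisson_weights] sums_summable by blast
  show "norm (t ^ n / fact n * exp (- t) * h n) \<le> t ^ n / fact n * exp (- t) * B" for n
    unfolding real_norm_def abs_mult using assms
    by (intro mult_mono) auto
qed

lemma abs_poisson_mean_le: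
  assumes "0 \<le> t" "\<And>j. \<bar>h j\<bar> \<le> B"
  shows "\<bar>poisson_mean t h\<bar> \<le> B"
proof -
  have s: "(\<lambda>j. t ^ j / fact j * exp (- t) * B) sums (1 * B)"
    by (intro sums_mult2 sums_poisson_weights)
  have "norm (poisson_mean t h) \<le> (\<Sum>j. t ^ j / fact j * exp (- t) * B)"
    unfolding poisson_mean_def
  proof (rule norm_suminf_le[OF _ sums_summable[OF s]])
    show "norm (t ^ n / fact n * exp (- t) * h n) \<le> t ^ n / fact n * exp (- t) * B" for n
      unfolding real_norm_def abs_mult using assms
      by (intro mult_mono) auto
  qed
  then show ?thesis using sums_unique[OF s] by simp
qed

lemma poisson_mean_diff:
  assumes "0 \<le> t" "\<And>j. \<bar>g j\<bar> \<le> B" "\<And>j. \<bar>h j\<bar> \<le> B'"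
  shows "poisson_mean t (\<lambda>j. g j - h j) = poisson_mean t g - poisson_mean t h"
  unfolding poisson_mean_def
  using suminf_diff[OF summable_poisson[where h = g, OF assms(1,2)]
      summable_poisson[where h = h, OF assms(1,3)]]
  by (simp add: right_diff_distrib)

lemma poisson_mean_cmult:
  assumes "0 \<le> t" "\<And>j. \<bar>h j\<bar> \<le> B"
  shows "poisson_mean t (\<lambda>j. c * h j) = c * poisson_mean t h"
  unfolding poisson_mean_def
  using suminf_mult[OF summable_poisson[where h = h, OF assms], of c]
  by (simp add: algebra_simps)

lemma poisson_mean_const: "poisson_mean t (\<lambda>_. c) = c"
  using sums_unique[OF sums_mult2[OF sums_poisson_weights[of t], of c]]
  by (simp add: poisson_mean_def)

lemma sums_poisson_size_bias:
  assumes "0 \<le> t" "\<And>j. \<bar>f j\<bar> \<le> B"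
  shows "(\<lambda>j. t ^ j / fact j * exp (- t) * (real j * f j)) sums (t * poisson_mean t (\<lambda>j. f (Suc j)))"
proof -
  have "(\<lambda>j. t ^ j / fact j * exp (- t) * f (Suc j)) sums poisson_mean t (\<lambda>j. f (Suc j))"
    unfolding poisson_mean_def by (rule summable_sums, rule summable_poisson) (use assms in auto)
  then have "(\<lambda>j. t * (t ^ j / fact j * exp (- t) * f (Suc j))) sums (t * poisson_mean t (\<lambda>j. f (Suc j)))"
    by (rule sums_mult)
  moreover have "t * (t ^ j / fact j * exp (- t) * f (Suc j)) =
      t ^ Suc j / fact (Suc j) * exp (- t) * (real (Suc j) * f (Suc j))" for j
  proof -
    have "t ^ Suc j / fact (Suc j) * real (Suc j) = t * (t ^ j / fact j)"
      by (simp add: field_simps del: of_nat_Suc)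
    then show ?thesis by (metis (no_types, lifting) mult.assoc mult.commute)
  qed
  ultimately have "(\<lambda>j. t ^ Suc j / fact (Suc j) * exp (- t) * (real (Suc j) * f (Suc j)))
      sums (t * poisson_mean t (\<lambda>j. f (Suc j)))" by (simp only:)
  then show ?thesis by (subst (asm) sums_Suc_iff) simp
qed

text \<open>The solution of the Stein equation, written as a series in the values of the right-hand side
  beyond the current point: this needs no division by \<open>t\<close>, so that \<open>t = 0\<close> is covered.\<close>

definition stein_solution :: "real \<Rightarrow> (nat \<Rightarrow> real) \<Rightarrow> nat \<Rightarrow> real" where
  "stein_solution t h j = (if j = 0 then 0 else
     - (\<Sum>i. t ^ i * fact (j - 1) / fact (j + i) * (h (j + i) - poisson_mean t h)))"

lemma fact_ratio_le: "fact j / fact (Suc j + i) \<le> (1 / fact i :: real)"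
proof -
  have "fact j * fact i * 1 \<le> (fact (j + i) :: nat)"
    by (metis fact_fact_dvd_fact dvd_imp_le fact_gt_zero mult.right_neutral)
  also have "\<dots> \<le> fact (Suc j + i)" by (rule fact_mono_nat) simp
  finally have "(fact j * fact i :: nat) \<le> fact (Suc j + i)" by (simp only: mult_1_right)
  then have "real (fact j * fact i) \<le> real (fact (Suc j + i))" by (rule of_nat_mono)
  then have "(fact j * fact i :: real) \<le> fact (Suc j + i)" by (simp only: of_nat_mult of_nat_fact)
  then show ?thesis using fact_gt_zero[of "Suc j + i", where ?'a = real] fact_gt_zero[of i, where ?'a = real]
    by (simp add: divide_simps mult.commute del: fact_Suc add_Suc)
qed

lemma
  fixes t B :: real
  assumes t: "0 \<le> t" and h: "\<And>j. \<bar>h j\<bar> \<le> B"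
  shows summable_stein_series:
      "summable (\<lambda>i. t ^ i * fact j / fact (Suc j + i) * (h (Suc j + i) - poisson_mean t h))"
    and abs_stein_solution_le: "\<bar>stein_solution t h j\<bar> \<le> 2 * B * exp t"
proof -
  have B: "0 \<le> B" using h[of 0] by linarith
  have diff: "\<bar>h i - poisson_mean t h\<bar> \<le> 2 * B" for i
    using h[of i] abs_poisson_mean_le[where h = h, OF t h] by linarith
  have E: "(\<lambda>i. t ^ i / fact i * (2 * B)) sums (exp t * (2 * B))"
    using sums_mult2[OF exp_converges[of t], of "2 * B"]
    by (simp add: field_simps scaleR_conv_of_real)
  have le: "norm (t ^ i * fact j / fact (Suc j + i) * (h (Suc j + i) - poisson_mean t h))
      \<le> t ^ i / fact i * (2 * B)" for i j
  proof -
    have "t ^ i * (fact j / fact (Suc j + i)) \<le> t ^ i * (1 / fact i)"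
      by (intro mult_left_mono fact_ratio_le) (use t in auto)
    then have "t ^ i * fact j / fact (Suc j + i) * \<bar>h (Suc j + i) - poisson_mean t h\<bar>
        \<le> t ^ i / fact i * (2 * B)"
      by (intro mult_mono diff) (use t B in auto)
    then show ?thesis using t by (simp add: abs_mult del: fact_Suc)
  qed
  show "summable (\<lambda>i. t ^ i * fact j / fact (Suc j + i) * (h (Suc j + i) - poisson_mean t h))"
    by (rule summable_comparison_test'[OF sums_summable[OF E]]) (rule le)
  show "\<bar>stein_solution t h j\<bar> \<le> 2 * B * exp t"
  proof (cases j)
    case 0
    then show ?thesis using B by (simp add: stein_solution_def)
  next
    case (Suc j')
    have "norm (\<Sum>i. t ^ i * fact j' / fact (Suc j' + i) * (h (Suc j' + i) - poisson_mean t h))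
        \<le> (\<Sum>i. t ^ i / fact i * (2 * B))"
      by (rule norm_suminf_le[OF le sums_summable[OF E]])
    then show ?thesis
      using sums_unique[OF E] Suc by (simp add: stein_solution_def mult_ac)
  qed
qed

lemma stein_equation:
  fixes t B :: real
  assumes t: "0 \<le> t" and h: "\<And>j. \<bar>h j\<bar> \<le> B"
  shows "t * stein_solution t h (Suc j) - real j * stein_solution t h j = h j - poisson_mean t h"
proof -
  define k where "k i = h i - poisson_mean t h" for i
  \<comment> \<open>The two terms on the left-hand side of the equation are minus the series \<open>u\<close>, without and
    with its first term \<open>k j\<close>.\<close>
  define u where "u i = t ^ i * fact j / fact (j + i) * k (j + i)" for i
  have Sj: "stein_solution t h (Suc j) = - (\<Sum>i. t ^ i * fact j / fact (Suc j + i) * k (Suc j + i))"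
    by (simp add: stein_solution_def k_def)
  have uS: "u (Suc i) = t * (t ^ i * fact j / fact (Suc j + i) * k (Suc j + i))" for i
    by (simp add: u_def)
  have s: "summable (\<lambda>i. t ^ i * fact j / fact (Suc j + i) * k (Suc j + i))"
    unfolding k_def by (rule summable_stein_series[where h = h, OF assms])
  have su: "summable (\<lambda>i. u (Suc i))"
    unfolding uS by (rule summable_mult[OF s])
  have tS: "t * stein_solution t h (Suc j) = - (\<Sum>i. u (Suc i))"
    unfolding uS Sj suminf_mult[OF s] by simp
  have su': "summable u" using su by (simp add: summable_Suc_iff)
  have u0: "u 0 = k j" by (simp add: u_def)
  have "real j * stein_solution t h j = - (\<Sum>i. u i)"
  proof (cases j)
    case 0
    have "u = (\<lambda>i. exp t * (t ^ i / fact i * exp (- t) * k i))"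
      by (auto simp: u_def 0 exp_minus fun_eq_iff field_simps)
    moreover have kB: "\<bar>k i\<bar> \<le> B + B" for i
      using h[of i] abs_poisson_mean_le[where h = h, OF t h] unfolding k_def by linarith
    ultimately have "(\<Sum>i. u i) = exp t * poisson_mean t k"
      unfolding poisson_mean_def by (simp only: suminf_mult[OF summable_poisson[where h = k, OF t kB]])
    also have "poisson_mean t k = 0"
      unfolding k_def using poisson_mean_diff[where g = h and h = "\<lambda>_. poisson_mean t h", OF t h order_refl]
      by (simp add: poisson_mean_const)
    finally show ?thesis using 0 by simp
  next
    case (Suc j')
    have s': "summable (\<lambda>i. t ^ i * fact j' / fact (Suc j' + i) * k (Suc j' + i))"
      unfolding k_def by (rule summable_stein_series[where h = h, OF assms])
    have "u = (\<lambda>i. real j * (t ^ i * fact j' / fact (Suc j' + i) * k (Suc j' + i)))"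
      by (simp add: u_def Suc fun_eq_iff)
    then have "(\<Sum>i. u i) = real j * (\<Sum>i. t ^ i * fact j' / fact (Suc j' + i) * k (Suc j' + i))"
      by (simp only: suminf_mult[OF s'])
    then show ?thesis by (simp add: stein_solution_def Suc k_def)
  qed
  moreover have "(\<Sum>i. u i) = (\<Sum>i. u (Suc i)) + k j"
    using suminf_split_head[OF su'] u0 by simp
  ultimately show ?thesis using tS by (simp add: k_def)
qed

text \<open>Integrating the Stein equation for the parameter \<open>t\<close> against the Poisson law with
  parameter \<open>s\<close> turns a difference of two Poisson expectations into an explicit multiple
  of \<open>t - s\<close>. This replaces differentiation in the parameter.\<close>

lemma poisson_mean_change:
  fixes s t B :: real
  assumes s: "0 \<le> s" and t: "0 \<le> t" and h: "\<And>j. \<bar>h j\<bar> \<le> B"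
  shows "poisson_mean s h - poisson_mean t h
    = (t - s) * poisson_mean s (\<lambda>j. stein_solution t h (Suc j))"
proof -
  let ?f = "stein_solution t h"
  note f = abs_stein_solution_le[where h = h, OF t h]
  have "(\<lambda>j. s ^ j / fact j * exp (- s) * (t * ?f (Suc j)) - s ^ j / fact j * exp (- s) * (real j * ?f j))
      sums (t * poisson_mean s (\<lambda>j. ?f (Suc j)) - s * poisson_mean s (\<lambda>j. ?f (Suc j)))"
  proof (intro sums_diff sums_poisson_size_bias[OF s f])
    have "summable (\<lambda>j. s ^ j / fact j * exp (- s) * (t * ?f (Suc j)))"
    proof (rule summable_poisson[OF s])
      show "\<bar>t * ?f (Suc j)\<bar> \<le> t * (2 * B * exp t)" for j
        unfolding abs_mult using t by (intro mult_mono f) auto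
    qed
    then show "(\<lambda>j. s ^ j / fact j * exp (- s) * (t * ?f (Suc j))) sums (t * poisson_mean s (\<lambda>j. ?f (Suc j)))"
      using poisson_mean_cmult[where h = "\<lambda>j. ?f (Suc j)", OF s f, of t] unfolding poisson_mean_def sums_iff by (auto simp: sums_iff)
  qed
  moreover have "s ^ j / fact j * exp (- s) * (t * ?f (Suc j)) - s ^ j / fact j * exp (- s) * (real j * ?f j)
      = s ^ j / fact j * exp (- s) * (h j - poisson_mean t h)" for j
    unfolding stein_equation[where h = h, OF t h, symmetric] by (simp add: algebra_simps)
  ultimately have "(\<lambda>j. s ^ j / fact j * exp (- s) * (h j - poisson_mean t h))
      sums (t * poisson_mean s (\<lambda>j. ?f (Suc j)) - s * poisson_mean s (\<lambda>j. ?f (Suc j)))"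
    by simp
  then have "poisson_mean s (\<lambda>j. h j - poisson_mean t h)
      = t * poisson_mean s (\<lambda>j. ?f (Suc j)) - s * poisson_mean s (\<lambda>j. ?f (Suc j))"
    unfolding poisson_mean_def by (simp add: sums_iff)
  moreover have "poisson_mean s (\<lambda>j. h j - poisson_mean t h) = poisson_mean s h - poisson_mean t h"
    using poisson_mean_diff[where g = h and h = "\<lambda>_. poisson_mean t h", OF s h order_refl] by (simp add: poisson_mean_const)
  ultimately show ?thesis by (simp add: algebra_simps)
qed

lemma poisson_mean_lipschitz:
  fixes s t B :: real
  assumes s: "0 \<le> s" and t: "0 \<le> t" and h: "\<And>j. \<bar>h j\<bar> \<le> B"
  shows "\<bar>poisson_mean s h - poisson_mean t h\<bar> \<le> \<bar>s - t\<bar> * (2 * B * exp t)"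
  unfolding poisson_mean_change[OF assms] abs_mult
  by (intro mult_mono abs_poisson_mean_le[OF s] abs_stein_solution_le[where h = h, OF t h]) auto

text \<open>The derivative of the Poisson expectation of \<open>h\<close> with respect to the parameter.\<close>

definition poisson_slope :: "real \<Rightarrow> (nat \<Rightarrow> real) \<Rightarrow> real" where
  "poisson_slope t h = - poisson_mean t (\<lambda>j. stein_solution t h (Suc j))"

lemma abs_poisson_slope_le:
  fixes t B :: real
  assumes t: "0 \<le> t" and h: "\<And>j. \<bar>h j\<bar> \<le> B"
  shows "\<bar>poisson_slope t h\<bar> \<le> 2 * B * exp t"
  unfolding poisson_slope_def abs_minus_cancel
  by (intro abs_poisson_mean_le[OF t] abs_stein_solution_le[where h = h, OF t h])

text \<open>The Stein solution is itself a bounded test function, so the first-order formula can be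
  applied twice.\<close>

lemma poisson_mean_second_order:
  fixes s t B :: real
  assumes s: "0 \<le> s" and t: "0 \<le> t" and h: "\<And>j. \<bar>h j\<bar> \<le> B"
  shows "\<bar>poisson_mean s h - poisson_mean t h - poisson_slope t h * (s - t)\<bar>
    \<le> (s - t)\<^sup>2 * (4 * B * (exp t)\<^sup>2)"
proof -
  let ?f = "\<lambda>j. stein_solution t h (Suc j)"
  have "poisson_mean s h - poisson_mean t h - poisson_slope t h * (s - t)
      = (t - s) * (poisson_mean s ?f - poisson_mean t ?f)"
    unfolding poisson_mean_change[OF assms] poisson_slope_def by (simp add: algebra_simps)
  also have "\<bar>\<dots>\<bar> \<le> \<bar>t - s\<bar> * (\<bar>s - t\<bar> * (2 * (2 * B * exp t) * exp t))"
    unfolding abs_mult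
    by (intro mult_left_mono poisson_mean_lipschitz[OF s t] abs_stein_solution_le[where h = h, OF t h]) auto
  also have "\<dots> = \<bar>s - t\<bar>\<^sup>2 * (4 * B * (exp t)\<^sup>2)"
    by (simp add: power2_eq_square abs_minus_commute)
  finally show ?thesis by simp
qed


section \<open>Random edge sets\<close>

definition random_subset :: "'e set \<Rightarrow> ('e \<Rightarrow> real) \<Rightarrow> 'e set pmf" where
  "random_subset E p =
     map_pmf (\<lambda>present. {e \<in> E. present e}) (Pi_pmf E False (\<lambda>e. bernoulli_pmf (p e)))"

lemma set_pmf_random_subset: "set_pmf (random_subset E p) \<subseteq> Pow E"
  by (auto simp: random_subset_def)

lemma integrable_random_subset:
  fixes g :: "'e set \<Rightarrow> real"
  assumes "finite E"
  shows "integrable (measure_pmf (random_subset E p)) g"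
  by (rule integrable_measure_pmf_finite, rule finite_subset[OF set_pmf_random_subset])
    (simp add: assms)

lemma random_subset_insert:
  assumes "finite E" "e \<notin> E"
  shows "random_subset (insert e E) p = do {
    b \<leftarrow> bernoulli_pmf (p e); G \<leftarrow> random_subset E p; return_pmf (if b then insert e G else G)}"
proof -
  have *: "{x. (x = e \<or> x \<in> E) \<and> (if x = e then b else f x)} =
      (if b then insert e {x\<in>E. f x} else {x\<in>E. f x})" for b f
    using assms(2) by auto
  show ?thesis
    unfolding random_subset_def Pi_pmf_insert'[OF assms]
    by (simp add: map_pmf_def bind_assoc_pmf bind_return_pmf *)
qed

lemma expectation_random_subset_insert:
  fixes g :: "'e set \<Rightarrow> real"
  assumes "finite E" "e \<notin> E" "0 \<le> p e" "p e \<le> 1"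
  shows "measure_pmf.expectation (random_subset (insert e E) p) g =
    p e * measure_pmf.expectation (random_subset E p) (\<lambda>G. g (insert e G)) +
    (1 - p e) * measure_pmf.expectation (random_subset E p) g"
proof -
  have fin: "finite (set_pmf (random_subset E p))"
    by (rule finite_subset[OF set_pmf_random_subset]) (simp add: assms)
  have m: "random_subset E p \<bind> (\<lambda>G. return_pmf (if b then insert e G else G)) =
      map_pmf (\<lambda>G. if b then insert e G else G) (random_subset E p)" for b
    by (simp add: map_pmf_def)
  show ?thesis
    unfolding random_subset_insert[OF assms(1,2)] m
    by (subst pmf_expectation_bind[where A = UNIV]) (auto simp: UNIV_bool fin assms)
qed

text \<open>Conditionally on the edge \<open>e\<close> being present, the random edge set is distributed like
  the random edge set to which \<open>e\<close> is added: the other edges do not notice.\<close>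

lemma expectation_random_subset_mem:
  fixes g :: "'e set \<Rightarrow> real"
  assumes "finite E" "e \<in> E" "0 \<le> p e" "p e \<le> 1"
  shows "measure_pmf.expectation (random_subset E p) (\<lambda>G. of_bool (e \<in> G) * g G) =
    p e * measure_pmf.expectation (random_subset E p) (\<lambda>G. g (insert e G))"
proof -
  define E' where "E' = E - {e}"
  have E: "E = insert e E'" "finite E'" "e \<notin> E'" using assms unfolding E'_def by auto
  have "measure_pmf.expectation (random_subset E' p) (\<lambda>G. of_bool (e \<in> G) * g G) =
      measure_pmf.expectation (random_subset E' p) (\<lambda>G. 0)"
    using set_pmf_random_subset[of E' p] E(3)
    by (intro integral_cong_AE) (auto simp: AE_measure_pmf_iff)
  then show ?thesis
    unfolding E(1) expectation_random_subset_insert[where p = p, OF E(2,3) assms(3,4)]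
    by (simp add: algebra_simps)
qed

lemma expectation_random_subset_superset:
  fixes g :: "'e set \<Rightarrow> real"
  assumes "finite E" "S \<subseteq> E" "\<And>e. e \<in> E \<Longrightarrow> 0 \<le> p e \<and> p e \<le> 1"
  shows "measure_pmf.expectation (random_subset E p) (\<lambda>G. of_bool (S \<subseteq> G) * g G) =
    (\<Prod>e\<in>S. p e) * measure_pmf.expectation (random_subset E p) (\<lambda>G. g (G \<union> S))"
proof -
  have "finite S" using assms finite_subset by blast
  then show ?thesis using assms(2)
  proof (induction S arbitrary: g)
    case empty
    then show ?case by simp
  next
    case (insert e S)
    have "measure_pmf.expectation (random_subset E p) (\<lambda>G. of_bool (insert e S \<subseteq> G) * g G) =
        measure_pmf.expectation (random_subset E p) (\<lambda>G. of_bool (e \<in> G) * (of_bool (S \<subseteq> G) * g G))"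
      by (intro Bochner_Integration.integral_cong) auto
    also have "\<dots> = p e * measure_pmf.expectation (random_subset E p)
        (\<lambda>G. of_bool (S \<subseteq> insert e G) * g (insert e G))"
      by (rule expectation_random_subset_mem) (use insert.prems assms in auto)
    also have "(\<lambda>G. of_bool (S \<subseteq> insert e G) * g (insert e G)) =
        (\<lambda>G. of_bool (S \<subseteq> G) * g (insert e G))"
      using insert.hyps(2) by (auto simp: fun_eq_iff)
    also have "measure_pmf.expectation (random_subset E p) (\<lambda>G. of_bool (S \<subseteq> G) * g (insert e G))
        = (\<Prod>e\<in>S. p e) * measure_pmf.expectation (random_subset E p) (\<lambda>G. g (insert e (G \<union> S)))"
      using insert.prems by (intro insert.IH[of "\<lambda>G. g (insert e G)"]) auto
    finally show ?case using insert.hyps by (simp add: mult.assoc)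
  qed
qed

lemma expectation_random_subset_subset:
  assumes "finite E" "S \<subseteq> E" "\<And>e. e \<in> E \<Longrightarrow> 0 \<le> p e \<and> p e \<le> 1"
  shows "measure_pmf.expectation (random_subset E p) (\<lambda>G. of_bool (S \<subseteq> G)) = (\<Prod>e\<in>S. p e)"
  using expectation_random_subset_superset[where g = "\<lambda>_. 1", OF assms] by simp

section \<open>Poisson approximation for the number of covered edge sets\<close>

text \<open>Conditioning on \<open>\<alpha> \<subseteq> G\<close> amounts to replacing \<open>G\<close> by \<open>G \<union> \<alpha>\<close>, which changes the count of the
  members of \<open>\<A>\<close> inside the edge set only by those members that meet \<open>\<alpha>\<close>. Inserted in the Stein
  equation this is the size-bias coupling form of the Chen--Stein method.\<close>

theorem chen_stein_random_subset:
  fixes E :: "'e set" and p :: "'e \<Rightarrow> real" and h :: "nat \<Rightarrow> real"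
  assumes E: "finite E" and \<A>: "\<A> \<subseteq> Pow E"
    and p: "\<And>e. e \<in> E \<Longrightarrow> 0 \<le> p e \<and> p e \<le> 1"
    and h: "\<And>j. \<bar>h j\<bar> \<le> 1" and t: "0 \<le> t"
    and \<rho>: "\<And>\<alpha>. \<alpha> \<in> \<A> \<Longrightarrow> (\<Prod>e\<in>\<alpha>. p e) +
        (\<Sum>\<beta> | \<beta> \<in> \<A> \<and> \<beta> \<noteq> \<alpha> \<and> \<beta> \<inter> \<alpha> \<noteq> {}. \<Prod>e\<in>\<beta> - \<alpha>. p e) \<le> \<rho> \<alpha>"
  shows "\<bar>measure_pmf.expectation (random_subset E p) (\<lambda>G. h (card {\<alpha>\<in>\<A>. \<alpha> \<subseteq> G})) - poisson_mean t h\<bar>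
    \<le> 4 * exp t * (\<bar>t - (\<Sum>\<alpha>\<in>\<A>. \<Prod>e\<in>\<alpha>. p e)\<bar> + (\<Sum>\<alpha>\<in>\<A>. (\<Prod>e\<in>\<alpha>. p e) * \<rho> \<alpha>))"
proof -
  let ?E = "measure_pmf.expectation (random_subset E p)"
  define X where "X G = card {\<alpha>\<in>\<A>. \<alpha> \<subseteq> G}" for G
  define f where "f = stein_solution t h"
  define pr where "pr \<alpha> = (\<Prod>e\<in>\<alpha>. p e)" for \<alpha>
  have fin: "finite \<A>" using \<A> E finite_subset by blast
  have fb: "\<bar>f j\<bar> \<le> 2 * exp t" for j
    using abs_stein_solution_le[where h = h, OF t h] by (simp add: f_def)
  have int: "integrable (measure_pmf (random_subset E p)) g" for g :: "'e set \<Rightarrow> real"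
    by (rule integrable_random_subset[OF E])
  have pr0: "0 \<le> pr \<alpha>" if "\<alpha> \<in> \<A>" for \<alpha>
    unfolding pr_def using that \<A> p by (intro prod_nonneg) auto
  have X_sum: "real (X G) = (\<Sum>\<alpha>\<in>\<A>. of_bool (\<alpha> \<subseteq> G))" for G
    unfolding X_def using fin by (simp add: Int_def)
  have size_bias: "?E (\<lambda>G. real (X G) * f (X G)) = (\<Sum>\<alpha>\<in>\<A>. pr \<alpha> * ?E (\<lambda>G. f (X (G \<union> \<alpha>))))"
  proof -
    have "?E (\<lambda>G. real (X G) * f (X G)) = ?E (\<lambda>G. \<Sum>\<alpha>\<in>\<A>. of_bool (\<alpha> \<subseteq> G) * f (X G))"
      by (simp add: X_sum sum_distrib_right)
    also have "\<dots> = (\<Sum>\<alpha>\<in>\<A>. ?E (\<lambda>G. of_bool (\<alpha> \<subseteq> G) * f (X G)))"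
      by (rule Bochner_Integration.integral_sum) (rule int)
    also have "\<dots> = (\<Sum>\<alpha>\<in>\<A>. pr \<alpha> * ?E (\<lambda>G. f (X (G \<union> \<alpha>))))"
      unfolding pr_def using \<A> p
      by (intro sum.cong refl expectation_random_subset_superset E) auto
    finally show ?thesis .
  qed
  have coupling: "\<bar>f (Suc (X G)) - f (X (G \<union> \<alpha>))\<bar> \<le> 4 * exp t *
      (of_bool (\<alpha> \<subseteq> G) + (\<Sum>\<beta> | \<beta> \<in> \<A> \<and> \<beta> \<noteq> \<alpha> \<and> \<beta> \<inter> \<alpha> \<noteq> {}. of_bool (\<beta> - \<alpha> \<subseteq> G)))"
      (is "_ \<le> 4 * exp t * ?r") if "\<alpha> \<in> \<A>" for G \<alpha>
  proof (cases "Suc (X G) = X (G \<union> \<alpha>)")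
    case True
    then show ?thesis by (simp add: sum_nonneg)
  next
    case False
    \<comment> \<open>If neither \<open>\<alpha>\<close> nor a neighbour of \<open>\<alpha>\<close> contributes, then \<open>\<alpha>\<close> is the only new member.\<close>
    have "1 \<le> ?r"
    proof (rule ccontr)
      assume "\<not> 1 \<le> ?r"
      moreover have nonneg: "0 \<le> (\<Sum>\<beta> | \<beta> \<in> \<A> \<and> \<beta> \<noteq> \<alpha> \<and> \<beta> \<inter> \<alpha> \<noteq> {}. of_bool (\<beta> - \<alpha> \<subseteq> G) :: real)"
        by (rule sum_nonneg) auto
      ultimately have nG: "\<not> \<alpha> \<subseteq> G" by (cases "\<alpha> \<subseteq> G") auto
      have nb: "\<not> \<beta> - \<alpha> \<subseteq> G" if "\<beta> \<in> \<A>" "\<beta> \<noteq> \<alpha>" "\<beta> \<inter> \<alpha> \<noteq> {}" for \<beta>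
      proof
        assume "\<beta> - \<alpha> \<subseteq> G"
        then have "(1 :: real) \<le> (\<Sum>\<beta> | \<beta> \<in> \<A> \<and> \<beta> \<noteq> \<alpha> \<and> \<beta> \<inter> \<alpha> \<noteq> {}. of_bool (\<beta> - \<alpha> \<subseteq> G))"
          using member_le_sum[of \<beta> "{\<beta> \<in> \<A>. \<beta> \<noteq> \<alpha> \<and> \<beta> \<inter> \<alpha> \<noteq> {}}" "\<lambda>\<beta>. of_bool (\<beta> - \<alpha> \<subseteq> G) :: real"]
            that fin by auto
        then show False using \<open>\<not> 1 \<le> ?r\<close> by (simp add: nG)
      qed
      have "{\<beta>\<in>\<A>. \<beta> \<subseteq> G \<union> \<alpha>} = insert \<alpha> {\<beta>\<in>\<A>. \<beta> \<subseteq> G}"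
        using nb \<open>\<alpha> \<in> \<A>\<close> by blast
      then have "X (G \<union> \<alpha>) = Suc (X G)" using nG fin by (simp add: X_def)
      then show False using False by simp
    qed
    have "\<bar>f (Suc (X G)) - f (X (G \<union> \<alpha>))\<bar> \<le> 4 * exp t"
      using fb[of "Suc (X G)"] fb[of "X (G \<union> \<alpha>)"] by linarith
    also have "\<dots> \<le> 4 * exp t * ?r" using \<open>1 \<le> ?r\<close> by simp
    finally show ?thesis .
  qed
  have neighbour: "\<bar>?E (\<lambda>G. f (Suc (X G))) - ?E (\<lambda>G. f (X (G \<union> \<alpha>)))\<bar> \<le> 4 * exp t * \<rho> \<alpha>"
    if "\<alpha> \<in> \<A>" for \<alpha>
  proof -
    have "\<bar>?E (\<lambda>G. f (Suc (X G))) - ?E (\<lambda>G. f (X (G \<union> \<alpha>)))\<bar>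
        = \<bar>?E (\<lambda>G. f (Suc (X G)) - f (X (G \<union> \<alpha>)))\<bar>"
      by (simp add: Bochner_Integration.integral_diff[OF int int])
    also have "\<dots> \<le> ?E (\<lambda>G. \<bar>f (Suc (X G)) - f (X (G \<union> \<alpha>))\<bar>)"
      by (rule integral_abs_bound)
    also have "\<dots> \<le> ?E (\<lambda>G. 4 * exp t *
      (of_bool (\<alpha> \<subseteq> G) + (\<Sum>\<beta> | \<beta> \<in> \<A> \<and> \<beta> \<noteq> \<alpha> \<and> \<beta> \<inter> \<alpha> \<noteq> {}. of_bool (\<beta> - \<alpha> \<subseteq> G))))"
      by (intro integral_mono int coupling that)
    also have "\<dots> = 4 * exp t * (?E (\<lambda>G. of_bool (\<alpha> \<subseteq> G)) +
        (\<Sum>\<beta> | \<beta> \<in> \<A> \<and> \<beta> \<noteq> \<alpha> \<and> \<beta> \<inter> \<alpha> \<noteq> {}. ?E (\<lambda>G. of_bool (\<beta> - \<alpha> \<subseteq> G))))"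
      by (simp add: Bochner_Integration.integral_add[OF int int] Bochner_Integration.integral_sum[OF int])
    also have "?E (\<lambda>G. of_bool (\<alpha> \<subseteq> G)) = pr \<alpha>"
      unfolding pr_def using that \<A> by (intro expectation_random_subset_subset E p) auto
    also have "(\<Sum>\<beta> | \<beta> \<in> \<A> \<and> \<beta> \<noteq> \<alpha> \<and> \<beta> \<inter> \<alpha> \<noteq> {}. ?E (\<lambda>G. of_bool (\<beta> - \<alpha> \<subseteq> G)))
        = (\<Sum>\<beta> | \<beta> \<in> \<A> \<and> \<beta> \<noteq> \<alpha> \<and> \<beta> \<inter> \<alpha> \<noteq> {}. \<Prod>e\<in>\<beta> - \<alpha>. p e)"
      using \<A> by (intro sum.cong refl expectation_random_subset_subset E p) auto
    also have "4 * exp t * (pr \<alpha> + \<dots>) \<le> 4 * exp t * \<rho> \<alpha>"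
      unfolding pr_def by (intro mult_left_mono \<rho> that) auto
    finally show ?thesis .
  qed
  have "?E (\<lambda>G. h (X G)) - poisson_mean t h = ?E (\<lambda>G. h (X G) - poisson_mean t h)"
    by (simp add: Bochner_Integration.integral_diff[OF int int])
  also have "\<dots> = ?E (\<lambda>G. t * f (Suc (X G)) - real (X G) * f (X G))"
    unfolding f_def by (simp only: stein_equation[where h = h, OF t h])
  also have "\<dots> = t * ?E (\<lambda>G. f (Suc (X G))) - ?E (\<lambda>G. real (X G) * f (X G))"
    by (simp add: Bochner_Integration.integral_diff[OF int int])
  also have "\<dots> = (t - (\<Sum>\<alpha>\<in>\<A>. pr \<alpha>)) * ?E (\<lambda>G. f (Suc (X G))) +
      (\<Sum>\<alpha>\<in>\<A>. pr \<alpha> * (?E (\<lambda>G. f (Suc (X G))) - ?E (\<lambda>G. f (X (G \<union> \<alpha>)))))"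
    unfolding size_bias by (simp add: algebra_simps sum_subtractf sum_distrib_left sum_distrib_right)
  finally have eq: "?E (\<lambda>G. h (X G)) - poisson_mean t h = \<dots>" .
  have "\<bar>(t - (\<Sum>\<alpha>\<in>\<A>. pr \<alpha>)) * ?E (\<lambda>G. f (Suc (X G)))\<bar> \<le> \<bar>t - (\<Sum>\<alpha>\<in>\<A>. pr \<alpha>)\<bar> * (4 * exp t)"
    unfolding abs_mult
  proof (rule mult_left_mono)
    have "\<bar>?E (\<lambda>G. f (Suc (X G)))\<bar> \<le> ?E (\<lambda>G. \<bar>f (Suc (X G))\<bar>)"
      by (rule integral_abs_bound)
    also have "\<dots> \<le> ?E (\<lambda>G. 2 * exp t)" by (intro integral_mono int fb)
    also have "\<dots> \<le> 4 * exp t" by simp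
    finally show "\<bar>?E (\<lambda>G. f (Suc (X G)))\<bar> \<le> 4 * exp t" .
  qed simp
  moreover have "\<bar>\<Sum>\<alpha>\<in>\<A>. pr \<alpha> * (?E (\<lambda>G. f (Suc (X G))) - ?E (\<lambda>G. f (X (G \<union> \<alpha>))))\<bar>
      \<le> (\<Sum>\<alpha>\<in>\<A>. pr \<alpha> * (4 * exp t * \<rho> \<alpha>))"
    by (intro order_trans[OF sum_abs] sum_mono) (auto simp: abs_mult pr0 intro!: mult_mono neighbour)
  moreover have "(\<Sum>\<alpha>\<in>\<A>. pr \<alpha> * (4 * exp t * \<rho> \<alpha>)) = 4 * exp t * (\<Sum>\<alpha>\<in>\<A>. pr \<alpha> * \<rho> \<alpha>)"
    by (simp add: sum_distrib_left mult_ac)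
  ultimately have "\<bar>?E (\<lambda>G. h (X G)) - poisson_mean t h\<bar> \<le>
      \<bar>t - (\<Sum>\<alpha>\<in>\<A>. pr \<alpha>)\<bar> * (4 * exp t) + 4 * exp t * (\<Sum>\<alpha>\<in>\<A>. pr \<alpha> * \<rho> \<alpha>)"
    unfolding eq by linarith
  then show ?thesis unfolding X_def pr_def by (simp add: algebra_simps)
qed


section \<open>Cycles and the vertex sequences that traverse them\<close>

definition complete_edges :: "'v set \<Rightarrow> 'v set set" where
  "complete_edges V = {{i, j} | i j. i \<in> V \<and> j \<in> V \<and> i \<noteq> j}"

lemma Suc_mod_less: "i < k \<Longrightarrow> Suc i mod k = (if Suc i = k then 0 else Suc i)"
  by (auto simp: mod_Suc)

lemma Suc_mod_bound: "i < k \<Longrightarrow> Suc i mod k < k"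
  by simp

lemma cycle_edges_image: "cycle_edges vs = (\<lambda>i. {vs ! i, vs ! (Suc i mod length vs)}) ` {..<length vs}"
  by (auto simp: cycle_edges_def)

lemma finite_cycle_edges: "finite (cycle_edges vs)"
  by (simp add: cycle_edges_image)

lemma bij_betw_Suc_mod: "bij_betw (\<lambda>i. Suc i mod k) {..<k} {..<k}"
proof -
  have inj: "inj_on (\<lambda>i. Suc i mod k) {..<k}"
    by (auto simp: inj_on_def Suc_mod_less split: if_splits)
  have "(\<lambda>i. Suc i mod k) ` {..<k} \<subseteq> {..<k}" by auto
  then show ?thesis using endo_inj_surj[OF _ _ inj] inj by (simp add: bij_betw_def)
qed

lemma inj_on_cycle_edge:
  assumes "distinct vs" "3 \<le> length vs"
  shows "inj_on (\<lambda>i. {vs ! i, vs ! (Suc i mod length vs)}) {..<length vs}"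
proof (rule inj_onI)
  fix i j
  assume ij: "i \<in> {..<length vs}" "j \<in> {..<length vs}"
    and eq: "{vs ! i, vs ! (Suc i mod length vs)} = {vs ! j, vs ! (Suc j mod length vs)}"
  have l: "Suc i mod length vs < length vs" "Suc j mod length vs < length vs"
    using ij by (auto intro!: Suc_mod_bound)
  have "i = j \<or> (i = Suc j mod length vs \<and> Suc i mod length vs = j)"
    using eq ij l assms(1) by (auto simp: doubleton_eq_iff nth_eq_iff_index_eq)
  then show "i = j"
    using ij assms(2) by (auto simp: Suc_mod_less split: if_splits)
qed

lemma card_cycle_edges:
  assumes "distinct vs" "3 \<le> length vs"
  shows "card (cycle_edges vs) = length vs"
  unfolding cycle_edges_image using card_image[OF inj_on_cycle_edge[OF assms]] by simp

lemma prod_cycle_edges: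
  assumes "distinct vs" "3 \<le> length vs"
  shows "(\<Prod>e\<in>cycle_edges vs. g e) = (\<Prod>i<length vs. g {vs ! i, vs ! (Suc i mod length vs)})"
  unfolding cycle_edges_image by (subst prod.reindex[OF inj_on_cycle_edge[OF assms]]) simp

lemma Union_cycle_edges: "\<Union> (cycle_edges vs) = set vs"
proof
  have "vs ! (Suc i mod length vs) \<in> set vs" if "i < length vs" for i
    using that by (intro nth_mem Suc_mod_bound)
  then show "\<Union> (cycle_edges vs) \<subseteq> set vs"
    by (auto simp: cycle_edges_image)
  show "set vs \<subseteq> \<Union> (cycle_edges vs)"
    by (auto simp: cycle_edges_image in_set_conv_nth)
qed

lemma cycle_edges_subset_complete:
  assumes "distinct vs" "2 \<le> length vs" "set vs \<subseteq> V"
  shows "cycle_edges vs \<subseteq> complete_edges V"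
proof
  fix e assume "e \<in> cycle_edges vs"
  then obtain i where i: "i < length vs" "e = {vs ! i, vs ! (Suc i mod length vs)}"
    by (auto simp: cycle_edges_image)
  have l: "Suc i mod length vs < length vs" using i(1) by (rule Suc_mod_bound)
  have "i \<noteq> Suc i mod length vs" using i assms(2) by (auto simp: Suc_mod_less)
  then have "vs ! i \<noteq> vs ! (Suc i mod length vs)"
    using nth_eq_iff_index_eq[OF assms(1) i(1) l] by simp
  moreover have "vs ! i \<in> V" "vs ! (Suc i mod length vs) \<in> V"
    using nth_mem[OF i(1)] nth_mem[OF l] assms(3) by blast+
  ultimately show "e \<in> complete_edges V" unfolding complete_edges_def i(2) by blast
qed

lemma prod_vertices_cycle_edges:
  fixes x :: "'v \<Rightarrow> real"
  assumes "distinct vs" "3 \<le> length vs"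
  shows "(\<Prod>e\<in>cycle_edges vs. \<Prod>i\<in>e. x i) = (\<Prod>v\<leftarrow>vs. (x v)\<^sup>2)"
proof -
  let ?k = "length vs"
  have "(\<Prod>e\<in>cycle_edges vs. \<Prod>i\<in>e. x i) = (\<Prod>i<?k. x (vs ! i) * x (vs ! (Suc i mod ?k)))"
    unfolding prod_cycle_edges[OF assms]
  proof (intro prod.cong refl)
    fix i assume "i \<in> {..<?k}"
    then have "vs ! i \<noteq> vs ! (Suc i mod ?k)"
      using assms by (subst nth_eq_iff_index_eq) (auto simp: Suc_mod_less)
    then show "(\<Prod>i\<in>{vs ! i, vs ! (Suc i mod ?k)}. x i) = x (vs ! i) * x (vs ! (Suc i mod ?k))"
      by simp
  qed
  also have "\<dots> = (\<Prod>i<?k. x (vs ! i)) * (\<Prod>i<?k. x (vs ! (Suc i mod ?k)))"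
    by (rule prod.distrib)
  also have "(\<Prod>i<?k. x (vs ! (Suc i mod ?k))) = (\<Prod>i<?k. x (vs ! i))"
    by (rule prod.reindex_bij_betw[OF bij_betw_Suc_mod, of "\<lambda>i. x (vs ! i)"])
  also have "(\<Prod>i<?k. x (vs ! i)) * (\<Prod>i<?k. x (vs ! i)) = (\<Prod>i<?k. (x (vs ! i))\<^sup>2)"
    by (simp add: power2_eq_square prod.distrib)
  also have "\<dots> = (\<Prod>v\<leftarrow>vs. (x v)\<^sup>2)"
    by (simp add: prod.list_conv_set_nth atLeast0LessThan)
  finally show ?thesis .
qed

lemma cycle_edges_rotate1: "cycle_edges (rotate1 vs) = cycle_edges vs"
proof (cases vs)
  case (Cons a as)
  let ?k = "length vs"
  have k: "0 < ?k" using Cons by simp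
  have nth: "rotate1 vs ! i = vs ! (Suc i mod ?k)" if "i < ?k" for i
    using nth_rotate1[OF that] .
  have "cycle_edges (rotate1 vs) = (\<lambda>i. {vs ! i, vs ! (Suc i mod ?k)}) ` (\<lambda>i. Suc i mod ?k) ` {..<?k}"
    unfolding cycle_edges_image image_image length_rotate1
    by (intro image_cong refl) (simp add: nth nth[OF Suc_mod_bound])
  then show ?thesis
    using bij_betw_Suc_mod[of ?k] by (simp add: bij_betw_def cycle_edges_image)
qed simp

lemma cycle_edges_rotate: "cycle_edges (rotate i vs) = cycle_edges vs"
  by (induction i) (simp_all add: cycle_edges_rotate1)

lemma cycle_edges_rev: "cycle_edges (rev vs) = cycle_edges vs"
proof -
  have sub: "cycle_edges (rev vs) \<subseteq> cycle_edges vs" for vs :: "'a list"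
  proof
    fix e assume "e \<in> cycle_edges (rev vs)"
    then obtain i where i: "i < length vs" "e = {rev vs ! i, rev vs ! (Suc i mod length vs)}"
      by (auto simp: cycle_edges_image)
    have l: "Suc i mod length vs < length vs" using i(1) by (rule Suc_mod_bound)
    let ?m = "length vs - Suc (Suc i mod length vs)"
    have m: "?m < length vs" using i(1) by simp
    have "Suc ?m mod length vs = length vs - Suc i"
    proof (cases "Suc i = length vs")
      case True
      then have "Suc i mod length vs = 0" by simp
      then have "?m = length vs - 1" by simp
      then have "Suc ?m = length vs" using i(1) by simp
      then show ?thesis using True by simp
    next
      case False
      then show ?thesis using i(1) by (auto simp: Suc_mod_less Suc_diff_Suc)
    qed
    then have "e = {vs ! ?m, vs ! (Suc ?m mod length vs)}"
      using i l by (auto simp: rev_nth)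
    then show "e \<in> cycle_edges vs" using m unfolding cycle_edges_image by blast
  qed
  show ?thesis using sub[of vs] sub[of "rev vs"] by simp
qed

lemma cycle_edges_neighbour:
  assumes "distinct vs" "Suc (Suc i) < length vs" "{vs ! Suc i, w} \<in> cycle_edges vs"
  shows "w = vs ! i \<or> w = vs ! Suc (Suc i)"
proof -
  obtain j where j: "j < length vs" "{vs ! Suc i, w} = {vs ! j, vs ! (Suc j mod length vs)}"
    using assms(3) by (auto simp: cycle_edges_image)
  have l: "Suc j mod length vs < length vs" using j(1) by (rule Suc_mod_bound)
  consider "vs ! Suc i = vs ! j" "w = vs ! (Suc j mod length vs)"
    | "vs ! Suc i = vs ! (Suc j mod length vs)" "w = vs ! j"
    using j(2) by (auto simp: doubleton_eq_iff)
  then show ?thesis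
  proof cases
    case 1
    then have "j = Suc i" using assms j(1) nth_eq_iff_index_eq[OF assms(1), of "Suc i" j] by auto
    then show ?thesis using 1 assms(2) by simp
  next
    case 2
    then have "Suc j mod length vs = Suc i"
      using assms l nth_eq_iff_index_eq[OF assms(1), of "Suc i" "Suc j mod length vs"] by auto
    then have "j = i" using j(1) by (auto simp: Suc_mod_less split: if_splits)
    then show ?thesis using 2 by simp
  qed
qed

definition traversals :: "nat \<Rightarrow> 'v set set \<Rightarrow> 'v list set" where
  "traversals k F = {vs. distinct vs \<and> length vs = k \<and> cycle_edges vs = F}"

text \<open>The first step of a traversal decides the rest, because every vertex of a cycle has only
  two neighbours. The same argument shows that a traversal of a shorter cycle inside a given
  cycle could not close up.\<close>

lemma traversal_determined:
  assumes us: "distinct us" "3 \<le> length us" and vs: "distinct vs" "3 \<le> length vs"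
    and sub: "cycle_edges us \<subseteq> cycle_edges vs"
    and start: "us ! 0 = vs ! 0" "us ! 1 = vs ! 1"
  shows "us = vs"
proof -
  let ?k = "length us"
  have "card (cycle_edges us) \<le> card (cycle_edges vs)"
    by (rule card_mono[OF finite_cycle_edges sub])
  then have le: "?k \<le> length vs" using us vs by (simp add: card_cycle_edges)
  have pairs: "Suc i < ?k \<Longrightarrow> us ! i = vs ! i \<and> us ! Suc i = vs ! Suc i" for i
  proof (induction i)
    case 0
    then show ?case using start by simp
  next
    case (Suc i)
    then have IH: "us ! i = vs ! i" "us ! Suc i = vs ! Suc i" by auto
    have "{us ! Suc i, us ! Suc (Suc i)} \<in> cycle_edges us"
      unfolding cycle_edges_image using Suc.prems
      by (intro image_eqI[of _ _ "Suc i"]) auto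
    then have "{vs ! Suc i, us ! Suc (Suc i)} \<in> cycle_edges vs"
      using IH sub by auto
    then have "us ! Suc (Suc i) = vs ! i \<or> us ! Suc (Suc i) = vs ! Suc (Suc i)"
      using cycle_edges_neighbour[OF vs(1)] Suc.prems le by auto
    moreover have "us ! Suc (Suc i) \<noteq> us ! i"
      using Suc.prems us by (simp add: nth_eq_iff_index_eq)
    ultimately show ?case using IH by simp
  qed
  have agree: "us ! i = vs ! i" if "i < ?k" for i
  proof (cases i)
    case 0
    then show ?thesis using start by simp
  next
    case (Suc j)
    then show ?thesis using pairs[of j] that by simp
  qed
  have "\<not> ?k < length vs"
  proof
    assume lt: "?k < length vs"
    define m where "m = ?k - 3"
    have m: "?k = Suc (Suc (Suc m))" using us(2) by (simp add: m_def)
    have "{us ! Suc (Suc m), us ! 0} \<in> cycle_edges us"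
      unfolding cycle_edges_image using m by (intro image_eqI[of _ _ "Suc (Suc m)"]) auto
    then have "{vs ! Suc (Suc m), vs ! 0} \<in> cycle_edges vs"
      using sub agree[of 0] agree[of "Suc (Suc m)"] m by auto
    then have "vs ! 0 = vs ! Suc m \<or> vs ! 0 = vs ! Suc (Suc (Suc m))"
      using cycle_edges_neighbour[OF vs(1), of "Suc m"] lt m by simp
    moreover have "vs \<noteq> []" using lt by auto
    then have "vs ! 0 \<noteq> vs ! Suc m" "vs ! 0 \<noteq> vs ! Suc (Suc (Suc m))"
      using lt m vs(1) nth_eq_iff_index_eq[OF vs(1), of 0 "Suc m"]
        nth_eq_iff_index_eq[OF vs(1), of 0 "Suc (Suc (Suc m))"] by auto
    ultimately show False by blast
  qed
  then show ?thesis using agree le by (intro nth_equalityI) auto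
qed

lemma traversal_starting_with:
  assumes "distinct vs" "length vs = k" "3 \<le> k" "{a, b} \<in> cycle_edges vs"
  obtains us where "us \<in> traversals k (cycle_edges vs)" "us ! 0 = a" "us ! 1 = b"
proof -
  obtain i where i: "i < k" "{a, b} = {vs ! i, vs ! (Suc i mod k)}"
    using assms(2,4) by (auto simp: cycle_edges_image)
  then consider "a = vs ! i" "b = vs ! (Suc i mod k)" | "a = vs ! (Suc i mod k)" "b = vs ! i"
    by (auto simp: doubleton_eq_iff)
  then show ?thesis
  proof cases
    case 1
    have "rotate i vs ! 0 = a" "rotate i vs ! 1 = b"
      using 1 i(1) assms(2,3) by (simp_all add: nth_rotate)
    moreover have "rotate i vs \<in> traversals k (cycle_edges vs)"
      using assms by (simp add: traversals_def cycle_edges_rotate)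
    ultimately show ?thesis using that by blast
  next
    case 2
    define r where "r = rotate (i + 2) vs"
    have r: "r ! j = vs ! ((i + 2 + j) mod k)" if "j < k" for j
      unfolding r_def using nth_rotate[of j vs "i + 2"] that assms(2) by (simp only:)
    have len: "length r = k" using assms(2) by (simp add: r_def)
    have "rev r ! 0 = vs ! ((i + 2 + (k - 1)) mod k)"
      using assms(3) r[of "k - 1"] by (simp add: rev_nth len)
    also have "i + 2 + (k - 1) = Suc i + k" using assms(3) by simp
    also have "(Suc i + k) mod k = Suc i mod k" by (rule mod_add_self2)
    finally have first: "rev r ! 0 = a" using 2 by simp
    have "rev r ! 1 = vs ! ((i + 2 + (k - 2)) mod k)"
      using assms(3) r[of "k - 2"] by (simp add: rev_nth len numeral_2_eq_2)
    also have "i + 2 + (k - 2) = i + k" using assms(3) by simp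
    also have "(i + k) mod k = i" using i(1) by simp
    finally have "rev r ! 1 = b" using 2 by simp
    moreover have "rev r \<in> traversals k (cycle_edges vs)"
      unfolding r_def using assms by (simp add: traversals_def cycle_edges_rotate cycle_edges_rotate1 cycle_edges_rev)
    ultimately show ?thesis using that first by blast
  qed
qed

text \<open>Traversals correspond to ordered pairs of adjacent vertices, as every such pair starts exactly
  one traversal.\<close>

lemma card_traversals:
  assumes "distinct vs" "length vs = k" "3 \<le> k"
  shows "card (traversals k (cycle_edges vs)) = 2 * k"
proof -
  let ?F = "cycle_edges vs"
  define nxt where "nxt i = Suc i mod k" for i
  have nxt: "nxt i < k" for i using assms(3) by (simp add: nxt_def)
  have nxt_if: "nxt i = (if Suc i = k then 0 else Suc i)" if "i < k" for i
    using that by (simp add: nxt_def Suc_mod_less)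
  have eq_iff: "vs ! i = vs ! j \<longleftrightarrow> i = j" if "i < k" "j < k" for i j
    using that assms by (simp add: nth_eq_iff_index_eq)
  define fwd where "fwd = (\<lambda>i. (vs ! i, vs ! nxt i)) ` {..<k}"
  define bwd where "bwd = (\<lambda>i. (vs ! nxt i, vs ! i)) ` {..<k}"
  have adjacent: "(a, b) \<in> fwd \<union> bwd \<longleftrightarrow> {a, b} \<in> ?F" for a b
    unfolding fwd_def bwd_def cycle_edges_image assms(2) nxt_def by (auto simp: doubleton_eq_iff)
  have "bij_betw (\<lambda>us. (us ! 0, us ! 1)) (traversals k ?F) (fwd \<union> bwd)"
  proof (rule bij_betw_imageI)
    show "inj_on (\<lambda>us. (us ! 0, us ! 1)) (traversals k ?F)"
      using assms(3) by (intro inj_onI traversal_determined) (auto simp: traversals_def)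
    show "(\<lambda>us. (us ! 0, us ! 1)) ` traversals k ?F = fwd \<union> bwd"
    proof (intro equalityI subsetI)
      fix ab assume "ab \<in> (\<lambda>us. (us ! 0, us ! 1)) ` traversals k ?F"
      then obtain us where us: "us \<in> traversals k ?F" and ab: "ab = (us ! 0, us ! 1)" by auto
      have "{us ! 0, us ! (Suc 0 mod length us)} \<in> cycle_edges us"
        unfolding cycle_edges_image using us assms(3) by (intro imageI) (auto simp: traversals_def)
      then have "{us ! 0, us ! 1} \<in> ?F" using us assms(3) by (auto simp: traversals_def)
      then show "ab \<in> fwd \<union> bwd" unfolding ab by (simp only: adjacent)
    next
      fix ab assume ab: "ab \<in> fwd \<union> bwd"
      obtain a b where [simp]: "ab = (a, b)" by (cases ab)
      have "{a, b} \<in> ?F" using ab adjacent by simp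
      then obtain us where "us \<in> traversals k ?F" "us ! 0 = a" "us ! 1 = b"
        by (rule traversal_starting_with[OF assms])
      then show "ab \<in> (\<lambda>us. (us ! 0, us ! 1)) ` traversals k ?F"
        by (intro image_eqI[of _ _ us]) auto
    qed
  qed
  then have "card (traversals k ?F) = card (fwd \<union> bwd)" by (rule bij_betw_same_card)
  also have "\<dots> = card fwd + card bwd"
  proof (rule card_Un_disjoint)
    show "fwd \<inter> bwd = {}"
    proof (rule ccontr)
      assume "fwd \<inter> bwd \<noteq> {}"
      then obtain i j where ij: "i < k" "j < k" "vs ! i = vs ! nxt j" "vs ! nxt i = vs ! j"
        by (auto simp: fwd_def bwd_def)
      then have "i = nxt j" "nxt i = j" using eq_iff nxt by auto
      then show False using ij(1,2) assms(3) by (auto simp: nxt_if split: if_splits)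
    qed
  qed (auto simp: fwd_def bwd_def)
  also have "card fwd = k"
    unfolding fwd_def by (subst card_image) (auto simp: inj_on_def eq_iff)
  also have "card bwd = k"
    unfolding bwd_def by (subst card_image) (auto simp: inj_on_def eq_iff)
  finally show ?thesis by simp
qed

text \<open>Hence a cycle other than \<open>\<alpha>\<close> always has an edge outside \<open>\<alpha>\<close>.\<close>

lemma subcycle_eq:
  assumes "is_cycle k F" "is_cycle k' F'" "F' \<subseteq> F"
  shows "F' = F"
proof -
  obtain vs where vs: "distinct vs" "length vs = k" "F = cycle_edges vs" and k: "3 \<le> k"
    using assms(1) by (auto simp: is_cycle_def)
  obtain us where us: "distinct us" "length us = k'" "F' = cycle_edges us" and k': "3 \<le> k'"
    using assms(2) by (auto simp: is_cycle_def)
  have "{us ! 0, us ! (Suc 0 mod length us)} \<in> cycle_edges us"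
    unfolding cycle_edges_image using us k' by (intro imageI) auto
  then have "{us ! 0, us ! 1} \<in> cycle_edges vs" using us vs k' assms(3) by auto
  then obtain ws where "ws \<in> traversals k (cycle_edges vs)" "ws ! 0 = us ! 0" "ws ! 1 = us ! 1"
    by (rule traversal_starting_with[OF vs(1,2) k])
  then show ?thesis
    using traversal_determined[of us ws] us vs k k' assms(3) by (auto simp: traversals_def)
qed

lemma card_is_cycle: "is_cycle k F \<Longrightarrow> card F = k"
  by (auto simp: is_cycle_def card_cycle_edges)

text \<open>Walking along a cycle that shares some but not all of its edges with \<open>\<alpha>\<close>, there is a
  place where \<open>\<alpha>\<close> is entered. Starting there gives a traversal with its first vertex in \<open>\<alpha>\<close>
  whose closing edge is not in \<open>\<alpha>\<close>.\<close>

lemma traversal_entering: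
  assumes \<beta>: "is_cycle k \<beta>" and meets: "\<beta> \<inter> \<alpha> \<noteq> {}" and not_sub: "\<not> \<beta> \<subseteq> \<alpha>"
  obtains vs where "vs \<in> traversals k \<beta>" "hd vs \<in> \<Union> \<alpha>" "{last vs, hd vs} \<notin> \<alpha>"
proof -
  obtain vs where vs: "distinct vs" "length vs = k" "\<beta> = cycle_edges vs" and k: "3 \<le> k"
    using \<beta> by (auto simp: is_cycle_def)
  define edge where "edge i = {vs ! (i mod k), vs ! (Suc i mod k)}" for i
  have \<beta>_edges: "\<beta> = edge ` {..<k}"
    unfolding vs(3) cycle_edges_image vs(2) edge_def by (intro image_cong) auto
  have edge_mod: "edge (i mod k) = edge i" for i
    by (simp add: edge_def mod_Suc_eq)
  have "\<exists>i. edge i \<notin> \<alpha> \<and> edge (Suc i) \<in> \<alpha>"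
  proof (rule ccontr)
    assume none: "\<nexists>i. edge i \<notin> \<alpha> \<and> edge (Suc i) \<in> \<alpha>"
    obtain j where j: "j < k" "edge j \<notin> \<alpha>" using not_sub \<beta>_edges by auto
    have all: "edge (j + m) \<notin> \<alpha>" for m
      by (induction m) (use j none in auto)
    have "edge i \<notin> \<alpha>" if "i < k" for i
    proof -
      have "(j + (i + (k - j))) mod k = i" using j(1) that by simp
      then show ?thesis using all[of "i + (k - j)"] edge_mod by metis
    qed
    then show False using meets \<beta>_edges by auto
  qed
  then obtain i where i: "edge i \<notin> \<alpha>" "edge (Suc i) \<in> \<alpha>" by blast
  define us where "us = rotate (Suc i) vs"
  have us_nth: "us ! j = vs ! ((Suc i + j) mod k)" if "j < k" for j
    unfolding us_def using nth_rotate[of j vs "Suc i"] that vs(2) by (simp only:)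
  have len: "length us = k" using vs(2) by (simp add: us_def)
  then have "us \<noteq> []" using k by auto
  then have hd: "hd us = vs ! (Suc i mod k)" using us_nth[of 0] k by (simp add: hd_conv_nth)
  have "Suc i + (k - 1) = i + k" using k by simp
  then have last: "last us = vs ! (i mod k)"
    using us_nth[of "k - 1"] k \<open>us \<noteq> []\<close> len by (simp add: last_conv_nth del: add_Suc)
  show ?thesis
  proof
    show "us \<in> traversals k \<beta>"
      using vs by (simp add: traversals_def us_def cycle_edges_rotate cycle_edges_rotate1)
    show "hd us \<in> \<Union> \<alpha>" using i(2) by (auto simp: edge_def hd)
    show "{last us, hd us} \<notin> \<alpha>" using i(1) by (simp add: edge_def hd last)
  qed
qed


section \<open>Weight sums over vertex sequences\<close>

definition vertex_seqs :: "'v set \<Rightarrow> nat \<Rightarrow> 'v list set" where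
  "vertex_seqs V k = {vs. set vs \<subseteq> V \<and> length vs = k}"

lemma finite_vertex_seqs: "finite V \<Longrightarrow> finite (vertex_seqs V k)"
  unfolding vertex_seqs_def by (rule finite_lists_length_eq)

lemma vertex_seqs_0: "vertex_seqs V 0 = {[]}"
  by (auto simp: vertex_seqs_def)

lemma sum_vertex_seqs_Suc:
  "(\<Sum>vs\<in>vertex_seqs V (Suc k). g vs) = (\<Sum>v\<in>V. \<Sum>vs\<in>vertex_seqs V k. g (v # vs))"
proof -
  have "bij_betw (\<lambda>(v, vs). v # vs) (V \<times> vertex_seqs V k) (vertex_seqs V (Suc k))"
    by (rule bij_betw_byWitness[where f' = "\<lambda>vs. (hd vs, tl vs)"])
      (auto simp: vertex_seqs_def length_Suc_conv)
  from sum.reindex_bij_betw[OF this, of g] show ?thesis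
    by (simp add: sum.cartesian_product case_prod_beta)
qed

text \<open>The weights \<open>x\<close> are normalised so that the sum of their squares stays bounded, whereas the
  sum of their fourth powers is the small quantity that controls all errors.\<close>

locale vertex_weights =
  fixes V :: "'v set" and x :: "'v \<Rightarrow> real" and K :: real
  assumes finite_V: "finite V" and x_nonneg: "\<And>v. v \<in> V \<Longrightarrow> 0 \<le> x v"
    and K_ge_1: "1 \<le> K" and sum_sq_le: "(\<Sum>v\<in>V. (x v)\<^sup>2) \<le> K"
begin

abbreviation q :: real where "q \<equiv> \<Sum>v\<in>V. (x v)\<^sup>2"
abbreviation s4 :: real where "s4 \<equiv> \<Sum>v\<in>V. (x v) ^ 4"

abbreviation sq_prod :: "'v list \<Rightarrow> real" where "sq_prod vs \<equiv> \<Prod>v\<leftarrow>vs. (x v)\<^sup>2"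
abbreviation sq_sum :: "'v list \<Rightarrow> real" where "sq_sum vs \<equiv> \<Sum>v\<leftarrow>vs. (x v)\<^sup>2"

lemma q_nonneg: "0 \<le> q" by (rule sum_nonneg) simp
lemma s4_nonneg: "0 \<le> s4" by (rule sum_nonneg) simp
lemma K_nonneg: "0 \<le> K" using K_ge_1 by simp
lemma sq_prod_nonneg: "0 \<le> sq_prod vs" by (induction vs) auto
lemma sq_sum_nonneg: "0 \<le> sq_sum vs" by (induction vs) auto

lemma q_power_le: "q ^ k \<le> K ^ k"
  by (rule power_mono[OF sum_sq_le q_nonneg])

lemma K_power_mono: "j \<le> k \<Longrightarrow> K ^ j \<le> K ^ k"
  by (rule power_increasing[OF _ K_ge_1])

lemma x_sq_le_q: "v \<in> V \<Longrightarrow> (x v)\<^sup>2 \<le> q"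
  by (rule member_le_sum) (auto simp: finite_V)

lemma sum_sq_prod: "(\<Sum>vs\<in>vertex_seqs V k. sq_prod vs) = q ^ k"
proof (induction k)
  case (Suc k)
  have "(\<Sum>vs\<in>vertex_seqs V (Suc k). sq_prod vs) =
      (\<Sum>v\<in>V. (x v)\<^sup>2 * (\<Sum>vs\<in>vertex_seqs V k. sq_prod vs))"
    by (simp add: sum_vertex_seqs_Suc sum_distrib_left)
  then show ?case by (simp add: Suc sum_distrib_right)
qed (simp add: vertex_seqs_0)

text \<open>Marking one vertex of the sequence turns its weight from a square into a fourth power. All
  error terms below reduce to this sum.\<close>

lemma sum_sq_prod_sq_sum_le:
  "(\<Sum>vs\<in>vertex_seqs V k. sq_prod vs * sq_sum vs) \<le> k * K ^ k * s4"
proof (induction k)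
  case (Suc k)
  let ?S = "\<Sum>vs\<in>vertex_seqs V k. sq_prod vs * sq_sum vs"
  have "(\<Sum>vs\<in>vertex_seqs V (Suc k). sq_prod vs * sq_sum vs) =
      (\<Sum>v\<in>V. \<Sum>vs\<in>vertex_seqs V k. (x v) ^ 4 * sq_prod vs + (x v)\<^sup>2 * (sq_prod vs * sq_sum vs))"
    by (simp add: sum_vertex_seqs_Suc algebra_simps power2_eq_square power4_eq_xxxx)
  also have "\<dots> = s4 * q ^ k + q * ?S"
    by (simp add: sum.distrib sum_distrib_left[symmetric] sum_distrib_right[symmetric] sum_sq_prod)
  also have "\<dots> \<le> s4 * K ^ Suc k + K * (k * K ^ k * s4)"
  proof (rule add_mono)
    show "s4 * q ^ k \<le> s4 * K ^ Suc k"
      using q_power_le[of k] K_power_mono[of k "Suc k"] by (intro mult_left_mono s4_nonneg) auto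
    show "q * ?S \<le> K * (k * K ^ k * s4)"
      by (intro mult_mono sum_sq_le Suc.IH K_nonneg sum_nonneg mult_nonneg_nonneg
          sq_prod_nonneg sq_sum_nonneg)
  qed
  finally show ?case by (simp add: algebra_simps)
qed (simp add: vertex_seqs_0)

text \<open>A repeated vertex carries at least the fourth power of its weight.\<close>

lemma sum_sq_prod_not_distinct_le:
  "(\<Sum>vs\<in>vertex_seqs V k. of_bool (\<not> distinct vs) * sq_prod vs) \<le> (real k)\<^sup>2 * K ^ k * s4"
proof (induction k)
  case (Suc k)
  let ?N = "\<Sum>vs\<in>vertex_seqs V k. of_bool (\<not> distinct vs) * sq_prod vs"
  have repeat: "(\<Sum>v\<in>V. of_bool (v \<in> set vs) * (x v)\<^sup>2) \<le> sq_sum vs" if "vs \<in> vertex_seqs V k" for vs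
  proof -
    have "(\<Sum>v\<in>V. of_bool (v \<in> set vs) * (x v)\<^sup>2) = (\<Sum>v\<in>set vs. (x v)\<^sup>2)"
      using that finite_V unfolding vertex_seqs_def by (intro sum.mono_neutral_cong_right) auto
    also have "\<dots> \<le> sq_sum vs"
    proof (induction vs)
      case (Cons a vs)
      then show ?case by (cases "a \<in> set vs") (auto simp: insert_absorb intro: order_trans)
    qed simp
    finally show ?thesis .
  qed
  have "(\<Sum>vs\<in>vertex_seqs V (Suc k). of_bool (\<not> distinct vs) * sq_prod vs) \<le>
      (\<Sum>v\<in>V. \<Sum>vs\<in>vertex_seqs V k. sq_prod vs * (of_bool (v \<in> set vs) * (x v)\<^sup>2)
        + (x v)\<^sup>2 * (of_bool (\<not> distinct vs) * sq_prod vs))"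
    unfolding sum_vertex_seqs_Suc by (intro sum_mono) (auto simp: sq_prod_nonneg)
  also have "\<dots> = (\<Sum>vs\<in>vertex_seqs V k. sq_prod vs * (\<Sum>v\<in>V. of_bool (v \<in> set vs) * (x v)\<^sup>2)) + q * ?N"
    unfolding sum.distrib
    by (subst sum.swap) (simp add: sum_distrib_left[symmetric] sum_distrib_right[symmetric])
  also have "\<dots> \<le> (\<Sum>vs\<in>vertex_seqs V k. sq_prod vs * sq_sum vs) + q * ?N"
    by (intro add_right_mono sum_mono mult_left_mono repeat sq_prod_nonneg)
  also have "\<dots> \<le> k * K ^ k * s4 + K * ((real k)\<^sup>2 * K ^ k * s4)"
    by (intro add_mono sum_sq_prod_sq_sum_le mult_mono sum_sq_le Suc.IH K_nonneg sum_nonneg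
        mult_nonneg_nonneg sq_prod_nonneg) auto
  also have "\<dots> \<le> k * K ^ Suc k * s4 + K * ((real k)\<^sup>2 * K ^ k * s4)"
    by (intro add_right_mono mult_right_mono mult_left_mono K_power_mono s4_nonneg) auto
  also have "\<dots> = (real k + (real k)\<^sup>2) * (K ^ Suc k * s4)"
    by (simp add: algebra_simps)
  also have "\<dots> \<le> (real (Suc k))\<^sup>2 * (K ^ Suc k * s4)"
    by (intro mult_right_mono mult_nonneg_nonneg zero_le_power K_nonneg s4_nonneg)
      (simp add: power2_eq_square algebra_simps)
  finally show ?case by (simp only: mult.assoc)
qed (simp add: vertex_seqs_0)


section \<open>Sums over cycles\<close>

definition cycles :: "nat \<Rightarrow> 'v set set set" where
  "cycles k = {F. F \<subseteq> complete_edges V \<and> is_cycle k F}"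

definition sigma :: "'v set set \<Rightarrow> real" where
  "sigma F = (\<Sum>v\<in>\<Union>F. (x v)\<^sup>2)"

text \<open>The connection probability \<open>p e\<close> agrees with the product weight \<open>y e\<close> to first order. Products
  of \<open>y\<close> along a cycle are easy to sum, as every vertex contributes its squared weight.\<close>

definition y :: "'v set \<Rightarrow> real" where "y e = (\<Prod>v\<in>e. x v)"
definition p :: "'v set \<Rightarrow> real" where "p e = y e / (1 + y e)"

lemma finite_complete_edges: "finite (complete_edges V)"
proof -
  have "complete_edges V \<subseteq> Pow V" by (auto simp: complete_edges_def)
  then show ?thesis by (rule finite_subset) (simp add: finite_V)
qed

lemma finite_cycles: "finite (cycles k)"
  by (rule finite_subset[of _ "Pow (complete_edges V)"])
    (auto simp: cycles_def finite_complete_edges)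

lemma y_nonneg: "e \<in> complete_edges V \<Longrightarrow> 0 \<le> y e"
  unfolding y_def by (rule prod_nonneg) (auto simp: complete_edges_def x_nonneg)

lemma p_nonneg: "e \<in> complete_edges V \<Longrightarrow> 0 \<le> p e"
  unfolding p_def using y_nonneg[of e] by simp

lemma p_le_y: "e \<in> complete_edges V \<Longrightarrow> p e \<le> y e"
  unfolding p_def using y_nonneg[of e] by (simp add: divide_simps mult_le_cancel_left1 algebra_simps)

lemma p_le_1: "e \<in> complete_edges V \<Longrightarrow> p e \<le> 1"
  unfolding p_def using y_nonneg[of e] by (simp add: divide_simps)

lemma cycles_cases:
  assumes "F \<in> cycles k"
  obtains vs where "distinct vs" "length vs = k" "set vs \<subseteq> V" "F = cycle_edges vs" "3 \<le> k"
proof -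
  obtain vs where vs: "distinct vs" "length vs = k" "F = cycle_edges vs" "3 \<le> k"
    using assms by (auto simp: cycles_def is_cycle_def)
  have "\<Union>F \<subseteq> V" using assms by (auto simp: cycles_def complete_edges_def)
  then have "set vs \<subseteq> V" using vs by (simp add: Union_cycle_edges)
  then show ?thesis using that vs by blast
qed

lemma traversals_vertex_seqs:
  assumes "F \<in> cycles k"
  shows "traversals k F = {vs \<in> vertex_seqs V k. distinct vs \<and> cycle_edges vs = F}"
proof -
  obtain us where "set us \<subseteq> V" "F = cycle_edges us"
    using assms by (rule cycles_cases)
  then show ?thesis
    by (auto simp: traversals_def vertex_seqs_def simp flip: Union_cycle_edges)
qed

text \<open>Double counting: every cycle of length \<open>k\<close> has \<open>2 * k\<close> traversals.\<close>

lemma sum_cycles: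
  fixes g :: "'v set set \<Rightarrow> real"
  assumes "3 \<le> k"
  shows "2 * real k * (\<Sum>F\<in>cycles k. g F) =
    (\<Sum>vs\<in>vertex_seqs V k. of_bool (distinct vs) * g (cycle_edges vs))"
proof -
  let ?D = "{vs \<in> vertex_seqs V k. distinct vs}"
  have D: "finite ?D" using finite_vertex_seqs[OF finite_V] by simp
  have img: "cycle_edges ` ?D \<subseteq> cycles k"
    using cycle_edges_subset_complete[of _ V] assms
    by (fastforce simp: cycles_def is_cycle_def vertex_seqs_def)
  have "(\<Sum>vs\<in>vertex_seqs V k. of_bool (distinct vs) * g (cycle_edges vs)) =
      (\<Sum>vs\<in>?D. g (cycle_edges vs))"
    using finite_vertex_seqs[OF finite_V] by (intro sum.mono_neutral_cong_right) auto
  also have "\<dots> = (\<Sum>F\<in>cycles k. \<Sum>vs\<in>{vs \<in> ?D. cycle_edges vs = F}. g (cycle_edges vs))"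
    by (rule sum.group[symmetric, OF D finite_cycles img])
  also have "\<dots> = (\<Sum>F\<in>cycles k. 2 * real k * g F)"
  proof (intro sum.cong refl)
    fix F assume F: "F \<in> cycles k"
    then obtain us where us: "distinct us" "length us = k" "F = cycle_edges us"
      by (rule cycles_cases)
    have "{vs \<in> ?D. cycle_edges vs = F} = traversals k F"
      unfolding traversals_vertex_seqs[OF F] by auto
    moreover have "card (traversals k F) = 2 * k"
      using card_traversals[OF us(1,2) assms] us(3) by simp
    moreover have "(\<Sum>vs\<in>{vs \<in> ?D. cycle_edges vs = F}. g (cycle_edges vs)) =
        (\<Sum>vs\<in>{vs \<in> ?D. cycle_edges vs = F}. g F)"
      by (intro sum.cong) auto
    ultimately show "(\<Sum>vs\<in>{vs \<in> ?D. cycle_edges vs = F}. g (cycle_edges vs)) = 2 * real k * g F"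
      by simp
  qed
  finally show ?thesis by (simp add: sum_distrib_left)
qed

lemma sigma_nonneg: "0 \<le> sigma F"
  unfolding sigma_def by (rule sum_nonneg) simp

lemma sigma_cycle_edges: "distinct vs \<Longrightarrow> sigma (cycle_edges vs) = sq_sum vs"
  by (simp add: sigma_def Union_cycle_edges sum_list_distinct_conv_sum_set)

lemma prod_y_cycle_edges:
  "distinct vs \<Longrightarrow> 3 \<le> length vs \<Longrightarrow> (\<Prod>e\<in>cycle_edges vs. y e) = sq_prod vs"
  unfolding y_def by (rule prod_vertices_cycle_edges)

lemma sum_cycles_prod_sigma_le:
  assumes "3 \<le> k"
  shows "2 * real k * (\<Sum>F\<in>cycles k. (\<Prod>e\<in>F. y e) * sigma F) \<le> k * K ^ k * s4"
proof -
  have "2 * real k * (\<Sum>F\<in>cycles k. (\<Prod>e\<in>F. y e) * sigma F) \<le> (\<Sum>vs\<in>vertex_seqs V k. sq_prod vs * sq_sum vs)"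
    unfolding sum_cycles[OF assms] using assms
    by (intro sum_mono)
      (auto simp: vertex_seqs_def sigma_cycle_edges prod_y_cycle_edges sq_prod_nonneg sq_sum_nonneg)
  also have "\<dots> \<le> k * K ^ k * s4" by (rule sum_sq_prod_sq_sum_le)
  finally show ?thesis .
qed

lemma prod_one_minus_ge:
  fixes a :: "'b \<Rightarrow> real"
  assumes "finite F" "\<And>e. e \<in> F \<Longrightarrow> 0 \<le> a e \<and> a e \<le> 1"
  shows "1 - (\<Sum>e\<in>F. a e) \<le> (\<Prod>e\<in>F. 1 - a e)"
  using assms
proof (induction F rule: finite_induct)
  case (insert e F)
  have "(1 - a e) * (1 - (\<Sum>e\<in>F. a e)) \<le> (1 - a e) * (\<Prod>e\<in>F. 1 - a e)"
    using insert by (intro mult_left_mono) auto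
  moreover have "0 \<le> a e * (\<Sum>e\<in>F. a e)"
    using insert.prems by (intro mult_nonneg_nonneg sum_nonneg) auto
  ultimately show ?case using insert.hyps by (simp add: algebra_simps)
qed simp

text \<open>The inequality between the geometric and the arithmetic mean.\<close>

lemma y_le_sigma:
  assumes "F \<subseteq> complete_edges V" "e \<in> F"
  shows "y e \<le> sigma F"
proof -
  obtain i j where e: "e = {i, j}" "i \<in> V" "j \<in> V" "i \<noteq> j"
    using assms by (auto simp: complete_edges_def)
  have "\<Union>F \<subseteq> V" using assms(1) by (auto simp: complete_edges_def)
  then have "finite (\<Union>F)" using finite_V finite_subset by blast
  have "2 * (x i * x j) \<le> (x i)\<^sup>2 + (x j)\<^sup>2" by (rule order_trans[OF _ sum_squares_bound[of "x i" "x j"]]) simp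
  then have "y e \<le> (\<Sum>v\<in>{i, j}. (x v)\<^sup>2)"
    using e mult_nonneg_nonneg[OF x_nonneg x_nonneg, of i j] by (simp add: y_def)
  also have "\<dots> \<le> sigma F"
    unfolding sigma_def using \<open>finite (\<Union>F)\<close> assms(2) e(1) by (intro sum_mono2) auto
  finally show ?thesis .
qed

lemma prod_y_diff_prod_p:
  assumes "F \<in> cycles k"
  shows "(\<Prod>e\<in>F. p e) \<le> (\<Prod>e\<in>F. y e)"
    and "(\<Prod>e\<in>F. y e) - (\<Prod>e\<in>F. p e) \<le> (\<Prod>e\<in>F. y e) * (k * sigma F)"
proof -
  have sub: "F \<subseteq> complete_edges V" and card: "card F = k"
    using assms by (auto simp: cycles_def card_is_cycle)
  have fin: "finite F" by (rule finite_subset[OF sub finite_complete_edges])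
  show "(\<Prod>e\<in>F. p e) \<le> (\<Prod>e\<in>F. y e)"
    using sub p_nonneg p_le_y by (intro prod_mono) blast
  have p: "p e = y e * (1 - p e)" if "e \<in> F" for e
  proof -
    have "0 \<le> y e" using that sub y_nonneg by blast
    then have "1 + y e \<noteq> 0" by linarith
    then show ?thesis unfolding p_def by (simp add: field_simps)
  qed
  have "(\<Prod>e\<in>F. p e) = (\<Prod>e\<in>F. y e * (1 - p e))" by (intro prod.cong refl p)
  also have "\<dots> = (\<Prod>e\<in>F. y e) * (\<Prod>e\<in>F. 1 - p e)" by (rule prod.distrib)
  finally have eq: "(\<Prod>e\<in>F. p e) = \<dots>" .
  have "1 - (\<Sum>e\<in>F. p e) \<le> (\<Prod>e\<in>F. 1 - p e)"
    using sub p_nonneg p_le_1 by (intro prod_one_minus_ge fin) blast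
  moreover have "(\<Sum>e\<in>F. p e) \<le> (\<Sum>e\<in>F. sigma F)"
    using sub p_le_y y_le_sigma[OF sub] by (intro sum_mono) (meson order_trans subsetD)
  ultimately have "1 - (\<Prod>e\<in>F. 1 - p e) \<le> k * sigma F"
    by (simp add: card)
  then have "(\<Prod>e\<in>F. y e) * (1 - (\<Prod>e\<in>F. 1 - p e)) \<le> (\<Prod>e\<in>F. y e) * (k * sigma F)"
    using sub y_nonneg by (intro mult_left_mono prod_nonneg) auto
  then show "(\<Prod>e\<in>F. y e) - (\<Prod>e\<in>F. p e) \<le> (\<Prod>e\<in>F. y e) * (k * sigma F)"
    unfolding eq by (simp add: algebra_simps)
qed

text \<open>Ignoring repeated vertices and the difference between \<open>p\<close> and \<open>y\<close>, the sum over the traversals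
  factorises into \<open>q ^ k\<close>; both corrections are sums over sequences with a marked vertex.\<close>

lemma expected_cycles:
  assumes "3 \<le> k"
  shows "\<bar>q ^ k / (2 * real k) - (\<Sum>F\<in>cycles k. \<Prod>e\<in>F. p e)\<bar> \<le> k * K ^ k * s4"
proof -
  let ?Y = "\<Sum>F\<in>cycles k. \<Prod>e\<in>F. y e"
  let ?N = "\<Sum>vs\<in>vertex_seqs V k. of_bool (\<not> distinct vs) * sq_prod vs"
  have "2 * real k * ?Y = (\<Sum>vs\<in>vertex_seqs V k. of_bool (distinct vs) * sq_prod vs)"
    unfolding sum_cycles[OF assms] using assms
    by (intro sum.cong) (auto simp: prod_y_cycle_edges vertex_seqs_def)
  also have "\<dots> + ?N = q ^ k"
    unfolding sum.distrib[symmetric] sum_sq_prod[symmetric]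
    by (intro sum.cong) auto
  finally have "2 * real k * ?Y = q ^ k - ?N" by simp
  then have Y: "?Y = q ^ k / (2 * real k) - ?N / (2 * real k)"
    using assms by (simp add: field_simps)
  have N0: "0 \<le> ?N" by (intro sum_nonneg mult_nonneg_nonneg sq_prod_nonneg) auto
  have "?N / (2 * real k) \<le> (real k)\<^sup>2 * K ^ k * s4 / (2 * real k)"
    by (intro divide_right_mono sum_sq_prod_not_distinct_le) auto
  also have "\<dots> = k * K ^ k * s4 / 2"
    using assms by (simp add: power2_eq_square)
  finally have 1: "?N / (2 * real k) \<le> k * K ^ k * s4 / 2" .
  have "?Y - (\<Sum>F\<in>cycles k. \<Prod>e\<in>F. p e) = (\<Sum>F\<in>cycles k. (\<Prod>e\<in>F. y e) - (\<Prod>e\<in>F. p e))"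
    by (simp add: sum_subtractf)
  also have "\<dots> \<le> (\<Sum>F\<in>cycles k. (\<Prod>e\<in>F. y e) * (k * sigma F))"
    by (intro sum_mono prod_y_diff_prod_p)
  also have "\<dots> = k * (\<Sum>F\<in>cycles k. (\<Prod>e\<in>F. y e) * sigma F)"
    by (simp add: sum_distrib_left mult_ac)
  finally have 2: "?Y - (\<Sum>F\<in>cycles k. \<Prod>e\<in>F. p e) \<le> k * K ^ k * s4 / 2"
    using sum_cycles_prod_sigma_le[OF assms] by simp
  have "(\<Sum>F\<in>cycles k. \<Prod>e\<in>F. p e) \<le> ?Y"
    by (intro sum_mono prod_y_diff_prod_p)
  moreover have "0 \<le> ?N / (2 * real k)" using N0 by simp
  ultimately show ?thesis using 1 2 Y by linarith
qed

end


section \<open>Cycles sharing an edge with a given cycle\<close>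

context vertex_weights
begin

text \<open>A cycle through edges of \<open>\<alpha>\<close> is explored as a walk whose steps along \<open>\<alpha>\<close> have weight 1.\<close>

definition step_weight :: "'v set set \<Rightarrow> 'v \<Rightarrow> 'v \<Rightarrow> real" where
  "step_weight \<alpha> u v = (if {u, v} \<in> \<alpha> then 1 else x u * x v)"

fun walk_weight :: "'v set set \<Rightarrow> 'v list \<Rightarrow> real" where
  "walk_weight \<alpha> [] = 1"
| "walk_weight \<alpha> [v] = x v"
| "walk_weight \<alpha> (u # v # vs) = step_weight \<alpha> u v * walk_weight \<alpha> (v # vs)"

lemma walk_weight_Cons:
  "walk_weight \<alpha> (u # vs) =
    (\<Prod>i<length vs. step_weight \<alpha> ((u # vs) ! i) ((u # vs) ! Suc i)) * x (last (u # vs))"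
proof (induction vs arbitrary: u)
  case (Cons v vs)
  show ?case by (simp add: Cons prod.lessThan_Suc_shift del: prod.lessThan_Suc)
qed simp

lemma step_weight_nonneg: "u \<in> V \<Longrightarrow> v \<in> V \<Longrightarrow> 0 \<le> step_weight \<alpha> u v"
  by (simp add: step_weight_def x_nonneg)

lemma walk_weight_nonneg: "set vs \<subseteq> V \<Longrightarrow> 0 \<le> walk_weight \<alpha> vs"
  by (induction \<alpha> vs rule: walk_weight.induct) (auto simp: x_nonneg step_weight_nonneg)

text \<open>The edges of \<open>\<alpha>\<close> are already present and cost nothing. As the closing edge lies outside \<open>\<alpha>\<close>,
  it splits into two factors, one at either end of the walk.\<close>

lemma prod_outside_le_walk_weight:
  assumes vs: "vs \<in> traversals k \<beta>" and sub: "\<beta> \<subseteq> complete_edges V" and k: "3 \<le> k"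
    and closing: "{last vs, hd vs} \<notin> \<alpha>"
  shows "(\<Prod>e\<in>\<beta> - \<alpha>. p e) \<le> x (hd vs) * walk_weight \<alpha> vs"
proof -
  have v: "distinct vs" "length vs = k" "\<beta> = cycle_edges vs"
    using vs by (auto simp: traversals_def)
  then obtain u ws where uw: "vs = u # ws" using k by (cases vs) auto
  define m where "m = length ws"
  have m: "k = Suc m" using v(2) uw m_def by simp
  have fin: "finite \<beta>" using v(3) finite_cycle_edges by auto
  have "(\<Prod>e\<in>\<beta> - \<alpha>. p e) \<le> (\<Prod>e\<in>\<beta> - \<alpha>. y e)"
    using sub p_nonneg p_le_y by (intro prod_mono) blast
  also have "\<dots> = (\<Prod>e\<in>\<beta>. if e \<in> \<alpha> then 1 else y e)"
    using fin by (intro prod.mono_neutral_cong_left) auto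
  also have "\<dots> = (\<Prod>i<k. if {vs ! i, vs ! (Suc i mod k)} \<in> \<alpha> then 1 else y {vs ! i, vs ! (Suc i mod k)})"
    unfolding v(3) using prod_cycle_edges[OF v(1)] k v(2) by simp
  also have "\<dots> = (\<Prod>i<k. step_weight \<alpha> (vs ! i) (vs ! (Suc i mod k)))"
  proof (intro prod.cong refl)
    fix i assume "i \<in> {..<k}"
    then have "vs ! i \<noteq> vs ! (Suc i mod k)"
      using v k by (subst nth_eq_iff_index_eq) (auto simp: Suc_mod_less)
    then show "(if {vs ! i, vs ! (Suc i mod k)} \<in> \<alpha> then 1 else y {vs ! i, vs ! (Suc i mod k)}) =
        step_weight \<alpha> (vs ! i) (vs ! (Suc i mod k))"
      by (simp add: step_weight_def y_def)
  qed
  also have "\<dots> = (\<Prod>i<m. step_weight \<alpha> (vs ! i) (vs ! Suc i)) * step_weight \<alpha> (vs ! m) (vs ! 0)"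
    by (simp add: m)
  also have "vs ! m = last vs"
    using v(2) m by (cases "vs = []") (simp_all add: last_conv_nth)
  also have "vs ! 0 = hd vs" by (simp add: uw)
  also have "step_weight \<alpha> (last vs) (hd vs) = x (last vs) * x (hd vs)"
    using closing by (simp add: step_weight_def)
  finally show ?thesis
    by (simp add: uw walk_weight_Cons m_def mult_ac)
qed

definition vertex_sum :: "'v set set \<Rightarrow> real" where
  "vertex_sum \<alpha> = (\<Sum>v\<in>\<Union>\<alpha>. x v)"

text \<open>A vector that one step of the walk enlarges by at most a constant factor: the steps
  outside \<open>\<alpha>\<close> lead to a multiple of \<open>x\<close>, the steps along \<open>\<alpha>\<close> stay among the few vertices
  of \<open>\<alpha>\<close>.\<close>

definition walk_bound :: "'v set set \<Rightarrow> 'v \<Rightarrow> real" where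
  "walk_bound \<alpha> u = x u + of_bool (u \<in> \<Union>\<alpha>) * vertex_sum \<alpha>"

end

locale vertex_weights_cycle = vertex_weights V x K
  for V :: "'v set" and x :: "'v \<Rightarrow> real" and K :: real +
  fixes \<alpha> :: "'v set set" and N :: nat
  assumes \<alpha>_sub: "\<alpha> \<subseteq> complete_edges V" and card_\<alpha>: "card (\<Union>\<alpha>) \<le> N"
begin

lemma Union_\<alpha>_sub: "\<Union>\<alpha> \<subseteq> V"
  using \<alpha>_sub by (auto simp: complete_edges_def)

lemma finite_Union_\<alpha>: "finite (\<Union>\<alpha>)"
  by (rule finite_subset[OF Union_\<alpha>_sub finite_V])

lemma vertex_sum_nonneg: "0 \<le> vertex_sum \<alpha>"
  unfolding vertex_sum_def using Union_\<alpha>_sub x_nonneg by (intro sum_nonneg) auto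

lemma walk_bound_nonneg: "u \<in> V \<Longrightarrow> 0 \<le> walk_bound \<alpha> u"
  by (simp add: walk_bound_def x_nonneg vertex_sum_nonneg)

lemma vertex_sum_sq_le: "(vertex_sum \<alpha>)\<^sup>2 \<le> N * sigma \<alpha>"
proof -
  have "(vertex_sum \<alpha>)\<^sup>2 \<le> card (\<Union>\<alpha>) * sigma \<alpha>"
    using Cauchy_Schwarz_ineq_sum[of "\<lambda>_. 1" x "\<Union>\<alpha>"]
    by (simp add: vertex_sum_def sigma_def)
  also have "\<dots> \<le> N * sigma \<alpha>"
    using card_\<alpha> by (intro mult_right_mono sigma_nonneg) simp
  finally show ?thesis .
qed

lemma sigma_le_K: "sigma \<alpha> \<le> K"
proof -
  have "sigma \<alpha> \<le> q"
    unfolding sigma_def by (rule sum_mono2[OF finite_V Union_\<alpha>_sub]) simp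
  then show ?thesis using sum_sq_le by linarith
qed

definition growth :: real where "growth = (1 + real N) * (1 + K)"

lemma growth_ge_1: "1 \<le> growth"
proof -
  have "1 * 1 \<le> (1 + real N) * (1 + K)"
    using K_nonneg by (intro mult_mono) auto
  then show ?thesis by (simp add: growth_def)
qed

lemma one_step_le:
  assumes u: "u \<in> V"
  shows "(\<Sum>v\<in>V. step_weight \<alpha> u v * walk_bound \<alpha> v) \<le> growth * walk_bound \<alpha> u"
proof -
  let ?S = "vertex_sum \<alpha>"
  have split: "step_weight \<alpha> u v * walk_bound \<alpha> v \<le>
      x u * (x v * walk_bound \<alpha> v) + of_bool ({u, v} \<in> \<alpha>) * walk_bound \<alpha> v" if "v \<in> V" for v
    using that u by (auto simp: step_weight_def x_nonneg walk_bound_nonneg)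
  have "(\<Sum>v\<in>V. x v * walk_bound \<alpha> v) = q + (\<Sum>v\<in>V. of_bool (v \<in> \<Union>\<alpha>) * x v * ?S)"
    by (simp add: walk_bound_def distrib_left sum.distrib power2_eq_square mult_ac)
  also have "(\<Sum>v\<in>V. of_bool (v \<in> \<Union>\<alpha>) * x v * ?S) = (\<Sum>v\<in>\<Union>\<alpha>. x v * ?S)"
    by (rule sum.mono_neutral_cong_right[OF finite_V Union_\<alpha>_sub]) auto
  also have "\<dots> = ?S\<^sup>2" by (simp add: vertex_sum_def sum_distrib_right[symmetric] power2_eq_square)
  finally have "(\<Sum>v\<in>V. x v * walk_bound \<alpha> v) \<le> K + N * K"
    using sum_sq_le vertex_sum_sq_le mult_left_mono[OF sigma_le_K, of "real N"] by simp
  also have "\<dots> \<le> growth" using K_nonneg by (simp add: growth_def algebra_simps)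
  finally have 1: "(\<Sum>v\<in>V. x v * walk_bound \<alpha> v) \<le> growth" .
  have 2: "(\<Sum>v\<in>V. of_bool ({u, v} \<in> \<alpha>) * walk_bound \<alpha> v) \<le> of_bool (u \<in> \<Union>\<alpha>) * (growth * ?S)"
  proof (cases "u \<in> \<Union>\<alpha>")
    case True
    have "(\<Sum>v\<in>V. of_bool ({u, v} \<in> \<alpha>) * walk_bound \<alpha> v) \<le> (\<Sum>v\<in>V. of_bool (v \<in> \<Union>\<alpha>) * walk_bound \<alpha> v)"
      by (intro sum_mono mult_right_mono walk_bound_nonneg) auto
    also have "\<dots> = (\<Sum>v\<in>\<Union>\<alpha>. x v + ?S)"
      by (rule sum.mono_neutral_cong_right[OF finite_V Union_\<alpha>_sub]) (auto simp: walk_bound_def)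
    also have "\<dots> = (1 + real (card (\<Union>\<alpha>))) * ?S"
      by (simp add: sum.distrib vertex_sum_def algebra_simps)
    also have "\<dots> \<le> growth * ?S"
    proof (intro mult_right_mono vertex_sum_nonneg)
      have "1 + real (card (\<Union>\<alpha>)) \<le> (1 + real N) * 1" using card_\<alpha> by simp
      also have "\<dots> \<le> growth" unfolding growth_def using K_nonneg by (intro mult_left_mono) auto
      finally show "1 + real (card (\<Union>\<alpha>)) \<le> growth" .
    qed
    finally show ?thesis using True by simp
  next
    case False
    then have "(\<Sum>v\<in>V. of_bool ({u, v} \<in> \<alpha>) * walk_bound \<alpha> v) = 0"
      by (intro sum.neutral) auto
    then show ?thesis using False by simp
  qed
  have "(\<Sum>v\<in>V. step_weight \<alpha> u v * walk_bound \<alpha> v) \<le>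
      (\<Sum>v\<in>V. x u * (x v * walk_bound \<alpha> v) + of_bool ({u, v} \<in> \<alpha>) * walk_bound \<alpha> v)"
    by (intro sum_mono split)
  also have "\<dots> = x u * (\<Sum>v\<in>V. x v * walk_bound \<alpha> v) + (\<Sum>v\<in>V. of_bool ({u, v} \<in> \<alpha>) * walk_bound \<alpha> v)"
    by (simp add: sum.distrib sum_distrib_left)
  also have "\<dots> \<le> x u * growth + of_bool (u \<in> \<Union>\<alpha>) * (growth * ?S)"
    by (intro add_mono mult_left_mono 1 2 x_nonneg u)
  also have "\<dots> = growth * walk_bound \<alpha> u" by (simp add: walk_bound_def algebra_simps)
  finally show ?thesis .
qed

lemma sum_walk_weight_le:
  assumes "u \<in> V"
  shows "(\<Sum>vs\<in>vertex_seqs V m. walk_weight \<alpha> (u # vs)) \<le> growth ^ m * walk_bound \<alpha> u"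
  using assms
proof (induction m arbitrary: u)
  case 0
  then show ?case by (simp add: vertex_seqs_0 walk_bound_def vertex_sum_nonneg)
next
  case (Suc m)
  have "(\<Sum>vs\<in>vertex_seqs V (Suc m). walk_weight \<alpha> (u # vs)) =
      (\<Sum>v\<in>V. step_weight \<alpha> u v * (\<Sum>vs\<in>vertex_seqs V m. walk_weight \<alpha> (v # vs)))"
    by (simp add: sum_vertex_seqs_Suc sum_distrib_left)
  also have "\<dots> \<le> (\<Sum>v\<in>V. step_weight \<alpha> u v * (growth ^ m * walk_bound \<alpha> v))"
    by (intro sum_mono mult_left_mono Suc.IH step_weight_nonneg Suc.prems)
  also have "\<dots> = growth ^ m * (\<Sum>v\<in>V. step_weight \<alpha> u v * walk_bound \<alpha> v)"
    by (simp add: sum_distrib_left mult_ac)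
  also have "\<dots> \<le> growth ^ m * (growth * walk_bound \<alpha> u)"
    using growth_ge_1 by (intro mult_left_mono one_step_le Suc.prems) auto
  finally show ?case by (simp add: mult_ac)
qed

text \<open>Given that all edges of \<open>\<alpha>\<close> are present, the expected number of further cycles through an
  edge of \<open>\<alpha>\<close> is at most of the order of the sum of the squared weights along \<open>\<alpha>\<close>.\<close>

lemma sum_neighbours_le:
  assumes cyc: "is_cycle k0 \<alpha>" and k: "3 \<le> k" "k \<le> N"
  shows "(\<Sum>\<beta> | \<beta> \<in> cycles k \<and> \<beta> \<noteq> \<alpha> \<and> \<beta> \<inter> \<alpha> \<noteq> {}. \<Prod>e\<in>\<beta> - \<alpha>. p e)
    \<le> growth ^ N * (1 + N) * sigma \<alpha>"
proof -
  let ?B = "{\<beta>. \<beta> \<in> cycles k \<and> \<beta> \<noteq> \<alpha> \<and> \<beta> \<inter> \<alpha> \<noteq> {}}"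
  let ?T = "{vs \<in> vertex_seqs V k. hd vs \<in> \<Union>\<alpha>}"
  have "\<forall>\<beta>\<in>?B. \<exists>vs. vs \<in> traversals k \<beta> \<and> hd vs \<in> \<Union>\<alpha> \<and> {last vs, hd vs} \<notin> \<alpha>"
  proof
    fix \<beta> assume that: "\<beta> \<in> ?B"
    have \<beta>: "is_cycle k \<beta>" "\<beta> \<inter> \<alpha> \<noteq> {}" using that by (auto simp: cycles_def)
    moreover have "\<not> \<beta> \<subseteq> \<alpha>" using subcycle_eq[OF cyc \<beta>(1)] that by auto
    ultimately obtain vs where "vs \<in> traversals k \<beta>" "hd vs \<in> \<Union>\<alpha>" "{last vs, hd vs} \<notin> \<alpha>"
      by (rule traversal_entering)
    then show "\<exists>vs. vs \<in> traversals k \<beta> \<and> hd vs \<in> \<Union>\<alpha> \<and> {last vs, hd vs} \<notin> \<alpha>" by blast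
  qed
  then obtain tr where
    "\<forall>\<beta>\<in>?B. tr \<beta> \<in> traversals k \<beta> \<and> hd (tr \<beta>) \<in> \<Union>\<alpha> \<and> {last (tr \<beta>), hd (tr \<beta>)} \<notin> \<alpha>"
    by (rule bchoice[THEN exE])
  then have tr: "tr \<beta> \<in> traversals k \<beta>" "hd (tr \<beta>) \<in> \<Union>\<alpha>" "{last (tr \<beta>), hd (tr \<beta>)} \<notin> \<alpha>"
    if "\<beta> \<in> ?B" for \<beta> using that by blast+
  have inj: "inj_on tr ?B"
  proof (rule inj_onI)
    fix \<beta> \<beta>' assume "\<beta> \<in> ?B" "\<beta>' \<in> ?B" "tr \<beta> = tr \<beta>'"
    then show "\<beta> = \<beta>'" using tr(1)[of \<beta>] tr(1)[of \<beta>'] by (simp add: traversals_def)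
  qed
  have tr_T: "tr ` ?B \<subseteq> ?T"
    using tr(1,2) traversals_vertex_seqs by fastforce
  have "(\<Sum>\<beta>\<in>?B. \<Prod>e\<in>\<beta> - \<alpha>. p e) \<le> (\<Sum>\<beta>\<in>?B. x (hd (tr \<beta>)) * walk_weight \<alpha> (tr \<beta>))"
    using tr k by (intro sum_mono prod_outside_le_walk_weight) (auto simp: cycles_def)
  also have "\<dots> = (\<Sum>vs\<in>tr ` ?B. x (hd vs) * walk_weight \<alpha> vs)"
    by (simp add: sum.reindex[OF inj])
  also have "\<dots> \<le> (\<Sum>vs\<in>?T. x (hd vs) * walk_weight \<alpha> vs)"
  proof (rule sum_mono2[OF _ tr_T])
    show "finite ?T" using finite_vertex_seqs[OF finite_V] by simp
    show "0 \<le> x (hd vs) * walk_weight \<alpha> vs" if "vs \<in> ?T - tr ` ?B" for vs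
      using that Union_\<alpha>_sub
      by (intro mult_nonneg_nonneg x_nonneg walk_weight_nonneg) (auto simp: vertex_seqs_def)
  qed
  also have "\<dots> = (\<Sum>vs\<in>vertex_seqs V k. of_bool (hd vs \<in> \<Union>\<alpha>) * (x (hd vs) * walk_weight \<alpha> vs))"
    using finite_vertex_seqs[OF finite_V] by (intro sum.mono_neutral_cong_left) auto
  also have "vertex_seqs V k = vertex_seqs V (Suc (k - 1))" using k by simp
  also have "(\<Sum>vs\<in>vertex_seqs V (Suc (k - 1)). of_bool (hd vs \<in> \<Union>\<alpha>) * (x (hd vs) * walk_weight \<alpha> vs)) =
      (\<Sum>u\<in>V. of_bool (u \<in> \<Union>\<alpha>) * (x u * (\<Sum>vs\<in>vertex_seqs V (k - 1). walk_weight \<alpha> (u # vs))))"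
    by (simp add: sum_vertex_seqs_Suc sum_distrib_left)
  also have "\<dots> = (\<Sum>u\<in>\<Union>\<alpha>. x u * (\<Sum>vs\<in>vertex_seqs V (k - 1). walk_weight \<alpha> (u # vs)))"
    by (rule sum.mono_neutral_cong_right[OF finite_V Union_\<alpha>_sub]) auto
  also have "\<dots> \<le> (\<Sum>u\<in>\<Union>\<alpha>. x u * (growth ^ (k - 1) * walk_bound \<alpha> u))"
    using Union_\<alpha>_sub by (intro sum_mono mult_left_mono sum_walk_weight_le x_nonneg) auto
  also have "\<dots> = growth ^ (k - 1) * (\<Sum>u\<in>\<Union>\<alpha>. (x u)\<^sup>2 + x u * vertex_sum \<alpha>)"
    by (simp add: sum_distrib_left walk_bound_def power2_eq_square algebra_simps)
  also have "\<dots> = growth ^ (k - 1) * (sigma \<alpha> + (vertex_sum \<alpha>)\<^sup>2)"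
    by (simp add: sum.distrib sigma_def vertex_sum_def sum_distrib_right[symmetric] power2_eq_square)
  also have "\<dots> \<le> growth ^ N * (sigma \<alpha> + N * sigma \<alpha>)"
    using k growth_ge_1 vertex_sum_sq_le sigma_nonneg[of \<alpha>]
    by (intro mult_mono add_left_mono power_increasing) auto
  finally show ?thesis by (simp add: algebra_simps)
qed

lemma prod_p_le_sigma:
  assumes "\<alpha> \<in> cycles k" "k \<le> N"
  shows "(\<Prod>e\<in>\<alpha>. p e) \<le> K ^ N * sigma \<alpha>"
proof -
  obtain vs where vs: "distinct vs" "length vs = k" "set vs \<subseteq> V" "\<alpha> = cycle_edges vs" "3 \<le> k"
    using assms(1) by (rule cycles_cases)
  then obtain u ws where uw: "vs = u # ws" by (cases vs) auto
  have "(\<Prod>e\<in>\<alpha>. p e) \<le> sq_prod vs"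
    using prod_y_diff_prod_p(1)[OF assms(1)] vs by (simp add: prod_y_cycle_edges)
  also have "\<dots> = (x u)\<^sup>2 * sq_prod ws" by (simp add: uw)
  also have "\<dots> \<le> sigma \<alpha> * K ^ N"
  proof (intro mult_mono sq_prod_nonneg sigma_nonneg)
    show "(x u)\<^sup>2 \<le> sigma \<alpha>"
      using vs(1,4) by (simp add: uw sigma_cycle_edges sq_sum_nonneg)
    have ws: "set ws \<subseteq> V" using vs(3) uw by simp
    have "sq_prod ws \<le> K ^ length ws"
      using ws
    proof (induction ws)
      case (Cons a ws)
      then have "(x a)\<^sup>2 \<le> K" using x_sq_le_q[of a] sum_sq_le by simp
      then show ?case using Cons K_nonneg by (auto intro!: mult_mono sq_prod_nonneg)
    qed simp
    also have "\<dots> \<le> K ^ N" using vs(2) uw assms(2) by (intro K_power_mono) simp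
    finally show "sq_prod ws \<le> K ^ N" .
  qed
  finally show ?thesis by (simp add: mult.commute)
qed

end


section \<open>Poisson approximation for fixed weights\<close>

definition cycle_mean :: "nat set \<Rightarrow> real \<Rightarrow> real" where
  "cycle_mean A r = (\<Sum>k\<in>A. r ^ k / (2 * real k))"

text \<open>Explicit, because it has to depend on nothing but \<open>N\<close> and the bound \<open>K\<close> on the sum of the
  squared weights.\<close>

definition fixed_weights_const :: "nat \<Rightarrow> real \<Rightarrow> real" where
  "fixed_weights_const N K = 4 * exp (N * K ^ N) * (real N * (N * K ^ N) +
     N * K ^ N * (K ^ N + N * (((1 + real N) * (1 + K)) ^ N * (1 + N))))"

lemma card_le_of_subset_atLeastAtMost:
  assumes "A \<subseteq> {3..N :: nat}"
  shows "card A \<le> N"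
proof -
  have "card A \<le> card {3..N}" using assms by (intro card_mono) auto
  then show ?thesis by simp
qed

lemma sum_subset_const_le:
  assumes "A \<subseteq> {3..N :: nat}" "\<And>k. 3 \<le> k \<Longrightarrow> k \<le> N \<Longrightarrow> g k \<le> (c :: real)" "0 \<le> c"
  shows "(\<Sum>k\<in>A. g k) \<le> N * c"
proof -
  have "(\<Sum>k\<in>A. g k) \<le> card A * c" using assms(1,2) by (intro sum_bounded_above) auto
  also have "\<dots> \<le> N * c"
    using card_le_of_subset_atLeastAtMost[OF assms(1)] assms(3) by (intro mult_right_mono) auto
  finally show ?thesis .
qed

lemma cycle_mean_bounds:
  assumes A: "A \<subseteq> {3..N}" and K: "1 \<le> K" and r: "0 \<le> r" "r \<le> K"
  shows "0 \<le> cycle_mean A r" "cycle_mean A r \<le> N * K ^ N"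
    and "\<bar>\<Sum>k\<in>A. r ^ (k - 1) / 2\<bar> \<le> N * K ^ N"
proof -
  have pw: "r ^ j \<le> K ^ N" if "j \<le> N" for j
    using power_mono[OF r(2,1), of j] power_increasing[OF that K] by linarith
  show "0 \<le> cycle_mean A r"
    unfolding cycle_mean_def using r by (intro sum_nonneg) simp
  show "cycle_mean A r \<le> N * K ^ N"
    unfolding cycle_mean_def
  proof (rule sum_subset_const_le[OF A])
    fix k assume k: "3 \<le> k" "k \<le> N"
    have "r ^ k / (2 * real k) \<le> r ^ k / 1" using k r by (intro divide_left_mono) auto
    then show "r ^ k / (2 * real k) \<le> K ^ N" using pw[OF k(2)] by simp
  qed (use K in simp)
  have "\<bar>\<Sum>k\<in>A. r ^ (k - 1) / 2\<bar> = (\<Sum>k\<in>A. r ^ (k - 1) / 2)"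
    using r by (intro abs_of_nonneg sum_nonneg) simp
  also have "\<dots> \<le> N * K ^ N"
  proof (rule sum_subset_const_le[OF A])
    fix k assume k: "3 \<le> k" "k \<le> N"
    have "0 \<le> r ^ (k - 1)" using r by simp
    then show "r ^ (k - 1) / 2 \<le> K ^ N" using pw[of "k - 1"] k by linarith
  qed (use K in simp)
  finally show "\<bar>\<Sum>k\<in>A. r ^ (k - 1) / 2\<bar> \<le> N * K ^ N" .
qed

context vertex_weights
begin

text \<open>Both contributions to the Chen--Stein bound, the error in the mean and the expected number of
  pairs of cycles with a common edge, are multiples of the sum of the fourth powers.\<close>

theorem poisson_approximation_cycle_count:
  assumes A: "A \<subseteq> {3..N}" and h: "\<And>j. \<bar>h j\<bar> \<le> 1"
  shows "\<bar>measure_pmf.expectation (random_subset (complete_edges V) p) (\<lambda>G. h (cycle_count A G))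
      - poisson_mean (cycle_mean A q) h\<bar> \<le> fixed_weights_const N K * s4"
proof -
  let ?E = "measure_pmf.expectation (random_subset (complete_edges V) p)"
  define \<A> where "\<A> = (\<Union>k\<in>A. cycles k)"
  define c where "c = K ^ N + N * (((1 + real N) * (1 + K)) ^ N * (1 + N))"
  have finA: "finite A" using A finite_subset by blast
  have disj: "cycles j \<inter> cycles k = {}" if "j \<noteq> k" for j k
    using that by (auto simp: cycles_def dest!: card_is_cycle)
  have sum_\<A>: "(\<Sum>F\<in>\<A>. g F) = (\<Sum>k\<in>A. \<Sum>F\<in>cycles k. g F)" for g :: "'v set set \<Rightarrow> real"
    unfolding \<A>_def using finA finite_cycles disj by (intro sum.UNION_disjoint) auto
  have \<A>_sub: "\<A> \<subseteq> Pow (complete_edges V)" by (auto simp: \<A>_def cycles_def)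
  have c0: "0 \<le> c" unfolding c_def using K_nonneg by (intro add_nonneg_nonneg mult_nonneg_nonneg) auto
  have neighbours: "(\<Prod>e\<in>\<alpha>. p e) +
      (\<Sum>\<beta> | \<beta> \<in> \<A> \<and> \<beta> \<noteq> \<alpha> \<and> \<beta> \<inter> \<alpha> \<noteq> {}. \<Prod>e\<in>\<beta> - \<alpha>. p e) \<le> c * sigma \<alpha>" if "\<alpha> \<in> \<A>" for \<alpha>
  proof -
    obtain k0 where k0: "k0 \<in> A" "\<alpha> \<in> cycles k0" using \<open>\<alpha> \<in> \<A>\<close> by (auto simp: \<A>_def)
    then obtain vs where vs: "distinct vs" "length vs = k0" "\<alpha> = cycle_edges vs"
      by (auto elim: cycles_cases)
    interpret vertex_weights_cycle V x K \<alpha> N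
      by unfold_locales
        (use k0 A vs in \<open>auto simp: cycles_def Union_cycle_edges distinct_card\<close>)
    have "(\<Sum>\<beta> | \<beta> \<in> \<A> \<and> \<beta> \<noteq> \<alpha> \<and> \<beta> \<inter> \<alpha> \<noteq> {}. \<Prod>e\<in>\<beta> - \<alpha>. p e) =
        (\<Sum>k\<in>A. \<Sum>\<beta> | \<beta> \<in> cycles k \<and> \<beta> \<noteq> \<alpha> \<and> \<beta> \<inter> \<alpha> \<noteq> {}. \<Prod>e\<in>\<beta> - \<alpha>. p e)"
    proof -
      have "{\<beta>. \<beta> \<in> \<A> \<and> \<beta> \<noteq> \<alpha> \<and> \<beta> \<inter> \<alpha> \<noteq> {}} =
          (\<Union>k\<in>A. {\<beta>. \<beta> \<in> cycles k \<and> \<beta> \<noteq> \<alpha> \<and> \<beta> \<inter> \<alpha> \<noteq> {}})"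
        by (auto simp: \<A>_def)
      moreover have "(\<Sum>\<beta>\<in>(\<Union>k\<in>A. {\<beta>. \<beta> \<in> cycles k \<and> \<beta> \<noteq> \<alpha> \<and> \<beta> \<inter> \<alpha> \<noteq> {}}). \<Prod>e\<in>\<beta> - \<alpha>. p e) =
          (\<Sum>k\<in>A. \<Sum>\<beta> | \<beta> \<in> cycles k \<and> \<beta> \<noteq> \<alpha> \<and> \<beta> \<inter> \<alpha> \<noteq> {}. \<Prod>e\<in>\<beta> - \<alpha>. p e)"
        using finA finite_cycles disj by (intro sum.UNION_disjoint) auto
      ultimately show ?thesis by simp
    qed
    also have "\<dots> \<le> N * (growth ^ N * (1 + N) * sigma \<alpha>)"
    proof (rule sum_subset_const_le[OF A])
      fix k assume "3 \<le> k" "k \<le> N"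
      then show "(\<Sum>\<beta> | \<beta> \<in> cycles k \<and> \<beta> \<noteq> \<alpha> \<and> \<beta> \<inter> \<alpha> \<noteq> {}. \<Prod>e\<in>\<beta> - \<alpha>. p e)
          \<le> growth ^ N * (1 + N) * sigma \<alpha>"
        using k0(2) by (intro sum_neighbours_le[of k0]) (auto simp: cycles_def)
    qed (use growth_ge_1 sigma_nonneg in simp)
    also have "(\<Prod>e\<in>\<alpha>. p e) + \<dots> \<le> K ^ N * sigma \<alpha> + \<dots>"
      using k0 A by (intro add_right_mono prod_p_le_sigma[of k0]) auto
    finally show ?thesis by (simp add: c_def growth_def algebra_simps)
  qed
  let ?t = "cycle_mean A q"
  note t0 = cycle_mean_bounds(1)[OF A K_ge_1 q_nonneg sum_sq_le]
  have count: "cycle_count A G = card {F\<in>\<A>. F \<subseteq> G}" if "G \<subseteq> complete_edges V" for G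
    unfolding cycle_count_def using that
    by (intro arg_cong[where f = card]) (auto simp: \<A>_def cycles_def)
  have "?E (\<lambda>G. h (cycle_count A G)) = ?E (\<lambda>G. h (card {F\<in>\<A>. F \<subseteq> G}))"
    using set_pmf_random_subset[of "complete_edges V" p]
    by (intro integral_cong_AE) (auto simp: AE_measure_pmf_iff count subset_iff)
  also have "\<bar>\<dots> - poisson_mean ?t h\<bar> \<le> 4 * exp ?t *
      (\<bar>?t - (\<Sum>F\<in>\<A>. \<Prod>e\<in>F. p e)\<bar> + (\<Sum>F\<in>\<A>. (\<Prod>e\<in>F. p e) * (c * sigma F)))"
    using p_nonneg p_le_1
    by (intro chen_stein_random_subset finite_complete_edges \<A>_sub h t0 neighbours) auto
  also have "\<dots> \<le> 4 * exp (N * K ^ N) * (real N * (N * K ^ N * s4) + N * (c * (K ^ N * s4)))"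
  proof (intro mult_mono add_mono)
    show "exp ?t \<le> exp (N * K ^ N)" using cycle_mean_bounds(2)[OF A K_ge_1 q_nonneg sum_sq_le] by simp
    have "\<bar>?t - (\<Sum>F\<in>\<A>. \<Prod>e\<in>F. p e)\<bar> = \<bar>\<Sum>k\<in>A. q ^ k / (2 * real k) - (\<Sum>F\<in>cycles k. \<Prod>e\<in>F. p e)\<bar>"
      unfolding sum_\<A> cycle_mean_def by (simp add: sum_subtractf)
    also have "\<dots> \<le> (\<Sum>k\<in>A. \<bar>q ^ k / (2 * real k) - (\<Sum>F\<in>cycles k. \<Prod>e\<in>F. p e)\<bar>)"
      by (rule sum_abs)
    also have "\<dots> \<le> real N * (N * K ^ N * s4)"
    proof (rule sum_subset_const_le[OF A])
      fix k assume k: "3 \<le> k" "k \<le> N"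
      have "\<bar>q ^ k / (2 * real k) - (\<Sum>F\<in>cycles k. \<Prod>e\<in>F. p e)\<bar> \<le> k * K ^ k * s4"
        by (rule expected_cycles[OF k(1)])
      also have "\<dots> \<le> N * K ^ N * s4"
        using k K_nonneg by (intro mult_right_mono mult_mono K_power_mono s4_nonneg) auto
      finally show "\<bar>q ^ k / (2 * real k) - (\<Sum>F\<in>cycles k. \<Prod>e\<in>F. p e)\<bar> \<le> N * K ^ N * s4" .
    qed (simp add: K_nonneg s4_nonneg)
    finally show "\<bar>?t - (\<Sum>F\<in>\<A>. \<Prod>e\<in>F. p e)\<bar> \<le> real N * (N * K ^ N * s4)" .
    show "(\<Sum>F\<in>\<A>. (\<Prod>e\<in>F. p e) * (c * sigma F)) \<le> N * (c * (K ^ N * s4))"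
      unfolding sum_\<A>
    proof (rule sum_subset_const_le[OF A])
      fix k assume k: "3 \<le> k" "k \<le> N"
      have "(\<Sum>F\<in>cycles k. (\<Prod>e\<in>F. p e) * (c * sigma F)) \<le> (\<Sum>F\<in>cycles k. (\<Prod>e\<in>F. y e) * (c * sigma F))"
        by (intro sum_mono mult_right_mono prod_y_diff_prod_p mult_nonneg_nonneg c0 sigma_nonneg)
      also have "\<dots> = c * (\<Sum>F\<in>cycles k. (\<Prod>e\<in>F. y e) * sigma F)"
        by (simp add: sum_distrib_left mult_ac)
      also have "\<dots> \<le> c * (K ^ k * s4)"
      proof (rule mult_left_mono[OF _ c0])
        have "real k * (2 * (\<Sum>F\<in>cycles k. (\<Prod>e\<in>F. y e) * sigma F)) \<le> real k * (K ^ k * s4)"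
          using sum_cycles_prod_sigma_le[OF k(1)] by (simp add: mult_ac)
        then have "2 * (\<Sum>F\<in>cycles k. (\<Prod>e\<in>F. y e) * sigma F) \<le> K ^ k * s4"
          using k(1) by simp
        moreover have "0 \<le> (\<Sum>F\<in>cycles k. (\<Prod>e\<in>F. y e) * sigma F)"
          by (intro sum_nonneg mult_nonneg_nonneg prod_nonneg sigma_nonneg y_nonneg)
            (auto simp: cycles_def)
        ultimately show "(\<Sum>F\<in>cycles k. (\<Prod>e\<in>F. y e) * sigma F) \<le> K ^ k * s4" by linarith
      qed
      also have "\<dots> \<le> c * (K ^ N * s4)"
        by (intro mult_left_mono mult_right_mono K_power_mono k s4_nonneg c0)
      finally show "(\<Sum>F\<in>cycles k. (\<Prod>e\<in>F. p e) * (c * sigma F)) \<le> c * (K ^ N * s4)" .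
    qed (simp add: c0 K_nonneg s4_nonneg)
    have "0 \<le> (\<Sum>F\<in>\<A>. (\<Prod>e\<in>F. p e) * (c * sigma F))"
      using \<A>_sub by (intro sum_nonneg mult_nonneg_nonneg prod_nonneg sigma_nonneg c0 p_nonneg) auto
    then show "0 \<le> \<bar>?t - (\<Sum>F\<in>\<A>. \<Prod>e\<in>F. p e)\<bar> + (\<Sum>F\<in>\<A>. (\<Prod>e\<in>F. p e) * (c * sigma F))"
      by linarith
  qed auto
  also have "\<dots> = fixed_weights_const N K * s4"
    by (simp add: fixed_weights_const_def c_def algebra_simps)
  finally show ?thesis .
qed

end


section \<open>Dependence of the Poisson parameter on the weights\<close>

lemma power_lipschitz:
  fixes q r K :: real
  assumes "0 \<le> q" "q \<le> K" "0 \<le> r" "r \<le> K" "1 \<le> K"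
  shows "\<bar>q ^ k - r ^ k\<bar> \<le> k * K ^ k * \<bar>q - r\<bar>"
proof (induction k)
  case (Suc k)
  have low: "r ^ k \<le> K ^ Suc k"
    using assms by (intro order_trans[OF power_mono power_increasing]) auto
  have "q ^ Suc k - r ^ Suc k = q * (q ^ k - r ^ k) + (q - r) * r ^ k"
    by (simp add: algebra_simps)
  also have "\<bar>\<dots>\<bar> \<le> q * \<bar>q ^ k - r ^ k\<bar> + \<bar>q - r\<bar> * r ^ k"
    using assms by (intro order_trans[OF abs_triangle_ineq]) (simp add: abs_mult)
  also have "\<dots> \<le> K * (k * K ^ k * \<bar>q - r\<bar>) + \<bar>q - r\<bar> * K ^ Suc k"
    using assms Suc low by (intro add_mono mult_mono mult_nonneg_nonneg) auto
  finally show ?case by (simp add: algebra_simps)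
qed simp

lemma power_second_order:
  fixes q r K :: real
  assumes "0 \<le> q" "q \<le> K" "0 \<le> r" "r \<le> K" "1 \<le> K"
  shows "\<bar>q ^ k - r ^ k - k * r ^ (k - 1) * (q - r)\<bar> \<le> (real k)\<^sup>2 * K ^ k * (q - r)\<^sup>2"
proof (induction k)
  case (Suc k)
  have low: "r ^ (k - 1) \<le> K ^ Suc k"
    using assms by (intro order_trans[OF power_mono power_increasing]) auto
  have "q ^ Suc k - r ^ Suc k - Suc k * r ^ (Suc k - 1) * (q - r) =
      q * (q ^ k - r ^ k - k * r ^ (k - 1) * (q - r)) + k * r ^ (k - 1) * (q - r)\<^sup>2"
    by (cases k) (simp_all add: algebra_simps power2_eq_square)
  also have "\<bar>\<dots>\<bar> \<le> q * \<bar>q ^ k - r ^ k - k * r ^ (k - 1) * (q - r)\<bar> + k * r ^ (k - 1) * (q - r)\<^sup>2"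
    using assms by (intro order_trans[OF abs_triangle_ineq]) (simp add: abs_mult)
  also have "\<dots> \<le> K * ((real k)\<^sup>2 * K ^ k * (q - r)\<^sup>2) + k * K ^ Suc k * (q - r)\<^sup>2"
    using assms Suc low by (intro add_mono mult_mono mult_nonneg_nonneg) auto
  also have "\<dots> = ((real k)\<^sup>2 + k) * (K ^ Suc k * (q - r)\<^sup>2)"
    by (simp add: algebra_simps)
  also have "\<dots> \<le> (real (Suc k))\<^sup>2 * (K ^ Suc k * (q - r)\<^sup>2)"
  proof (rule mult_right_mono)
    show "(real k)\<^sup>2 + k \<le> (real (Suc k))\<^sup>2" by (simp add: power2_eq_square algebra_simps)
  qed (use assms in simp)
  finally show ?case by (simp add: mult.assoc)
qed simp

lemma cycle_mean_smooth:
  assumes A: "A \<subseteq> {3..N}" and K: "1 \<le> K"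
    and q: "0 \<le> q" "q \<le> K" and r: "0 \<le> r" "r \<le> K"
  shows "\<bar>cycle_mean A q - cycle_mean A r\<bar> \<le> N * (N * K ^ N * \<bar>q - r\<bar>)"
    and "\<bar>cycle_mean A q - cycle_mean A r - (\<Sum>k\<in>A. r ^ (k - 1) / 2) * (q - r)\<bar>
      \<le> N * ((real N)\<^sup>2 * K ^ N * (q - r)\<^sup>2)"
proof -
  have shrink: "\<bar>u / (2 * real k)\<bar> \<le> \<bar>u\<bar>" if "3 \<le> k" for u and k :: nat
  proof -
    have "\<bar>u\<bar> / (2 * real k) \<le> \<bar>u\<bar> / 1" using that by (intro divide_left_mono) auto
    then show ?thesis by simp
  qed
  have "\<bar>cycle_mean A q - cycle_mean A r\<bar> \<le> (\<Sum>k\<in>A. \<bar>(q ^ k - r ^ k) / (2 * real k)\<bar>)"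
    unfolding cycle_mean_def sum_subtractf[symmetric] diff_divide_distrib[symmetric] by (rule sum_abs)
  also have "\<dots> \<le> N * (N * K ^ N * \<bar>q - r\<bar>)"
  proof (rule sum_subset_const_le[OF A])
    fix k assume k: "3 \<le> k" "k \<le> N"
    have "\<bar>(q ^ k - r ^ k) / (2 * real k)\<bar> \<le> \<bar>q ^ k - r ^ k\<bar>" by (rule shrink[OF k(1)])
    also have "\<bar>q ^ k - r ^ k\<bar> \<le> k * K ^ k * \<bar>q - r\<bar>" by (rule power_lipschitz[OF q r K])
    also have "\<dots> \<le> N * K ^ N * \<bar>q - r\<bar>"
      using k K by (intro mult_right_mono mult_mono power_increasing) auto
    finally show "\<bar>(q ^ k - r ^ k) / (2 * real k)\<bar> \<le> N * K ^ N * \<bar>q - r\<bar>" .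
  qed (use K in simp)
  finally show "\<bar>cycle_mean A q - cycle_mean A r\<bar> \<le> N * (N * K ^ N * \<bar>q - r\<bar>)" .
  have "cycle_mean A q - cycle_mean A r - (\<Sum>k\<in>A. r ^ (k - 1) / 2) * (q - r) =
      (\<Sum>k\<in>A. q ^ k / (2 * real k) - r ^ k / (2 * real k) - r ^ (k - 1) / 2 * (q - r))"
    by (simp only: cycle_mean_def sum_subtractf sum_distrib_right)
  also have "\<dots> = (\<Sum>k\<in>A. (q ^ k - r ^ k - k * r ^ (k - 1) * (q - r)) / (2 * real k))"
  proof (intro sum.cong refl)
    fix k assume "k \<in> A"
    then have "real k \<noteq> 0" using A by auto
    then show "q ^ k / (2 * real k) - r ^ k / (2 * real k) - r ^ (k - 1) / 2 * (q - r) =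
        (q ^ k - r ^ k - k * r ^ (k - 1) * (q - r)) / (2 * real k)"
      by (simp add: diff_divide_distrib)
  qed
  finally have "\<bar>cycle_mean A q - cycle_mean A r - (\<Sum>k\<in>A. r ^ (k - 1) / 2) * (q - r)\<bar> =
      \<bar>\<Sum>k\<in>A. (q ^ k - r ^ k - k * r ^ (k - 1) * (q - r)) / (2 * real k)\<bar>" by simp
  also have "\<dots> \<le> (\<Sum>k\<in>A. \<bar>(q ^ k - r ^ k - k * r ^ (k - 1) * (q - r)) / (2 * real k)\<bar>)"
    by (rule sum_abs)
  also have "\<dots> \<le> N * ((real N)\<^sup>2 * K ^ N * (q - r)\<^sup>2)"
  proof (rule sum_subset_const_le[OF A])
    fix k assume k: "3 \<le> k" "k \<le> N"
    have "\<bar>(q ^ k - r ^ k - k * r ^ (k - 1) * (q - r)) / (2 * real k)\<bar>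
        \<le> \<bar>q ^ k - r ^ k - k * r ^ (k - 1) * (q - r)\<bar>" by (rule shrink[OF k(1)])
    also have "\<bar>q ^ k - r ^ k - k * r ^ (k - 1) * (q - r)\<bar> \<le> (real k)\<^sup>2 * K ^ k * (q - r)\<^sup>2"
      by (rule power_second_order[OF q r K])
    also have "\<dots> \<le> (real N)\<^sup>2 * K ^ N * (q - r)\<^sup>2"
    proof (intro mult_right_mono mult_mono)
      show "(real k)\<^sup>2 \<le> (real N)\<^sup>2" using k by (intro power_mono) auto
      show "K ^ k \<le> K ^ N" using k K by (intro power_increasing) auto
    qed (use K in auto)
    finally show "\<bar>(q ^ k - r ^ k - k * r ^ (k - 1) * (q - r)) / (2 * real k)\<bar>
        \<le> (real N)\<^sup>2 * K ^ N * (q - r)\<^sup>2" .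
  qed (use K in simp)
  finally show "\<bar>cycle_mean A q - cycle_mean A r - (\<Sum>k\<in>A. r ^ (k - 1) / 2) * (q - r)\<bar>
      \<le> N * ((real N)\<^sup>2 * K ^ N * (q - r)\<^sup>2)" .
qed

text \<open>The linear term has to be kept: the fluctuations of the ratio \<open>q\<close> around \<open>r\<close> are of order
  \<open>n powr (- 1 / 2)\<close>, so that only their square is small enough, while the linear term will
  disappear on average. The constant must serve all \<open>A\<close> and \<open>h\<close> at once because the final bound
  is uniform in both.\<close>

lemma poisson_cycle_mean_second_order:
  fixes K r :: real
  assumes K: "1 \<le> K" and r: "0 \<le> r" "r \<le> K"
  shows "\<exists>C\<ge>0. \<forall>A\<subseteq>{3..N}. \<forall>h. (\<forall>j. \<bar>h j\<bar> \<le> 1) \<longrightarrow> (\<exists>b. \<bar>b\<bar> \<le> C \<and>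
      (\<forall>q. 0 \<le> q \<and> q \<le> K \<longrightarrow>
        \<bar>poisson_mean (cycle_mean A q) h - poisson_mean (cycle_mean A r) h - b * (q - r)\<bar>
          \<le> C * (q - r)\<^sup>2))"
proof -
  define T where "T = N * K ^ N"
  define C1 where "C1 = 2 * exp T * T"
  define C2 where "C2 = 2 * exp T * (N * ((real N)\<^sup>2 * K ^ N)) + (N * (N * K ^ N))\<^sup>2 * (4 * (exp T)\<^sup>2)"
  have T: "0 \<le> T" and C: "0 \<le> C1" "0 \<le> C2" using K by (simp_all add: T_def C1_def C2_def)
  show ?thesis
  proof (rule exI[of _ "C1 + C2"], intro conjI allI impI)
    show "0 \<le> C1 + C2" using C by simp
    fix A and h :: "nat \<Rightarrow> real"
    assume A: "A \<subseteq> {3..N}" and "\<forall>j. \<bar>h j\<bar> \<le> 1"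
    then have h: "\<bar>h j\<bar> \<le> 1" for j by simp
    define t where "t = cycle_mean A r"
    define m where "m = (\<Sum>k\<in>A. r ^ (k - 1) / 2)"
    define b where "b = poisson_slope t h * m"
    have t: "0 \<le> t" "t \<le> T" and m: "\<bar>m\<bar> \<le> T"
      using cycle_mean_bounds[OF A K r] by (simp_all add: t_def T_def m_def)
    have slope: "\<bar>poisson_slope t h\<bar> \<le> 2 * exp T"
    proof -
      have "\<bar>poisson_slope t h\<bar> \<le> 2 * 1 * exp t" by (rule abs_poisson_slope_le[OF t(1) h])
      also have "\<dots> \<le> 2 * exp T" using t by simp
      finally show ?thesis .
    qed
    have "\<bar>b\<bar> \<le> C1" unfolding b_def abs_mult C1_def by (intro mult_mono slope m) auto
    moreover have "\<bar>poisson_mean (cycle_mean A q) h - poisson_mean t h - b * (q - r)\<bar> \<le> C2 * (q - r)\<^sup>2"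
      if q: "0 \<le> q" "q \<le> K" for q
    proof -
      let ?s = "cycle_mean A q"
      have s: "0 \<le> ?s" by (rule cycle_mean_bounds[OF A K q])
      have 1: "\<bar>?s - t\<bar> \<le> N * (N * K ^ N) * \<bar>q - r\<bar>"
        using cycle_mean_smooth(1)[OF A K q r] by (simp add: t_def mult_ac)
      have 2: "\<bar>?s - t - m * (q - r)\<bar> \<le> N * ((real N)\<^sup>2 * K ^ N) * (q - r)\<^sup>2"
        using cycle_mean_smooth(2)[OF A K q r] by (simp add: t_def m_def mult_ac)
      have "\<bar>poisson_mean ?s h - poisson_mean t h - poisson_slope t h * (?s - t)\<bar>
          \<le> (?s - t)\<^sup>2 * (4 * 1 * (exp t)\<^sup>2)"
        by (rule poisson_mean_second_order[OF s t(1) h])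
      also have "\<dots> \<le> (N * (N * K ^ N) * \<bar>q - r\<bar>)\<^sup>2 * (4 * 1 * (exp T)\<^sup>2)"
        using t power_mono[OF 1, of 2] by (intro mult_mono) (auto intro!: power_mono)
      finally have 3: "\<bar>poisson_mean ?s h - poisson_mean t h - poisson_slope t h * (?s - t)\<bar>
          \<le> (N * (N * K ^ N))\<^sup>2 * (4 * (exp T)\<^sup>2) * (q - r)\<^sup>2"
        by (simp add: power_mult_distrib mult_ac)
      have "\<bar>poisson_slope t h * (?s - t - m * (q - r))\<bar>
          \<le> 2 * exp T * (N * ((real N)\<^sup>2 * K ^ N) * (q - r)\<^sup>2)"
        unfolding abs_mult by (intro mult_mono slope 2) auto
      moreover have "poisson_mean ?s h - poisson_mean t h - b * (q - r) =
          (poisson_mean ?s h - poisson_mean t h - poisson_slope t h * (?s - t)) +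
          poisson_slope t h * (?s - t - m * (q - r))"
        by (simp add: b_def algebra_simps)
      ultimately have "\<bar>poisson_mean ?s h - poisson_mean t h - b * (q - r)\<bar> \<le>
          (N * (N * K ^ N))\<^sup>2 * (4 * (exp T)\<^sup>2) * (q - r)\<^sup>2 + 2 * exp T * (N * ((real N)\<^sup>2 * K ^ N) * (q - r)\<^sup>2)"
        using 3 by linarith
      then show ?thesis by (simp add: C2_def algebra_simps)
    qed
    moreover have "C2 * (q - r)\<^sup>2 \<le> (C1 + C2) * (q - r)\<^sup>2" for q
      using C by (intro mult_right_mono) auto
    ultimately have "\<bar>b\<bar> \<le> C1 + C2" and "\<And>q. 0 \<le> q \<Longrightarrow> q \<le> K \<Longrightarrow>
        \<bar>poisson_mean (cycle_mean A q) h - poisson_mean t h - b * (q - r)\<bar> \<le> (C1 + C2) * (q - r)\<^sup>2"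
      using C by (simp, blast intro: order_trans)
    then show "\<exists>b. \<bar>b\<bar> \<le> C1 + C2 \<and> (\<forall>q. 0 \<le> q \<and> q \<le> K \<longrightarrow>
        \<bar>poisson_mean (cycle_mean A q) h - poisson_mean (cycle_mean A r) h - b * (q - r)\<bar>
          \<le> (C1 + C2) * (q - r)\<^sup>2)"
      unfolding t_def by (intro exI[of _ b]) simp
  qed
qed


section \<open>The random graph given its weights\<close>

lemma all_edges_eq_complete_edges: "all_edges n = complete_edges {1..n}"
  unfolding all_edges_def complete_edges_def by (rule refl)

lemma random_subset_cong:
  assumes "finite E" "\<And>e. e \<in> E \<Longrightarrow> p e = p' e"
  shows "random_subset E p = random_subset E p'"
proof -
  have "Pi_pmf E False (\<lambda>e. bernoulli_pmf (p e)) = Pi_pmf E False (\<lambda>e. bernoulli_pmf (p' e))"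
    using assms by (intro Pi_pmf_cong) auto
  then show ?thesis by (simp add: random_subset_def)
qed

text \<open>Dividing the weights by the root of their sum brings the edge probabilities into the form
  \<open>x i * x j / (1 + x i * x j)\<close>.\<close>

lemma poisson_approximation_given_weights:
  fixes w :: "nat \<Rightarrow> real" and n :: nat
  defines "L \<equiv> \<Sum>i=1..n. w i" and "S2 \<equiv> \<Sum>i=1..n. (w i)\<^sup>2" and "S4 \<equiv> \<Sum>i=1..n. w i ^ 4"
  assumes w: "\<And>i. i \<in> {1..n} \<Longrightarrow> 0 < w i" and n: "1 \<le> n"
    and K: "1 \<le> K" "S2 / L \<le> K" and A: "A \<subseteq> {3..N}" and h: "\<And>j. \<bar>h j\<bar> \<le> 1"
  shows "\<bar>measure_pmf.expectation (grg_given_weights n w) (\<lambda>G. h (cycle_count A G))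
      - poisson_mean (cycle_mean A (S2 / L)) h\<bar> \<le> fixed_weights_const N K * (S4 / L\<^sup>2)"
proof -
  define x where "x i = w i / sqrt L" for i
  have L: "0 < L" unfolding L_def using w n by (intro sum_pos) auto
  have x2: "(x i)\<^sup>2 = (w i)\<^sup>2 / L" for i using L by (simp add: x_def power_divide)
  have x4: "x i ^ 4 = w i ^ 4 / L\<^sup>2" for i
  proof -
    have "x i ^ 4 = ((x i)\<^sup>2)\<^sup>2" by simp
    then show ?thesis unfolding x2 by (simp add: power_divide)
  qed
  have q: "(\<Sum>i\<in>{1..n}. (x i)\<^sup>2) = S2 / L" by (simp add: x2 S2_def sum_divide_distrib)
  have s4: "(\<Sum>i\<in>{1..n}. x i ^ 4) = S4 / L\<^sup>2" by (simp add: x4 S4_def sum_divide_distrib)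
  interpret vertex_weights "{1..n}" x K
  proof
    show "0 \<le> x i" if "i \<in> {1..n}" for i
      using w[OF that] L by (simp add: x_def)
    show "(\<Sum>i\<in>{1..n}. (x i)\<^sup>2) \<le> K" unfolding q by (rule K(2))
  qed (use K in auto)
  have "grg_given_weights n w = random_subset (complete_edges {1..n}) (edge_prob n w)"
    by (simp add: grg_given_weights_def random_subset_def all_edges_eq_complete_edges)
  also have "\<dots> = random_subset (complete_edges {1..n}) p"
  proof (rule random_subset_cong[OF finite_complete_edges])
    fix e assume "e \<in> complete_edges {1..n}"
    then obtain i j where e: "e = {i, j}" "i \<in> {1..n}" "j \<in> {1..n}" "i \<noteq> j"
      by (auto simp: complete_edges_def)
    have "y e = w i * w j / L" using e L by (simp add: y_def x_def)
    moreover have "(\<Prod>i\<in>e. w i) = w i * w j" using e by simp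
    moreover have "0 < w i * w j" using w e by simp
    ultimately show "edge_prob n w e = p e"
      using L unfolding edge_prob_def p_def L_def[symmetric] by (simp add: add_divide_eq_iff add.commute)
  qed
  finally show ?thesis
    using poisson_approximation_cycle_count[OF A h] by (simp only: q s4)
qed

text \<open>For random weights the linear term has expectation zero, and the right-hand side has expectation
  of order \<open>1 / n\<close>. When the sum of the weights or of their squares is atypical, the bound holds
  because its right-hand side is bounded below.\<close>

lemma expansion_given_weights:
  fixes m1 m2 :: real
  assumes m: "0 < m1" "0 < m2"
  shows "\<exists>C\<ge>0. \<forall>A\<subseteq>{3..N}. \<forall>h. (\<forall>j. \<bar>h j\<bar> \<le> 1) \<longrightarrow>
    (\<exists>a. \<forall>n\<ge>1. \<forall>w. (\<forall>i\<in>{1..n}. 0 < w i) \<longrightarrow>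
      \<bar>measure_pmf.expectation (grg_given_weights n w) (\<lambda>G. h (cycle_count A G))
          - poisson_mean (cycle_mean A (m2 / m1)) h
          - a / real n * (\<Sum>i=1..n. m1 * (w i)\<^sup>2 - m2 * w i)\<bar>
        \<le> C / (real n)\<^sup>2 * ((\<Sum>i=1..n. w i ^ 4) + (\<Sum>i=1..n. m1 * (w i)\<^sup>2 - m2 * w i)\<^sup>2
            + (\<Sum>i=1..n. w i - m1)\<^sup>2 + (\<Sum>i=1..n. (w i)\<^sup>2 - m2)\<^sup>2))"
proof -
  define r where "r = m2 / m1"
  \<comment> \<open>\<open>4 * r\<close> bounds \<open>S2 / L\<close> as soon as \<open>L\<close> is at least half and \<open>S2\<close> at most twice its mean.\<close>
  define K where "K = 1 + 4 * r"
  have r0: "0 < r" using m by (simp add: r_def)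
  then have r: "0 \<le> r" "r \<le> K" and K: "1 \<le> K" using r0 by (simp_all add: K_def)
  obtain C1 where C1: "0 \<le> C1" and second_order: "\<forall>A\<subseteq>{3..N}. \<forall>h. (\<forall>j. \<bar>h j\<bar> \<le> 1) \<longrightarrow>
    (\<exists>b. \<bar>b\<bar> \<le> C1 \<and> (\<forall>q. 0 \<le> q \<and> q \<le> K \<longrightarrow>
      \<bar>poisson_mean (cycle_mean A q) h - poisson_mean (cycle_mean A r) h - b * (q - r)\<bar> \<le> C1 * (q - r)\<^sup>2))"
    using poisson_cycle_mean_second_order[OF K r, of N] by (elim exE conjE)
  define C0 where "C0 = \<bar>fixed_weights_const N K\<bar>"
  define Cg where "Cg = 4 * C0 / m1\<^sup>2 + 4 * C1 / m1 ^ 4 + C1 / m1 ^ 3"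
  define Cb where "Cb = (2 + C1 / m1\<^sup>2) * (4 / m1\<^sup>2 + 1 / m2\<^sup>2) + C1 / m1\<^sup>2"
  have Cg: "0 \<le> Cg" and Cb: "0 \<le> Cb" using m C1 by (simp_all add: Cg_def Cb_def C0_def)
  show ?thesis
  proof (rule exI[of _ "Cg + Cb"], intro conjI allI impI)
    show "0 \<le> Cg + Cb" using Cg Cb by simp
    fix A and h :: "nat \<Rightarrow> real"
    assume A: "A \<subseteq> {3..N}" and h_all: "\<forall>j. \<bar>h j\<bar> \<le> 1"
    then have h: "\<bar>h j\<bar> \<le> 1" for j by simp
    define \<Phi> where "\<Phi> q = poisson_mean (cycle_mean A q) h" for q
    obtain b where b: "\<bar>b\<bar> \<le> C1"
      and \<Phi>_all: "\<forall>q. 0 \<le> q \<and> q \<le> K \<longrightarrow> \<bar>\<Phi> q - \<Phi> r - b * (q - r)\<bar> \<le> C1 * (q - r)\<^sup>2"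
      using second_order[THEN spec, THEN mp, OF A, THEN spec, THEN mp, OF h_all]
      unfolding \<Phi>_def by (elim exE conjE)
    have \<Phi>: "\<bar>\<Phi> q - \<Phi> r - b * (q - r)\<bar> \<le> C1 * (q - r)\<^sup>2" if "0 \<le> q" "q \<le> K" for q
      using \<Phi>_all that by simp
    define a where "a = b / m1\<^sup>2"
    have a: "\<bar>a\<bar> \<le> C1 / m1\<^sup>2" using b m by (simp add: a_def divide_right_mono)
    have "\<bar>measure_pmf.expectation (grg_given_weights n w) (\<lambda>G. h (cycle_count A G))
          - \<Phi> r - a / real n * (\<Sum>i=1..n. m1 * (w i)\<^sup>2 - m2 * w i)\<bar>
        \<le> (Cg + Cb) / (real n)\<^sup>2 * ((\<Sum>i=1..n. w i ^ 4) + (\<Sum>i=1..n. m1 * (w i)\<^sup>2 - m2 * w i)\<^sup>2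
            + (\<Sum>i=1..n. w i - m1)\<^sup>2 + (\<Sum>i=1..n. (w i)\<^sup>2 - m2)\<^sup>2)"
      if n: "1 \<le> n" and w: "\<And>i. i \<in> {1..n} \<Longrightarrow> 0 < w i" for n w
    proof -
      let ?Ex = "measure_pmf.expectation (grg_given_weights n w) (\<lambda>G. h (cycle_count A G))"
      define L where "L = (\<Sum>i=1..n. w i)"
      define S2 where "S2 = (\<Sum>i=1..n. (w i)\<^sup>2)"
      define S4 where "S4 = (\<Sum>i=1..n. w i ^ 4)"
      define D where "D = m1 * S2 - m2 * L"
      define u where "u = L - n * m1"
      define v where "v = S2 - n * m2"
      define R where "R = S4 + D\<^sup>2 + u\<^sup>2 + v\<^sup>2"
      have sums: "(\<Sum>i=1..n. m1 * (w i)\<^sup>2 - m2 * w i) = D" "(\<Sum>i=1..n. w i - m1) = u"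
          "(\<Sum>i=1..n. (w i)\<^sup>2 - m2) = v"
        by (simp_all add: D_def u_def v_def S2_def L_def sum_subtractf sum_distrib_left)
      have n0: "0 < real n" using n by simp
      have L: "0 < L" unfolding L_def using w n by (intro sum_pos) auto
      have S2: "0 \<le> S2" unfolding S2_def by (intro sum_nonneg) simp
      have S4: "0 \<le> S4" unfolding S4_def by (intro sum_nonneg) simp
      have R: "0 \<le> R" "S4 \<le> R" "D\<^sup>2 \<le> R" "u\<^sup>2 \<le> R" "v\<^sup>2 \<le> R" "D\<^sup>2 + u\<^sup>2 \<le> R" using S4 by (simp_all add: R_def)
      have "\<bar>?Ex - \<Phi> r - a / real n * D\<bar> \<le> (Cg + Cb) / (real n)\<^sup>2 * R"
      proof (cases "n * m1 / 2 \<le> L \<and> S2 \<le> 2 * (n * m2)")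
        case True
        then have L2: "n * m1 / 2 \<le> L" and S2_le: "S2 \<le> 2 * (n * m2)" by auto
        define q where "q = S2 / L"
        have q: "0 \<le> q" using S2 L by (simp add: q_def)
        have "q \<le> 2 * (n * m2) / (n * m1 / 2)"
          unfolding q_def using L2 S2_le S2 n0 m by (intro frac_le) auto
        also have "\<dots> = 4 * r" using n0 m by (simp add: r_def field_simps)
        finally have qK: "q \<le> K" by (simp add: K_def)
        have L_sq: "1 / L\<^sup>2 \<le> 4 / (m1\<^sup>2 * (real n)\<^sup>2)"
        proof -
          have "(n * m1 / 2)\<^sup>2 \<le> L\<^sup>2" using L2 n0 m by (intro power_mono) auto
          then have "1 / L\<^sup>2 \<le> 1 / (n * m1 / 2)\<^sup>2"
            using n0 m L by (intro divide_left_mono) auto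
          also have "\<dots> = 4 / (m1\<^sup>2 * (real n)\<^sup>2)" by (simp add: power_divide power_mult_distrib mult_ac)
          finally show ?thesis .
        qed
        have "\<bar>?Ex - \<Phi> q\<bar> \<le> fixed_weights_const N K * (S4 / L\<^sup>2)"
          unfolding \<Phi>_def q_def S2_def L_def S4_def
          by (rule poisson_approximation_given_weights[OF w n K _ A h])
            (use qK in \<open>simp_all add: q_def S2_def L_def\<close>)
        also have "\<dots> \<le> C0 * (S4 * (1 / L\<^sup>2))"
          unfolding C0_def using S4
            mult_right_mono[OF abs_ge_self[of "fixed_weights_const N K"], of "S4 / L\<^sup>2"] by simp
        also have "\<dots> \<le> C0 * (R * (4 / (m1\<^sup>2 * (real n)\<^sup>2)))"
          using R by (intro mult_left_mono mult_mono L_sq) (simp_all add: C0_def)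
        also have "\<dots> = 4 * C0 / m1\<^sup>2 * (R / (real n)\<^sup>2)" by simp
        finally have 1: "\<bar>?Ex - \<Phi> q\<bar> \<le> 4 * C0 / m1\<^sup>2 * (R / (real n)\<^sup>2)" .
        have qr: "q - r = D / (m1 * L)"
          using L m by (simp add: q_def r_def D_def field_simps)
        have "(q - r)\<^sup>2 = D\<^sup>2 * (1 / L\<^sup>2) / m1\<^sup>2"
          unfolding qr by (simp add: power_divide power_mult_distrib)
        also have "\<dots> \<le> R * (4 / (m1\<^sup>2 * (real n)\<^sup>2)) / m1\<^sup>2"
          using R by (intro divide_right_mono mult_mono L_sq) simp_all
        also have "\<dots> = 4 / m1 ^ 4 * (R / (real n)\<^sup>2)"
          by (simp add: power2_eq_square power4_eq_xxxx mult_ac)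
        finally have "C1 * (q - r)\<^sup>2 \<le> C1 * (4 / m1 ^ 4 * (R / (real n)\<^sup>2))"
          using C1 by (intro mult_left_mono)
        then have 2: "\<bar>\<Phi> q - \<Phi> r - b * (q - r)\<bar> \<le> 4 * C1 / m1 ^ 4 * (R / (real n)\<^sup>2)"
          using \<Phi>[OF q qK] by (simp add: mult_ac)
        \<comment> \<open>Replacing the random denominator \<open>L\<close> by its mean makes the linear term centred; the price
          is a product of two fluctuations.\<close>
        have "b * (q - r) - a / real n * D = - (b * (D * u) / (m1\<^sup>2 * n * L))"
          unfolding qr a_def u_def using L m n0 by (simp add: field_simps power2_eq_square)
        then have "\<bar>b * (q - r) - a / real n * D\<bar> = \<bar>b\<bar> * \<bar>D * u\<bar> / (m1\<^sup>2 * n * L)"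
          using L m n0 by (simp add: abs_mult)
        also have "\<dots> \<le> C1 * (R / 2) / (m1\<^sup>2 * n * (n * m1 / 2))"
        proof (intro frac_le mult_mono b)
          have "2 * \<bar>D * u\<bar> \<le> D\<^sup>2 + u\<^sup>2"
            using sum_squares_bound[of "\<bar>D\<bar>" "\<bar>u\<bar>"] by (simp add: abs_mult)
          then show "\<bar>D * u\<bar> \<le> R / 2" using R by linarith
        qed (use m n0 L2 C1 R in auto)
        also have "\<dots> = C1 / m1 ^ 3 * (R / (real n)\<^sup>2)"
          using m n0 by (simp add: field_simps power2_eq_square power3_eq_cube)
        finally have 3: "\<bar>b * (q - r) - a / real n * D\<bar> \<le> C1 / m1 ^ 3 * (R / (real n)\<^sup>2)" .
        have "\<bar>?Ex - \<Phi> r - a / real n * D\<bar> \<le> Cg * (R / (real n)\<^sup>2)"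
          using 1 2 3 unfolding Cg_def distrib_right by linarith
        also have "\<dots> \<le> (Cg + Cb) * (R / (real n)\<^sup>2)"
          using Cb R by (intro mult_right_mono) auto
        finally show ?thesis by simp
      next
        case False
        define z where "z = R / (real n)\<^sup>2"
        have z: "0 \<le> z" using R by (simp add: z_def)
        \<comment> \<open>Chebyshev's argument, carried out before taking expectations.\<close>
        have one: "1 \<le> (4 / m1\<^sup>2 + 1 / m2\<^sup>2) * z"
        proof -
          have "1 \<le> 4 / m1\<^sup>2 * z \<or> 1 \<le> 1 / m2\<^sup>2 * z"
          proof (cases "L < n * m1 / 2")
            case True
            then have "n * m1 / 2 \<le> - u" unfolding u_def by linarith
            then have "(n * m1 / 2)\<^sup>2 \<le> (- u)\<^sup>2" using n0 m by (intro power_mono) auto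
            then have "(real n)\<^sup>2 * m1\<^sup>2 / 4 \<le> R" using R(4) by (simp add: power_mult_distrib power_divide)
            then show ?thesis using n0 m by (simp add: z_def field_simps)
          next
            case False
            with \<open>\<not> (n * m1 / 2 \<le> L \<and> S2 \<le> 2 * (n * m2))\<close> have "2 * (n * m2) < S2" by linarith
            then have "n * m2 \<le> v" unfolding v_def by linarith
            then have "(n * m2)\<^sup>2 \<le> v\<^sup>2" using n0 m by (intro power_mono) auto
            then have "(real n)\<^sup>2 * m2\<^sup>2 \<le> R" using R(5) by (simp add: power_mult_distrib)
            then show ?thesis using n0 m by (simp add: z_def field_simps)
          qed
          moreover have "0 \<le> 4 / m1\<^sup>2 * z" "0 \<le> 1 / m2\<^sup>2 * z" using z by auto
          ultimately show ?thesis unfolding distrib_right by linarith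
        qed
        have "\<bar>?Ex\<bar> \<le> measure_pmf.expectation (grg_given_weights n w) (\<lambda>G. 1)"
          by (intro order_trans[OF integral_abs_bound] integral_mono)
            (auto intro!: measure_pmf.integrable_const_bound[where B = 1] h)
        moreover have "\<bar>\<Phi> r\<bar> \<le> 1"
          unfolding \<Phi>_def by (rule abs_poisson_mean_le[OF cycle_mean_bounds(1)[OF A K r] h])
        ultimately have 1: "\<bar>?Ex - \<Phi> r\<bar> \<le> 2" by simp
        have "2 * \<bar>D / n\<bar> \<le> 1 + (D / n)\<^sup>2"
          using sum_squares_bound[of 1 "\<bar>D / n\<bar>"] by (simp add: power_divide)
        then have "\<bar>D / n\<bar> \<le> 1 + (D / n)\<^sup>2" using abs_ge_zero[of "D / n"] by linarith
        also have "(D / n)\<^sup>2 \<le> z" using R by (simp add: z_def power_divide divide_right_mono)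
        finally have "\<bar>a\<bar> * \<bar>D / n\<bar> \<le> C1 / m1\<^sup>2 * (1 + z)"
          by (intro mult_mono a) (use C1 z in auto)
        then have "\<bar>a / real n * D\<bar> \<le> C1 / m1\<^sup>2 * (1 + z)"
          by (simp add: abs_mult)
        also have "\<dots> = C1 / m1\<^sup>2 + C1 / m1\<^sup>2 * z" by (simp add: distrib_left)
        finally have "\<bar>?Ex - \<Phi> r - a / real n * D\<bar> \<le> 2 + (C1 / m1\<^sup>2 + C1 / m1\<^sup>2 * z)"
          by (intro order_trans[OF abs_triangle_ineq4] add_mono 1)
        also have "\<dots> = (2 + C1 / m1\<^sup>2) * 1 + C1 / m1\<^sup>2 * z" by simp
        also have "\<dots> \<le> (2 + C1 / m1\<^sup>2) * ((4 / m1\<^sup>2 + 1 / m2\<^sup>2) * z) + C1 / m1\<^sup>2 * z"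
          using C1 by (intro add_right_mono mult_left_mono one) auto
        also have "\<dots> = Cb * z" by (simp only: Cb_def distrib_right mult.assoc)
        also have "\<dots> \<le> (Cg + Cb) * z" using Cg z by (intro mult_right_mono) auto
        finally show ?thesis by (simp add: z_def)
      qed
      then show ?thesis unfolding sums R_def S4_def by simp
    qed
    then show "\<exists>a. \<forall>n\<ge>1. \<forall>w. (\<forall>i\<in>{1..n}. 0 < w i) \<longrightarrow>
      \<bar>measure_pmf.expectation (grg_given_weights n w) (\<lambda>G. h (cycle_count A G))
          - poisson_mean (cycle_mean A (m2 / m1)) h
          - a / real n * (\<Sum>i=1..n. m1 * (w i)\<^sup>2 - m2 * w i)\<bar>
        \<le> (Cg + Cb) / (real n)\<^sup>2 * ((\<Sum>i=1..n. w i ^ 4) + (\<Sum>i=1..n. m1 * (w i)\<^sup>2 - m2 * w i)\<^sup>2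
            + (\<Sum>i=1..n. w i - m1)\<^sup>2 + (\<Sum>i=1..n. (w i)\<^sup>2 - m2)\<^sup>2)"
      unfolding \<Phi>_def r_def by (intro exI[of _ a]) simp
  qed
qed


section \<open>Moments of sums of independent weights\<close>

context product_prob_space
begin

lemma integrable_component:
  fixes g :: "'a \<Rightarrow> real"
  assumes "i \<in> I" "integrable (M i) g"
  shows "integrable (PiM I M) (\<lambda>w. g (w i))"
    and "(\<integral>w. g (w i) \<partial>PiM I M) = (\<integral>z. g z \<partial>M i)"
proof -
  have m: "(\<lambda>w. w i) \<in> PiM I M \<rightarrow>\<^sub>M M i" using assms(1) by simp
  have g: "g \<in> borel_measurable (M i)" using assms(2) by simp
  show "integrable (PiM I M) (\<lambda>w. g (w i))"
    using integrable_distr_eq[OF m g] PiM_component[OF assms(1)] assms(2) by simp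
  show "(\<integral>w. g (w i) \<partial>PiM I M) = (\<integral>z. g z \<partial>M i)"
    using integral_distr[OF m g] PiM_component[OF assms(1)] by simp
qed

lemma integrable_component_mult:
  fixes f g :: "'a \<Rightarrow> real"
  assumes I: "finite I" and ij: "i \<in> I" "j \<in> I" "i \<noteq> j"
    and f: "integrable (M i) f" and g: "integrable (M j) g"
  shows "integrable (PiM I M) (\<lambda>w. f (w i) * g (w j))"
    and "(\<integral>w. f (w i) * g (w j) \<partial>PiM I M) = (\<integral>z. f z \<partial>M i) * (\<integral>z. g z \<partial>M j)"
proof -
  define F where "F k = (if k = i then f else if k = j then g else (\<lambda>_. 1))" for k
  have F: "integrable (M k) (F k)" if "k \<in> I" for k
    using f g by (auto simp: F_def)
  have split: "(\<Prod>k\<in>I. a k) = a i * a j" if "\<And>k. k \<in> I \<Longrightarrow> k \<noteq> i \<Longrightarrow> k \<noteq> j \<Longrightarrow> a k = 1" for a :: "_ \<Rightarrow> real"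
  proof -
    have "(\<Prod>k\<in>I. a k) = (\<Prod>k\<in>{i, j}. a k)"
      using I ij that by (intro prod.mono_neutral_right) auto
    then show ?thesis using ij by simp
  qed
  have prod: "(\<Prod>k\<in>I. F k (w k)) = f (w i) * g (w j)" for w
    using split[of "\<lambda>k. F k (w k)"] ij by (simp add: F_def)
  show "integrable (PiM I M) (\<lambda>w. f (w i) * g (w j))"
    using product_integrable_prod[OF I F] unfolding prod .
  have "(\<integral>w. f (w i) * g (w j) \<partial>PiM I M) = (\<Prod>k\<in>I. integral\<^sup>L (M k) (F k))"
    using product_integral_prod[OF I F] unfolding prod .
  also have "\<dots> = (\<integral>z. f z \<partial>M i) * (\<integral>z. g z \<partial>M j)"
    using split[of "\<lambda>k. integral\<^sup>L (M k) (F k)"] ij M.prob_space by (simp add: F_def)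
  finally show "(\<integral>w. f (w i) * g (w j) \<partial>PiM I M) = (\<integral>z. f z \<partial>M i) * (\<integral>z. g z \<partial>M j)" .
qed

end

lemma
  fixes D :: "real measure" and g :: "real \<Rightarrow> real"
  assumes D: "prob_space D" and I: "finite I" and g: "integrable D g"
  shows integrable_sum_iid: "integrable (PiM I (\<lambda>_. D)) (\<lambda>w. \<Sum>i\<in>I. g (w i))"
    and integral_sum_iid: "(\<integral>w. (\<Sum>i\<in>I. g (w i)) \<partial>PiM I (\<lambda>_. D)) = card I * (\<integral>z. g z \<partial>D)"
proof -
  interpret D: prob_space D by (rule D)
  interpret product_prob_space "\<lambda>_. D" I ..
  show "integrable (PiM I (\<lambda>_. D)) (\<lambda>w. \<Sum>i\<in>I. g (w i))"
    using integrable_component g by (intro Bochner_Integration.integrable_sum) auto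
  show "(\<integral>w. (\<Sum>i\<in>I. g (w i)) \<partial>PiM I (\<lambda>_. D)) = card I * (\<integral>z. g z \<partial>D)"
    using integrable_component g by (subst Bochner_Integration.integral_sum) auto
qed

text \<open>Independence removes the mixed terms.\<close>

lemma
  fixes D :: "real measure" and g :: "real \<Rightarrow> real"
  assumes D: "prob_space D" and I: "finite I" and g: "integrable D g"
    and g2: "integrable D (\<lambda>z. (g z)\<^sup>2)" and centred: "(\<integral>z. g z \<partial>D) = 0"
  shows integrable_square_sum_iid: "integrable (PiM I (\<lambda>_. D)) (\<lambda>w. (\<Sum>i\<in>I. g (w i))\<^sup>2)"
    and integral_square_sum_iid:
      "(\<integral>w. (\<Sum>i\<in>I. g (w i))\<^sup>2 \<partial>PiM I (\<lambda>_. D)) = card I * (\<integral>z. (g z)\<^sup>2 \<partial>D)"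
proof -
  interpret D: prob_space D by (rule D)
  interpret product_prob_space "\<lambda>_. D" I ..
  let ?P = "PiM I (\<lambda>_. D)"
  have int: "integrable ?P (\<lambda>w. g (w i) * g (w j))" if "i \<in> I" "j \<in> I" for i j
    using integrable_component(1)[of i "\<lambda>z. (g z)\<^sup>2"] integrable_component_mult(1)[of i j g g] I that g g2
    by (cases "i = j") (simp_all add: power2_eq_square)
  have val: "(\<integral>w. g (w i) * g (w j) \<partial>?P) = (if i = j then (\<integral>z. (g z)\<^sup>2 \<partial>D) else 0)"
    if "i \<in> I" "j \<in> I" for i j
    using integrable_component(2)[of i "\<lambda>z. (g z)\<^sup>2"] integrable_component_mult(2)[of i j g g] I that g g2 centred
    by (cases "i = j") (simp_all add: power2_eq_square)
  have expand: "(\<Sum>i\<in>I. g (w i))\<^sup>2 = (\<Sum>i\<in>I. \<Sum>j\<in>I. g (w i) * g (w j))" for w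
    by (simp add: power2_eq_square sum_product)
  show "integrable ?P (\<lambda>w. (\<Sum>i\<in>I. g (w i))\<^sup>2)"
    unfolding expand by (intro Bochner_Integration.integrable_sum int)
  have "(\<integral>w. (\<Sum>i\<in>I. g (w i))\<^sup>2 \<partial>?P) = (\<Sum>i\<in>I. \<Sum>j\<in>I. \<integral>w. g (w i) * g (w j) \<partial>?P)"
    unfolding expand
    by (subst Bochner_Integration.integral_sum)
      (intro Bochner_Integration.integrable_sum int sum.cong refl Bochner_Integration.integral_sum | assumption)+
  also have "\<dots> = (\<Sum>i\<in>I. \<Sum>j\<in>I. if i = j then (\<integral>z. (g z)\<^sup>2 \<partial>D) else 0)"
    by (intro sum.cong refl val)
  also have "\<dots> = card I * (\<integral>z. (g z)\<^sup>2 \<partial>D)" using I by simp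
  finally show "(\<integral>w. (\<Sum>i\<in>I. g (w i))\<^sup>2 \<partial>?P) = card I * (\<integral>z. (g z)\<^sup>2 \<partial>D)" .
qed


section \<open>The laws on both sides as expectations\<close>

lemma measure_poisson_point_process:
  assumes "poisson_point_process P (cycle_intensity M W) \<eta>" and A: "A \<subseteq> {3..N}"
    and r: "0 \<le> r" "(\<integral>x. W x ^ 2 \<partial>M) / (\<integral>x. W x \<partial>M) = r"
  shows "measure P {\<omega> \<in> space P. count_in (\<eta> \<omega>) A \<in> B} =
    poisson_mean (cycle_mean A r) (\<lambda>j. of_bool (j \<in> B))"
proof -
  note ppp = assms(1)[unfolded poisson_point_process_def]
  have space: "space (cycle_intensity M W) = {3..}"
    by (simp add: cycle_intensity_def space_point_measure)
  have finA: "finite A" "A \<subseteq> {3..}" using A finite_subset[OF A] by auto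
  have P: "prob_space P" using ppp by (elim conjE)
  have meas: "(\<lambda>\<omega>. \<eta> \<omega> k) \<in> P \<rightarrow>\<^sub>M count_space UNIV" if "3 \<le> k" for k
    using ppp that unfolding space by (elim conjE) simp
  have law: "measure P {\<omega> \<in> space P. count_in (\<eta> \<omega>) A = j} =
      measure (cycle_intensity M W) A ^ j / fact j * exp (- measure (cycle_intensity M W) A)" for j
  proof -
    have "\<forall>A j. finite A \<and> A \<subseteq> space (cycle_intensity M W) \<longrightarrow>
        measure P {\<omega> \<in> space P. count_in (\<eta> \<omega>) A = j} =
          measure (cycle_intensity M W) A ^ j / fact j * exp (- measure (cycle_intensity M W) A)"
      using ppp by (elim conjE)
    from this[THEN spec, THEN spec, THEN mp, of A j] show ?thesis unfolding space using finA by simp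
  qed
  interpret P: prob_space P by (rule P)
  have rate: "cycle_rate M W k = r ^ k / (2 * real k)" for k
    by (simp add: cycle_rate_def r(2))
  have "emeasure (cycle_intensity M W) A = (\<Sum>k\<in>A. ennreal (r ^ k / (2 * real k)))"
    unfolding cycle_intensity_def rate using A finite_subset[OF A]
    by (intro emeasure_point_measure_finite2) auto
  also have "\<dots> = ennreal (cycle_mean A r)"
    unfolding cycle_mean_def using r(1) by (intro sum_ennreal) simp
  finally have em: "emeasure (cycle_intensity M W) A = ennreal (cycle_mean A r)" .
  have "0 \<le> cycle_mean A r" unfolding cycle_mean_def using r(1) by (intro sum_nonneg) simp
  then have \<Lambda>: "measure (cycle_intensity M W) A = cycle_mean A r"
    unfolding measure_def em by (rule enn2real_ennreal)
  have count: "(\<lambda>\<omega>. count_in (\<eta> \<omega>) A) \<in> P \<rightarrow>\<^sub>M count_space UNIV"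
    unfolding count_in_def using finA
  proof (induction A rule: finite_induct)
    case (insert k F)
    have "(\<lambda>\<omega>. \<eta> \<omega> k + (\<Sum>k\<in>F. \<eta> \<omega> k)) \<in> P \<rightarrow>\<^sub>M count_space UNIV"
    proof (rule measurable_compose_countable[where g = "\<lambda>\<omega>. \<eta> \<omega> k" and f = "\<lambda>m \<omega>. m + (\<Sum>k\<in>F. \<eta> \<omega> k)"])
      show "(\<lambda>\<omega>. m + (\<Sum>k\<in>F. \<eta> \<omega> k)) \<in> P \<rightarrow>\<^sub>M count_space UNIV" for m
        using insert.prems
        by (intro measurable_compose[OF insert.IH, where g = "\<lambda>s. m + s"]) auto
    qed (use insert.prems meas in simp)
    then show ?case using insert.hyps by simp
  qed simp
  define S where "S j = {\<omega> \<in> space P. count_in (\<eta> \<omega>) A = j \<and> j \<in> B}" for j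
  have "S j = (\<lambda>\<omega>. count_in (\<eta> \<omega>) A) -` (if j \<in> B then {j} else {}) \<inter> space P" for j
    by (auto simp: S_def)
  then have sets: "range S \<subseteq> sets P"
    using measurable_sets[OF count] by auto
  have "(\<lambda>j. measure P (S j)) sums measure P (\<Union>j. S j)"
    by (rule P.finite_measure_UNION[OF sets]) (auto simp: S_def disjoint_family_on_def)
  also have "(\<Union>j. S j) = {\<omega> \<in> space P. count_in (\<eta> \<omega>) A \<in> B}"
    by (auto simp: S_def)
  finally have "(\<lambda>j. measure P (S j)) sums measure P {\<omega> \<in> space P. count_in (\<eta> \<omega>) A \<in> B}" .
  moreover have "measure P (S j) = cycle_mean A r ^ j / fact j * exp (- cycle_mean A r) * of_bool (j \<in> B)" for j
    using law[of j] unfolding \<Lambda> by (cases "j \<in> B") (simp_all add: S_def)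
  ultimately show ?thesis by (simp add: poisson_mean_def sums_iff)
qed

lemma measure_grg:
  assumes "prob_space M" "W \<in> borel_measurable M"
  shows "measure (grg M W n) {G \<in> space (grg M W n). X G \<in> B} =
      (\<integral>w. measure_pmf.expectation (grg_given_weights n w) (\<lambda>G. of_bool (X G \<in> B))
        \<partial>(\<Pi>\<^sub>M i\<in>{1..n}. distr M borel W))"
    and "(\<lambda>w. measure_pmf.expectation (grg_given_weights n w) (\<lambda>G. of_bool (X G \<in> B) :: real))
      \<in> borel_measurable (\<Pi>\<^sub>M i\<in>{1..n}. distr M borel W)"
proof -
  let ?D = "\<Pi>\<^sub>M i\<in>{1..n}. distr M borel W"
  interpret D: prob_space "distr M borel W"
    using assms by (rule prob_space.prob_space_distr)
  interpret product_prob_space "\<lambda>_. distr M borel W" "{1..n}" ..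
  have ex: "measure_pmf.expectation (grg_given_weights n w) (\<lambda>G. of_bool (X G \<in> B)) =
      measure (measure_pmf (grg_given_weights n w)) {G. X G \<in> B}" for w
    by (simp add: of_bool_def flip: indicator_def[of "{G. X G \<in> B}", simplified])
  have "space (grg M W n) = space (count_space UNIV :: nat set set measure)"
    unfolding grg_def
    by (rule space_bind_measurable[OF grg_given_weights_measurable P.not_empty])
  then show "measure (grg M W n) {G \<in> space (grg M W n). X G \<in> B} =
      (\<integral>w. measure_pmf.expectation (grg_given_weights n w) (\<lambda>G. of_bool (X G \<in> B)) \<partial>?D)"
    unfolding ex grg_def
    using P.measure_bind[OF grg_given_weights_measurable, of "{G. X G \<in> B}"] by simp
  show "(\<lambda>w. measure_pmf.expectation (grg_given_weights n w) (\<lambda>G. of_bool (X G \<in> B) :: real))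
      \<in> borel_measurable ?D"
    unfolding ex
    by (rule measurable_compose[OF grg_given_weights_measurable measurable_measure_subprob_algebra]) simp
qed

section \<open>The rate of Poisson convergence\<close>

theorem theorem2p2:
  fixes M :: "'a measure" and W :: "'a \<Rightarrow> real"
    and P :: "'p measure" and \<eta> :: "'p \<Rightarrow> nat \<Rightarrow> nat"
  assumes "prob_space M"
    and "W \<in> borel_measurable M"
    and "AE x in M. 0 < W x"
    and "integrable M (\<lambda>x. W x ^ 4)"
    and "poisson_point_process P (cycle_intensity M W) \<eta>"
  shows "\<forall>N. \<exists>C>0. \<forall>A\<subseteq>{3..N}. \<forall>n\<ge>3.
    d_TV (grg M W n) (cycle_count A) P (\<lambda>\<omega>. count_in (\<eta> \<omega>) A) \<le> C / real n"
proof
  fix N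
  interpret M: prob_space M by (rule assms(1))
  define D where "D = distr M borel W"
  interpret D: prob_space D unfolding D_def using assms(1,2) by (rule prob_space.prob_space_distr)
  have [measurable]: "W \<in> borel_measurable M" by (rule assms(2))
  have pos: "AE z in D. 0 < z" unfolding D_def using assms(3) by (subst AE_distr_iff) auto
  have i4: "integrable D (\<lambda>z. z ^ 4)"
    unfolding D_def using assms(4) by (subst integrable_distr_eq) auto
  have low: "integrable D (\<lambda>z. z ^ k)" if "k \<le> 4" for k
  proof (rule Bochner_Integration.integrable_bound)
    show "integrable D (\<lambda>z. 1 + z ^ 4)"
      by (intro Bochner_Integration.integrable_add D.integrable_const i4)
    show "(\<lambda>z. z ^ k) \<in> borel_measurable D" by (simp add: D_def)
    show "AE z in D. norm (z ^ k) \<le> norm (1 + z ^ 4)"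
    proof (rule AE_I2)
      fix z :: real
      have "\<bar>z\<bar> ^ k \<le> 1 + \<bar>z\<bar> ^ 4"
      proof (cases "\<bar>z\<bar> \<le> 1")
        case True
        then have "\<bar>z\<bar> ^ k \<le> 1" by (intro power_le_one) auto
        then show ?thesis using zero_le_power[of "\<bar>z\<bar>" 4] by linarith
      next
        case False
        then have "\<bar>z\<bar> ^ k \<le> \<bar>z\<bar> ^ 4" using that by (intro power_increasing) auto
        then show ?thesis by linarith
      qed
      then show "norm (z ^ k) \<le> norm (1 + z ^ 4)" by (simp add: power_abs)
    qed
  qed
  define m1 where "m1 = (\<integral>z. z \<partial>D)"
  define m2 where "m2 = (\<integral>z. z\<^sup>2 \<partial>D)"
  have i1: "integrable D (\<lambda>z. z)" and i2: "integrable D (\<lambda>z. z\<^sup>2)" and i3: "integrable D (\<lambda>z. z ^ 3)"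
    using low[of 1] low[of 2] low[of 3] by auto
  have W1: "(\<integral>x. W x \<partial>M) = m1" and W2: "(\<integral>x. W x ^ 2 \<partial>M) = m2"
    unfolding m1_def m2_def D_def by (simp_all add: integral_distr)
  have "0 < m1"
    unfolding m1_def using pos D.integral_less_AE_space[of "\<lambda>_. 0" "\<lambda>z. z"] i1 D.emeasure_space_1 by simp
  moreover have "0 < m2"
  proof -
    have "AE z in D. 0 < z\<^sup>2" using pos by eventually_elim simp
    then show ?thesis
      unfolding m2_def using D.integral_less_AE_space[of "\<lambda>_. 0" "\<lambda>z. z\<^sup>2"] i2 D.emeasure_space_1 by simp
  qed
  ultimately have m: "0 < m1" "0 < m2" by auto
  obtain C where C: "0 \<le> C" and expansion: "\<forall>A\<subseteq>{3..N}. \<forall>h. (\<forall>j. \<bar>h j\<bar> \<le> 1) \<longrightarrow>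
    (\<exists>a. \<forall>n\<ge>1. \<forall>w. (\<forall>i\<in>{1..n}. 0 < w i) \<longrightarrow>
      \<bar>measure_pmf.expectation (grg_given_weights n w) (\<lambda>G. h (cycle_count A G))
          - poisson_mean (cycle_mean A (m2 / m1)) h
          - a / real n * (\<Sum>i=1..n. m1 * (w i)\<^sup>2 - m2 * w i)\<bar>
        \<le> C / (real n)\<^sup>2 * ((\<Sum>i=1..n. w i ^ 4) + (\<Sum>i=1..n. m1 * (w i)\<^sup>2 - m2 * w i)\<^sup>2
            + (\<Sum>i=1..n. w i - m1)\<^sup>2 + (\<Sum>i=1..n. (w i)\<^sup>2 - m2)\<^sup>2))"
    using expansion_given_weights[OF m, of N] by (elim exE conjE)
  \<comment> \<open>The three centred functions of a weight whose sums control the error. Their second moments are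
    finite because \<open>W\<close> has a fourth moment.\<close>
  define g0 g1 g2 where "g0 z = m1 * z\<^sup>2 - m2 * z" and "g1 z = z - m1" and "g2 z = z\<^sup>2 - m2" for z :: real
  have g_int: "integrable D g0" "integrable D g1" "integrable D g2"
    unfolding g0_def g1_def g2_def using i1 i2 by auto
  have g_centred: "(\<integral>z. g0 z \<partial>D) = 0" "(\<integral>z. g1 z \<partial>D) = 0" "(\<integral>z. g2 z \<partial>D) = 0"
    unfolding g0_def g1_def g2_def using i1 i2 D.prob_space
    by (simp_all add: m1_def[symmetric] m2_def[symmetric])
  have "(g0 z)\<^sup>2 = m1\<^sup>2 * z ^ 4 - 2 * m1 * m2 * z ^ 3 + m2\<^sup>2 * z\<^sup>2"
    "(g1 z)\<^sup>2 = z\<^sup>2 - 2 * m1 * z + m1\<^sup>2" "(g2 z)\<^sup>2 = z ^ 4 - 2 * m2 * z\<^sup>2 + m2\<^sup>2" for z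
    by (simp_all add: g0_def g1_def g2_def algebra_simps power2_eq_square power3_eq_cube power4_eq_xxxx)
  then have g_sq: "integrable D (\<lambda>z. (g0 z)\<^sup>2)" "integrable D (\<lambda>z. (g1 z)\<^sup>2)" "integrable D (\<lambda>z. (g2 z)\<^sup>2)"
    using i1 i2 i3 i4 by simp_all
  define v where "v = (\<integral>z. z ^ 4 \<partial>D) + (\<integral>z. (g0 z)\<^sup>2 \<partial>D) + (\<integral>z. (g1 z)\<^sup>2 \<partial>D) + (\<integral>z. (g2 z)\<^sup>2 \<partial>D)"
  have v: "0 \<le> v" unfolding v_def by (intro add_nonneg_nonneg integral_nonneg) auto
  have event: "\<bar>measure (grg M W n) {G \<in> space (grg M W n). cycle_count A G \<in> B} -
      measure P {\<omega> \<in> space P. count_in (\<eta> \<omega>) A \<in> B}\<bar> \<le> C * v / real n"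
    if A: "A \<subseteq> {3..N}" and n: "1 \<le> n" for A n B
  proof -
    let ?P = "\<Pi>\<^sub>M i\<in>{1..n}. D"
    interpret product_prob_space "\<lambda>_. D" "{1..n}" ..
    define h where "h j = (of_bool (j \<in> B) :: real)" for j
    define \<phi> where "\<phi> w = measure_pmf.expectation (grg_given_weights n w) (\<lambda>G. h (cycle_count A G))" for w
    define \<mu> where "\<mu> = poisson_mean (cycle_mean A (m2 / m1)) h"
    have h: "\<forall>j. \<bar>h j\<bar> \<le> 1" by (simp add: h_def)
    obtain a where a: "\<And>w. \<forall>i\<in>{1..n}. 0 < w i \<Longrightarrow>
        \<bar>\<phi> w - \<mu> - a / real n * (\<Sum>i=1..n. g0 (w i))\<bar>
        \<le> C / (real n)\<^sup>2 * ((\<Sum>i=1..n. w i ^ 4) + (\<Sum>i=1..n. g0 (w i))\<^sup>2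
            + (\<Sum>i=1..n. g1 (w i))\<^sup>2 + (\<Sum>i=1..n. g2 (w i))\<^sup>2)"
      using expansion[THEN spec, THEN mp, OF A, THEN spec, THEN mp, OF h] n
      unfolding \<phi>_def \<mu>_def g0_def g1_def g2_def by blast
    have \<phi>_meas: "\<phi> \<in> borel_measurable ?P"
      unfolding \<phi>_def h_def D_def by (rule measure_grg(2)[OF assms(1,2)])
    have \<phi>_int: "integrable ?P \<phi>"
    proof (rule P.integrable_const_bound[where B = 1, OF _ \<phi>_meas])
      show "AE w in ?P. norm (\<phi> w) \<le> 1"
      proof (rule AE_I2)
        fix w
        have "norm (\<phi> w) \<le> measure_pmf.expectation (grg_given_weights n w) (\<lambda>G. 1)"
          unfolding \<phi>_def real_norm_def
          by (intro order_trans[OF integral_abs_bound] integral_mono)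
            (auto intro!: measure_pmf.integrable_const_bound[where B = 1] simp: h_def)
        then show "norm (\<phi> w) \<le> 1" by simp
      qed
    qed
    have AE_pos: "AE w in ?P. \<forall>i\<in>{1..n}. 0 < w i"
      by (intro AE_finite_allI AE_component pos) auto
    note I0 = integrable_sum_iid[OF D.prob_space_axioms, of "{1..n}"]
    note I0' = integral_sum_iid[OF D.prob_space_axioms, of "{1..n}"]
    note I2 = integrable_square_sum_iid[OF D.prob_space_axioms, of "{1..n}"]
    note I2' = integral_square_sum_iid[OF D.prob_space_axioms, of "{1..n}"]
    let ?lin = "\<lambda>w. a / real n * (\<Sum>i=1..n. g0 (w i))"
    let ?R = "\<lambda>w. (\<Sum>i=1..n. w i ^ 4) + (\<Sum>i=1..n. g0 (w i))\<^sup>2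
            + (\<Sum>i=1..n. g1 (w i))\<^sup>2 + (\<Sum>i=1..n. g2 (w i))\<^sup>2"
    have J: "integrable ?P (\<lambda>w. \<Sum>i=1..n. w i ^ 4)" "integrable ?P (\<lambda>w. (\<Sum>i=1..n. g0 (w i))\<^sup>2)"
        "integrable ?P (\<lambda>w. (\<Sum>i=1..n. g1 (w i))\<^sup>2)" "integrable ?P (\<lambda>w. (\<Sum>i=1..n. g2 (w i))\<^sup>2)"
      by (intro I0 I2 finite_atLeastAtMost i4 g_int g_sq g_centred)+
    have R_int: "integrable ?P ?R"
      by (intro Bochner_Integration.integrable_add J)
    have "(\<integral>w. ?R w \<partial>?P) = (\<integral>w. (\<Sum>i=1..n. w i ^ 4) \<partial>?P) + (\<integral>w. (\<Sum>i=1..n. g0 (w i))\<^sup>2 \<partial>?P)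
        + (\<integral>w. (\<Sum>i=1..n. g1 (w i))\<^sup>2 \<partial>?P) + (\<integral>w. (\<Sum>i=1..n. g2 (w i))\<^sup>2 \<partial>?P)"
      using J by (simp only: Bochner_Integration.integral_add Bochner_Integration.integrable_add)
    also have "\<dots> = n * v"
      unfolding I0'[OF finite_atLeastAtMost i4] I2'[OF finite_atLeastAtMost g_int(1) g_sq(1) g_centred(1)]
        I2'[OF finite_atLeastAtMost g_int(2) g_sq(2) g_centred(2)]
        I2'[OF finite_atLeastAtMost g_int(3) g_sq(3) g_centred(3)]
      by (simp add: v_def algebra_simps)
    finally have R: "(\<integral>w. ?R w \<partial>?P) = n * v" .
    have lin_int: "integrable ?P ?lin"
      by (intro Bochner_Integration.integrable_mult_right I0 finite_atLeastAtMost g_int)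
    \<comment> \<open>The term of order \<open>n powr (- 1 / 2)\<close> has mean zero.\<close>
    have lin: "(\<integral>w. ?lin w \<partial>?P) = 0"
      using I0'[OF finite_atLeastAtMost g_int(1)] g_centred(1) by simp
    have "measure (grg M W n) {G \<in> space (grg M W n). cycle_count A G \<in> B} = (\<integral>w. \<phi> w \<partial>?P)"
      unfolding \<phi>_def h_def D_def by (rule measure_grg(1)[OF assms(1,2)])
    moreover have "measure P {\<omega> \<in> space P. count_in (\<eta> \<omega>) A \<in> B} = \<mu>"
      unfolding \<mu>_def h_def using m
      by (intro measure_poisson_point_process[OF assms(5) A]) (simp_all add: W1 W2)
    moreover have "(\<integral>w. \<phi> w - \<mu> - ?lin w \<partial>?P) = (\<integral>w. \<phi> w \<partial>?P) - \<mu>"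
    proof -
      have "(\<integral>w. \<phi> w - \<mu> - ?lin w \<partial>?P) = (\<integral>w. \<phi> w \<partial>?P) - (\<integral>w. \<mu> \<partial>?P) - (\<integral>w. ?lin w \<partial>?P)"
        by (simp only: Bochner_Integration.integral_diff Bochner_Integration.integrable_diff
            \<phi>_int lin_int P.integrable_const)
      then show ?thesis unfolding lin using P.prob_space by simp
    qed
    ultimately have "\<bar>measure (grg M W n) {G \<in> space (grg M W n). cycle_count A G \<in> B} -
        measure P {\<omega> \<in> space P. count_in (\<eta> \<omega>) A \<in> B}\<bar> = \<bar>\<integral>w. \<phi> w - \<mu> - ?lin w \<partial>?P\<bar>"
      by simp
    also have "\<dots> \<le> (\<integral>w. \<bar>\<phi> w - \<mu> - ?lin w\<bar> \<partial>?P)" by (rule integral_abs_bound)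
    also have "\<dots> \<le> (\<integral>w. C / (real n)\<^sup>2 * ?R w \<partial>?P)"
    proof (rule integral_mono_AE)
      show "integrable ?P (\<lambda>w. \<bar>\<phi> w - \<mu> - ?lin w\<bar>)"
        by (intro integrable_abs Bochner_Integration.integrable_diff \<phi>_int lin_int P.integrable_const)
      show "integrable ?P (\<lambda>w. C / (real n)\<^sup>2 * ?R w)"
        using R_int by (intro Bochner_Integration.integrable_mult_right)
      show "AE w in ?P. \<bar>\<phi> w - \<mu> - ?lin w\<bar> \<le> C / (real n)\<^sup>2 * ?R w"
        using AE_pos by eventually_elim (rule a)
    qed
    also have "\<dots> = C / (real n)\<^sup>2 * (n * v)"
      by (simp only: Bochner_Integration.integral_mult_right_zero R)
    also have "\<dots> = C * v / real n" using n by (simp add: power2_eq_square)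
    finally show ?thesis .
  qed
  show "\<exists>C>0. \<forall>A\<subseteq>{3..N}. \<forall>n\<ge>3.
    d_TV (grg M W n) (cycle_count A) P (\<lambda>\<omega>. count_in (\<eta> \<omega>) A) \<le> C / real n"
  \<comment> \<open>The summand 1 only serves to make the constant positive.\<close>
  proof (rule exI[of _ "C * v + 1"], intro conjI allI impI)
    show "0 < C * v + 1" using C v by (simp add: add_nonneg_pos)
    fix A n assume A: "A \<subseteq> {3..N}" and n: "3 \<le> (n :: nat)"
    have "C * v / real n \<le> (C * v + 1) / real n" by (intro divide_right_mono) auto
    then show "d_TV (grg M W n) (cycle_count A) P (\<lambda>\<omega>. count_in (\<eta> \<omega>) A) \<le> (C * v + 1) / real n"
      unfolding d_TV_def using n
      by (intro cSUP_least) (auto intro!: order_trans[OF event[OF A]])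
  qed
qed

end
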